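(* For every $N\in\mathbb{N}$ and every integer $n\ge n(N)$ we have $$p_{24}(n)=\frac{e^{4\pi\sqrt{n}}}{\sqrt{2}\, n^{27/4}}\left(\sum_{m=0}^{N}\frac{\widetilde{B}_m}{n^{m/2}}+R_N(n)\right),\qquad |R_N(n)|\le E_N\, n^{-\frac{N+1}{2}},$$ where $n(N)$, $\widetilde B_m$ and $E_N$ are as defined in the context.
   Context: $p_{24}(n)$ denotes the number of $24$-colored partitions of $n$, i.e. $\prod_{n\ge1}(1-q^n)^{-24}=\sum_{n\ge0}p_{24}(n)q^n$. For $b\in\mathbb{R}$, $(b)_0=1$ and $(b)_m=b(b+1)\cdots(b+m-1)$ for $m\ge1$. Constants: For $m\in\mathbb{N}_0$ let $a_m(13)=\binom{25/2}{m}\left(\tfrac{27}{2}\right)_m/2^m$. For $N\in\mathbb{N}$ let $E(13,N)=1+\left(\frac{2}{\pi^3}\right)^{1/2}\sqrt{\frac{14}{12-N}}\sqrt{N+\frac{29}{2}}\left(\sqrt{\frac{1}{13-N}}-\sqrt{\frac{1}{14}}\right)$ if $N\le 11$; $E(13,12)=1+\frac{\sqrt{29}}{\pi}(\sqrt{14}-1)$; and for $N\ge13$, $E(13,N)=1+\frac{2\sqrt\pi+3^4\cdot5}{2\sqrt\pi}\sqrt{2N+29}+\frac{\sqrt{2N+29}\log(N+1)}{2\sqrt\pi}+\frac{3^4\cdot5\sqrt{2N+29}\log(N+1)}{2\sqrt\pi(N+2)}$. Let $C^*(1)=1$ and $C^*(m)=6m\log m-m\log\log m$ for $m\ge2$.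 Let $n(N)=\max\left\{138,\left\lceil\left(\frac{C^*(N+2)}{4\pi}\right)^2+1\right\rceil\right\}$. Coefficients: $A_1(0)=1$ and for $k\ge1$, $A_1(k)=\frac{(-1)^k(\frac12-k)_{k+1}}{k}\sum_{\ell=1}^k\frac{(-1)^\ell(-k)_\ell}{(k+\ell)!}\frac{(4\pi)^{2\ell}}{(2\ell-1)!}$; for $k\ge0$, $A_2(k)=(-1)^{k+1}(\frac12-k)_{k+1}\sum_{\ell=0}^k\frac{(-1)^\ell(-k)_\ell}{(\ell+k+1)!}\frac{(4\pi)^{2\ell+1}}{(2\ell)!}$. For $\alpha\in\mathbb{R}$, $A_m(\alpha)=(-1)^{m/2}\binom{-\alpha}{m/2}$ if $m$ is even and $A_m(\alpha)=0$ if $m$ is odd; write $A_m=A_m(27/4)$. For $m\ge0$: $\widehat B_{2m}=\sum_{\ell=0}^mA_1(\ell)A_{2m-2\ell}$, $\widehat B_{2m+1}=\sum_{\ell=0}^mA_2(\ell)A_{2m-2\ell}$; $C_{2m}=(-1)^m\sum_{k=0}^m\binom{-k}{m-k}\frac{(-1)^ka_{2k}(13)}{(4\pi)^{2k}}$, $C_{2m+1}=(-1)^{m+1}\sum_{k=0}^m\binom{-\frac{2k+1}{2}}{m-k}\frac{(-1)^ka_{2k+1}(13)}{(4\pi)^{2k+1}}$; and $\widetilde B_m=\sum_{k=0}^m\widehat B_kC_{m-k}$. Error constants: $E_2=2\sqrt{2\pi}\cosh(4\pi)$; $E_3(\alpha,N)=2\alpha^{\frac{N+1}{2}}$; $E_4(N)=3E_2E_3(\tfrac{27}{4},N)N$;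 $E_5(N)=17\cdot69^{\frac{N+1}{2}}N!$; $E_{N,1}=\frac{2E(13,N)|a_{N+1}(13)|}{(4\pi)^{N+1}}$; $E_6(N)=2(E_5(N)+E_{N,1})+18\cdot N!$; and $E_N=E_2\frac{3E_5(N)+5E_6(N)}{30}+E_4(N)(28\cdot N!+E_6(N))+5E_5(N)+9E_6(N)$. *)

theory Defs
  imports "HOL-Analysis.Analysis" "HOL-Library.Multiset"
begin

text \<open>A part of size \<open>j\<close> and colour \<open>c\<close> is encoded as the pair \<open>(j, c)\<close>.
  Since parts are positive, the set below is finite and \<open>card\<close> really counts it; the counts
  have generating function \<open>\<Prod>j\<ge>1. (1 - q^j)^(-r)\<close>.\<close>

definition colored_partitions :: "nat \<Rightarrow> nat \<Rightarrow> (nat \<times> nat) multiset set" where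
  "colored_partitions r n =
     {M. (\<forall>(j, c) \<in># M. 1 \<le> j \<and> c < r) \<and> (\<Sum>(j, c) \<in># M. j) = n}"

definition p24 :: "nat \<Rightarrow> nat" where
  "p24 n = card (colored_partitions 24 n)"

definition a13 :: "nat \<Rightarrow> real" where
  "a13 m = ((25/2) gchoose m) * pochhammer (27/2) m / 2 ^ m"

definition E13 :: "nat \<Rightarrow> real" where
  "E13 N =
    (if N \<le> 11 then
       1 + sqrt (2 / pi ^ 3) * sqrt (14 / (12 - real N)) * sqrt (real N + 29/2)
           * (sqrt (1 / (13 - real N)) - sqrt (1/14))
     else if N = 12 then 1 + sqrt 29 / pi * (sqrt 14 - 1)
     else
       1 + (2 * sqrt pi + 3 ^ 4 * 5) / (2 * sqrt pi) * sqrt (2 * real N + 29)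
         + sqrt (2 * real N + 29) * ln (real N + 1) / (2 * sqrt pi)
         + 3 ^ 4 * 5 * sqrt (2 * real N + 29) * ln (real N + 1)
             / (2 * sqrt pi * (real N + 2)))"

text \<open>Only used for \<open>m \<ge> 1\<close>; the value at \<open>0\<close> is a dummy.\<close>

definition C_star :: "nat \<Rightarrow> real" where
  "C_star m = (if m \<le> 1 then 1 else 6 * real m * ln (real m) - real m * ln (ln (real m)))"

definition n_threshold :: "nat \<Rightarrow> int" where
  "n_threshold N = max 138 \<lceil>(C_star (N + 2) / (4 * pi)) ^ 2 + 1\<rceil>"

definition A1 :: "nat \<Rightarrow> real" where
  "A1 k =
    (if k = 0 then 1
     else (-1) ^ k * pochhammer (1/2 - real k) (k + 1) / real k *
       (\<Sum>l = 1..k. (-1) ^ l * pochhammer (- real k) l / fact (k + l)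
                      * ((4 * pi) ^ (2 * l) / fact (2 * l - 1))))"

definition A2 :: "nat \<Rightarrow> real" where
  "A2 k = (-1) ^ (k + 1) * pochhammer (1/2 - real k) (k + 1) *
     (\<Sum>l = 0..k. (-1) ^ l * pochhammer (- real k) l / fact (l + k + 1)
                    * ((4 * pi) ^ (2 * l + 1) / fact (2 * l)))"

definition A_alpha :: "real \<Rightarrow> nat \<Rightarrow> real" where
  "A_alpha \<alpha> m = (if even m then (-1) ^ (m div 2) * ((- \<alpha>) gchoose (m div 2)) else 0)"

definition B_hat :: "nat \<Rightarrow> real" where
  "B_hat j =
    (let m = j div 2 in
     if even j then \<Sum>l = 0..m. A1 l * A_alpha (27/4) (2 * m - 2 * l)
     else \<Sum>l = 0..m. A2 l * A_alpha (27/4) (2 * m - 2 * l))"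

definition C_coeff :: "nat \<Rightarrow> real" where
  "C_coeff j =
    (let m = j div 2 in
     if even j then
       (-1) ^ m * (\<Sum>k = 0..m. ((- real k) gchoose (m - k))
                     * ((-1) ^ k * a13 (2 * k) / (4 * pi) ^ (2 * k)))
     else
       (-1) ^ (m + 1) * (\<Sum>k = 0..m. ((- (2 * real k + 1) / 2) gchoose (m - k))
                     * ((-1) ^ k * a13 (2 * k + 1) / (4 * pi) ^ (2 * k + 1))))"

definition B_tilde :: "nat \<Rightarrow> real" where
  "B_tilde m = (\<Sum>k = 0..m. B_hat k * C_coeff (m - k))"

definition E2 :: real where
  "E2 = 2 * sqrt (2 * pi) * cosh (4 * pi)"

definition E3 :: "real \<Rightarrow> nat \<Rightarrow> real" where
  "E3 \<alpha> N = 2 * \<alpha> powr ((real N + 1) / 2)"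

definition E4 :: "nat \<Rightarrow> real" where
  "E4 N = 3 * E2 * E3 (27/4) N * real N"

definition E5 :: "nat \<Rightarrow> real" where
  "E5 N = 17 * 69 powr ((real N + 1) / 2) * fact N"

definition EN1 :: "nat \<Rightarrow> real" where
  "EN1 N = 2 * E13 N * \<bar>a13 (N + 1)\<bar> / (4 * pi) ^ (N + 1)"

definition E6 :: "nat \<Rightarrow> real" where
  "E6 N = 2 * (E5 N + EN1 N) + 18 * fact N"

definition E_total :: "nat \<Rightarrow> real" where
  "E_total N =
     E2 * ((3 * E5 N + 5 * E6 N) / 30) + E4 N * (28 * fact N + E6 N) + 5 * E5 N + 9 * E6 N"

end

(*
  The generating function of p24 is exp (24 * L), L = sum sigma(k) / k * q^k, because of the
  recurrence n * p24 n = 24 * sum sigma(k) * p24 (n - k). Eisenstein's double series gives the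
  quasi-modularity of E_2 = 1 - 24 * sum sigma(k) * q^k, the logarithmic derivative of
  h(z) = 1 / Delta(z), hence h(z) = z^12 * h(-1/z). Integrating h over the segment
  |Re z| <= 1/2, Im z = (n-1)^(-1/2), and replacing h(-1/z) by its single polar term
  exp(2 pi i / z) costs only O(exp(5/2 pi sqrt n)): on the rest of h(-1/z) the inversion formula
  is applied a second time, on the imaginary axis. The polar term is evaluated by a residue and
  equals a Bessel function I_13(4 pi sqrt(n-1)); its Poisson integral and the binomial series of
  (1-u)^(25/2) give the Hankel expansion with a remainder that is uniform in N. In s = n^(-1/2)
  every term of that expansion is a function holomorphic in the unit disc, with Taylor coefficients
  given by the A's, B's and C's of the statement, and Cauchy's estimate on |s| = 1/2 bounds the
  tails. Since E_N exceeds 10^7 * 21^(N+1) * (N+1)!, all errors fit for every n >= 138.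
*)

theory Submission
  imports Defs "HOL-Complex_Analysis.Complex_Analysis"
begin

section \<open>Coloured partitions and the divisor sum\<close>

text \<open>One segment suffices without a Farey dissection: at height y = 1/sqrt(n-1) the part of
  h(-1/z) beyond its polar term grows at most like exp(2 pi |z|^2 / y), and |z|^2 <= 1/4 + y^2.
  Together with the factor exp(2 pi (n-1) y) this stays near exp((2 + 1/2) pi sqrt n), against exp(4
  pi sqrt n) for the main term. The Hankel expansion lives in 1/sqrt(n-1), the statement in s =
  1/sqrt n. Three factors translate: exp(4 pi (sqrt(n-1) - sqrt n)) = exp(-4 pi w) with w = s / (1 +
  sqrt(1-s^2)), then (1-s^2)^(-27/4), and (s / sqrt(1-s^2))^k. Since 2 w = s (1 + w^2), the powers
  of w have closed coefficients, the origin of \<open>A1\<close> and \<open>A2\<close>; the second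
  factor gives \<open>A_alpha\<close>, the third \<open>C_coeff\<close>. The obstacle is uniformity
  in N: the expansion is only asymptotic, so every bound must be explicit with growth K^(N+1) *
  (N+1)! and K at most about 21. Here 21 is just below sqrt(69 * 27/4), the base hidden in E_4 *
  E_5, while the radius 1/2 in Cauchy's estimate costs only 2^(N+1). That slack pays for all crude
  constants.\<close>

definition divisor_sum :: "nat \<Rightarrow> nat" where
  "divisor_sum k = (\<Sum>d | d dvd k. d)"

lemma sum_mset_eq_sum_count:
  assumes "finite A" "set_mset M \<subseteq> A"
  shows "(\<Sum>x\<in>#M. f x) = (\<Sum>x\<in>A. count M x * (f x :: nat))"
  using assms(2)
proof (induction M)
  case (add y M)
  have "(\<Sum>x\<in>A. count (add_mset y M) x * f x) = (\<Sum>x\<in>A. (if x = y then f x else 0) + count M x * f x)"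
    by (intro sum.cong) auto
  also have "\<dots> = f y + (\<Sum>x\<in>A. count M x * f x)"
    using add.prems assms(1) by (simp add: sum.distrib)
  finally show ?case using add by simp
qed simp

lemma colored_partitions_parts:
  assumes "M \<in> colored_partitions r n"
  shows "set_mset M \<subseteq> {1..n} \<times> {..<r}" "size M \<le> n"
proof -
  from assms have 1: "\<And>j c. (j, c) \<in># M \<Longrightarrow> 1 \<le> j \<and> c < r" and 2: "(\<Sum>(j, c)\<in>#M. j) = n"
    unfolding colored_partitions_def by blast+
  have "j \<le> n" if m: "(j, c) \<in># M" for j c
  proof -
    obtain K where "M = add_mset (j, c) K" using multi_member_split[OF m] by blast
    with 2 show ?thesis by simp
  qed
  with 1 show "set_mset M \<subseteq> {1..n} \<times> {..<r}" by (intro subrelI) simp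
  have "size M = (\<Sum>x\<in>#M. 1)" by (rule size_eq_sum_mset)
  also have "\<dots> \<le> (\<Sum>(j, c)\<in>#M. j)"
    by (rule sum_mset_mono) (use 1 in auto)
  finally show "size M \<le> n" using 2 by simp
qed

lemma finite_colored_partitions: "finite (colored_partitions r n)"
proof (rule finite_subset)
  show "colored_partitions r n \<subseteq> mset ` {xs. set xs \<subseteq> {1..n} \<times> {..<r} \<and> length xs \<le> n}"
  proof
    fix M assume M: "M \<in> colored_partitions r n"
    obtain xs where xs: "M = mset xs" using ex_mset by metis
    with colored_partitions_parts[OF M] show "M \<in> mset ` {xs. set xs \<subseteq> {1..n} \<times> {..<r} \<and> length xs \<le> n}"
      by auto
  qed
  show "finite (mset ` {xs. set xs \<subseteq> {1..n} \<times> {..<r} \<and> length xs \<le> n})"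
    by (intro finite_imageI finite_lists_length_le) auto
qed

text \<open>Adding \<open>i\<close> copies of the part is injective and has exactly the required
  partitions as image; if \<open>i * j > n\<close>, the copies alone outweigh
  \<open>n\<close>.\<close>

lemma card_colored_partitions_count_ge:
  assumes x: "1 \<le> j" "c < r"
  shows "card {M \<in> colored_partitions r n. i \<le> count M (j, c)} =
    (if i * j \<le> n then card (colored_partitions r (n - i * j)) else 0)"
proof -
  let ?R = "replicate_mset i (j, c)"
  have wt: "(\<Sum>(j, c)\<in>#?R. j) = i * j" by simp
  have dec: "\<exists>K. M = K + ?R" if "i \<le> count M (j, c)" for M
  proof -
    have "?R \<subseteq># M" using that by (simp add: count_le_replicate_mset_subset_eq)
    thus ?thesis by (metis subset_mset.diff_add)
  qed
  show ?thesis
  proof (cases "i * j \<le> n")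
    case True
    have "{M \<in> colored_partitions r n. i \<le> count M (j, c)} =
        (\<lambda>K. K + ?R) ` colored_partitions r (n - i * j)" (is "?A = ?f ` ?B")
    proof (intro equalityI subsetI)
      fix M assume M: "M \<in> ?A"
      then obtain K where K: "M = K + ?R" using dec by auto
      with M wt show "M \<in> ?f ` ?B" by (auto simp: colored_partitions_def)
    next
      fix M assume "M \<in> ?f ` ?B"
      thus "M \<in> ?A" using x True by (auto simp: colored_partitions_def split: if_splits)
    qed
    moreover have "inj_on ?f ?B" by (auto simp: inj_on_def)
    ultimately show ?thesis using True by (simp add: card_image)
  next
    case False
    have "{M \<in> colored_partitions r n. i \<le> count M (j, c)} = {}"
    proof (intro equals0I)
      fix M assume M: "M \<in> {M \<in> colored_partitions r n. i \<le> count M (j, c)}"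
      then obtain K where "M = K + ?R" using dec by auto
      with M False show False by (auto simp: colored_partitions_def)
    qed
    thus ?thesis using False by (simp only: card.empty if_False)
  qed
qed

text \<open>Lattice points under a hyperbola are grouped by their product. This is where divisor
  sums enter: part size times multiplicity becomes \<open>k\<close>, and the part size ranges over
  its divisors.\<close>

lemma sum_by_product:
  fixes g :: "nat \<Rightarrow> nat \<Rightarrow> nat"
  shows "(\<Sum>j=1..n. \<Sum>i=1..n. if i * j \<le> n then g j (i * j) else 0) =
    (\<Sum>k=1..n. \<Sum>j | j dvd k. g j k)"
proof -
  have "(\<Sum>j=1..n. \<Sum>i=1..n. if i * j \<le> n then g j (i * j) else 0) =
      (\<Sum>(j, i) \<in> {1..n} \<times> {1..n}. if i * j \<le> n then g j (i * j) else 0)"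
    by (simp add: sum.cartesian_product)
  also have "\<dots> = (\<Sum>(j, i) \<in> {(j, i). 1 \<le> j \<and> 1 \<le> i \<and> i * j \<le> n}. g j (i * j))"
  proof (rule sum.mono_neutral_cong_right)
    show "{(j, i). 1 \<le> j \<and> 1 \<le> i \<and> i * j \<le> n} \<subseteq> {1..n} \<times> {1..n}"
    proof clarify
      fix j i :: nat assume h: "1 \<le> j" "1 \<le> i" "i * j \<le> n"
      have "1 * j \<le> i * j" "i * 1 \<le> i * j" using h by (intro mult_le_mono; simp)+
      with h have "j \<le> n" "i \<le> n" by linarith+
      with h show "j \<in> {1..n} \<and> i \<in> {1..n}" by simp
    qed
  qed (auto split: if_splits)
  also have "\<dots> = (\<Sum>(k, j) \<in> (SIGMA k:{1..n}. {j. j dvd k}). g j k)"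
  proof (rule sum.reindex_bij_witness[where i = "\<lambda>(k, j). (j, k div j)" and j = "\<lambda>(j, i). (i * j, j)"])
    fix a :: "nat \<times> nat" assume "a \<in> {(j, i). 1 \<le> j \<and> 1 \<le> i \<and> i * j \<le> n}"
    then obtain j i where a: "a = (j, i)" "1 \<le> j" "1 \<le> i" "i * j \<le> n" by auto
    have "1 * 1 \<le> i * j" using a by (intro mult_le_mono)
    with a show "(case case a of (j, i) \<Rightarrow> (i * j, j) of (k, j) \<Rightarrow> (j, k div j)) = a"
      "(case a of (j, i) \<Rightarrow> (i * j, j)) \<in> (SIGMA k:{1..n}. {j. j dvd k})"
      "(case case a of (j, i) \<Rightarrow> (i * j, j) of (k, j) \<Rightarrow> g j k) = (case a of (j, i) \<Rightarrow> g j (i * j))"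
      by simp_all
  next
    fix b :: "nat \<times> nat" assume "b \<in> (SIGMA k:{1..n}. {j. j dvd k})"
    then obtain k j where b: "b = (k, j)" "1 \<le> k" "k \<le> n" "j dvd k" by auto
    then obtain m where m: "k = j * m" by auto
    with b have "j \<noteq> 0" "m \<noteq> 0" by auto
    with b m show "(case case b of (k, j) \<Rightarrow> (j, k div j) of (j, i) \<Rightarrow> (i * j, j)) = b"
      "(case b of (k, j) \<Rightarrow> (j, k div j)) \<in> {(j, i). 1 \<le> j \<and> 1 \<le> i \<and> i * j \<le> n}"
      by (simp_all add: mult.commute)
  qed
  also have "\<dots> = (\<Sum>k=1..n. \<Sum>j | j dvd k. g j k)"
    by (rule sum.Sigma[symmetric]) (auto intro: finite_divisors_nat)
  finally show ?thesis .
qed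

text \<open>Double counting of the pairs (partition, number of copies \<open>i\<close> of a part it contains at
  least \<open>i\<close> times): removing these \<open>i\<close> copies leaves an arbitrary partition.\<close>

lemma colored_partitions_recurrence:
  "n * card (colored_partitions r n) =
     r * (\<Sum>k=1..n. divisor_sum k * card (colored_partitions r (n - k)))"
proof -
  let ?C = "colored_partitions r"
  let ?X = "{1..n} \<times> {..<r}"
  have w: "n = (\<Sum>x\<in>?X. \<Sum>i=1..n. if i \<le> count M x then fst x else 0)" if "M \<in> ?C n" for M
  proof -
    have "(\<lambda>(j, c). j) = (fst :: nat \<times> nat \<Rightarrow> nat)" by auto
    hence "n = (\<Sum>x\<in>#M. fst x)" using that by (simp add: colored_partitions_def)
    also have "\<dots> = (\<Sum>x\<in>?X. count M x * fst x)"
      by (rule sum_mset_eq_sum_count) (use colored_partitions_parts[OF that] in auto)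
    also have "\<dots> = (\<Sum>x\<in>?X. \<Sum>i=1..n. if i \<le> count M x then fst x else 0)"
    proof (intro sum.cong refl)
      fix x
      have "count M x \<le> n"
        using count_le_size[of M x] colored_partitions_parts(2)[OF that] by linarith
      hence "{i\<in>{1..n}. i \<le> count M x} = {1..count M x}" by auto
      thus "count M x * fst x = (\<Sum>i=1..n. if i \<le> count M x then fst x else 0)"
        by (simp flip: sum.inter_filter)
    qed
    finally show ?thesis .
  qed
  have "n * card (?C n) = (\<Sum>M\<in>?C n. n)" by simp
  also have "\<dots> = (\<Sum>M\<in>?C n. \<Sum>x\<in>?X. \<Sum>i=1..n. if i \<le> count M x then fst x else 0)"
    by (rule sum.cong[OF refl w])
  also have "\<dots> = (\<Sum>x\<in>?X. \<Sum>M\<in>?C n. \<Sum>i=1..n. if i \<le> count M x then fst x else 0)"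
    by (rule sum.swap)
  also have "\<dots> = (\<Sum>x\<in>?X. \<Sum>i=1..n. \<Sum>M\<in>?C n. if i \<le> count M x then fst x else 0)"
    by (intro sum.cong refl sum.swap)
  also have "\<dots> = (\<Sum>x\<in>?X. \<Sum>i=1..n. fst x * card {M\<in>?C n. i \<le> count M x})"
    by (intro sum.cong refl) (simp add: finite_colored_partitions flip: sum.inter_filter)
  also have "\<dots> = (\<Sum>x\<in>?X. \<Sum>i=1..n. if i * fst x \<le> n then fst x * card (?C (n - i * fst x)) else 0)"
    by (intro sum.cong refl) (auto simp: card_colored_partitions_count_ge split: prod.splits)
  also have "\<dots> = (\<Sum>j=1..n. \<Sum>c<r. \<Sum>i=1..n. if i * j \<le> n then j * card (?C (n - i * j)) else 0)"
    by (simp only: sum.cartesian_product' fst_conv)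
  also have "\<dots> = r * (\<Sum>j=1..n. \<Sum>i=1..n. if i * j \<le> n then j * card (?C (n - i * j)) else 0)"
    by (simp add: sum_distrib_left)
  also have "(\<Sum>j=1..n. \<Sum>i=1..n. if i * j \<le> n then j * card (?C (n - i * j)) else 0) =
      (\<Sum>k=1..n. \<Sum>j | j dvd k. j * card (?C (n - k)))"
    by (rule sum_by_product)
  also have "\<dots> = (\<Sum>k=1..n. divisor_sum k * card (?C (n - k)))"
    by (simp add: divisor_sum_def sum_distrib_right)
  finally show ?thesis .
qed

lemma colored_partitions_0: "colored_partitions r 0 = {{#}}"
proof -
  have "M = {#}" if "M \<in> colored_partitions r 0" for M
    using colored_partitions_parts(2)[OF that] by simp
  thus ?thesis by (auto simp: colored_partitions_def)
qed

section \<open>Partial fractions of the cotangent\<close>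

lemma abs_summable_on_prod_bound:
  fixes f :: "nat \<times> nat \<Rightarrow> complex"
  assumes bd: "\<And>m n. norm (f (m, n)) \<le> g m * h n"
    and g: "summable g" "\<And>m. g m \<ge> 0" and h: "summable h" "\<And>n. h n \<ge> 0"
  shows "f summable_on UNIV"
proof -
  have "(\<lambda>(m, n). g m * h n) summable_on (SIGMA m:UNIV. UNIV)"
  proof (rule summable_on_SigmaI)
    fix m :: nat
    show "((\<lambda>n. case (m, n) of (m, n) \<Rightarrow> g m * h n) has_sum (g m * suminf h)) UNIV"
      using h by (auto intro!: sums_nonneg_imp_has_sum sums_mult summable_sums mult_nonneg_nonneg g)
  next
    show "(\<lambda>m. g m * suminf h) summable_on UNIV"
      using g h by (auto intro!: summable_nonneg_imp_summable_on summable_mult2 mult_nonneg_nonneg suminf_nonneg)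
  qed (use g h in auto)
  hence "(\<lambda>(m, n). g m * h n) summable_on UNIV" by simp
  hence "(\<lambda>x. norm (f x)) summable_on UNIV"
    by (rule Infinite_Sum.abs_summable_on_comparison_test') (use bd in auto)
  thus ?thesis by (rule Infinite_Sum.abs_summable_summable)
qed

text \<open>Fubini for iterated \<open>sums\<close>. Domination by a product
  \<open>g m * h n\<close> gives a sum over all pairs, which equals both iterated sums.\<close>

lemma sums_swap:
  fixes f :: "nat \<Rightarrow> nat \<Rightarrow> complex"
  assumes bd: "\<And>m n. norm (f m n) \<le> g m * h n"
    and g: "summable g" "\<And>m. g m \<ge> 0" and h: "summable h" "\<And>n. h n \<ge> 0"
    and A: "\<And>m. f m sums A m" and B: "\<And>n. (\<lambda>m. f m n) sums B n"
  shows "\<exists>S. A sums S \<and> B sums S"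
proof -
  let ?f = "\<lambda>(m, n). f m n"
  have sm: "?f summable_on UNIV"
    by (rule abs_summable_on_prod_bound[of ?f g h]) (use bd g h in auto)
  have rows: "(f m has_sum A m) UNIV" for m
  proof (rule norm_summable_imp_has_sum[OF _ A])
    show "summable (\<lambda>n. norm (f m n))"
      by (rule summable_comparison_test'[of "\<lambda>n. g m * h n" 0]) (use bd h in \<open>auto intro: summable_mult\<close>)
  qed
  have cols: "((\<lambda>m. f m n) has_sum B n) UNIV" for n
  proof (rule norm_summable_imp_has_sum[OF _ B])
    show "summable (\<lambda>m. norm (f m n))"
      by (rule summable_comparison_test'[of "\<lambda>m. g m * h n" 0]) (use bd g in \<open>auto intro: summable_mult2\<close>)
  qed
  from sm obtain S where S: "(?f has_sum S) (SIGMA m:UNIV. UNIV)"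
    by (auto simp: summable_on_def)
  have "(A has_sum S) UNIV"
    by (rule has_sum_Sigma'[OF S]) (use rows in auto)
  moreover have "((\<lambda>(n, m). f m n) has_sum S) (SIGMA n:UNIV. UNIV)"
    using S by (subst (asm) has_sum_swap) simp
  hence "(B has_sum S) UNIV"
    by (rule has_sum_Sigma') (use cols in auto)
  ultimately show ?thesis by (blast dest: has_sum_imp_sums)
qed

text \<open>Differentiate \<open>rGamma z * rGamma (1 - z) = sin (pi z) / pi\<close>. The reciprocal
  Gamma function is entire, so no poles interfere.\<close>

lemma Digamma_reflection:
  fixes w :: complex
  assumes w: "w \<notin> \<int>"
  shows "Digamma (1 - w) - Digamma w = of_real pi * cot (of_real pi * w)"
proof -
  have w1: "1 - w \<notin> \<int>" using w by (metis Ints_1 Ints_diff diff_diff_eq2 add_diff_cancel_left')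
  have np: "w \<notin> \<int>\<^sub>\<le>\<^sub>0" "1 - w \<notin> \<int>\<^sub>\<le>\<^sub>0" using w w1 by (auto dest: nonpos_Ints_Int)
  let ?F = "\<lambda>z :: complex. rGamma z * rGamma (1 - z)"
  have "(?F has_field_derivative
      - (rGamma w * Digamma w) * rGamma (1 - w) + rGamma w * (rGamma (1 - w) * Digamma (1 - w))) (at w)"
    by (rule derivative_eq_intros refl np | simp)+
  moreover have "?F = (\<lambda>z. sin (of_real pi * z) / of_real pi)"
    by (simp add: rGamma_reflection_complex)
  moreover have "((\<lambda>z :: complex. sin (of_real pi * z) / of_real pi) has_field_derivative cos (of_real pi * w)) (at w)"
    by (auto intro!: derivative_eq_intros)
  ultimately have "- (rGamma w * Digamma w) * rGamma (1 - w) + rGamma w * (rGamma (1 - w) * Digamma (1 - w)) =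
      cos (of_real pi * w)"
    using DERIV_unique by metis
  hence "(rGamma w * rGamma (1 - w)) * (Digamma (1 - w) - Digamma w) = cos (of_real pi * w)"
    by (simp add: algebra_simps)
  moreover have "rGamma w * rGamma (1 - w) \<noteq> 0" using np by (simp add: rGamma_eq_zero_iff)
  ultimately show ?thesis unfolding rGamma_reflection_complex by (auto simp: cot_def field_simps)
qed

lemma sin_pi_times_nonzero: "w \<notin> \<int> \<Longrightarrow> sin (of_real pi * w :: complex) \<noteq> 0"
  by (auto simp: sin_eq_0)

text \<open>The derivative of the previous identity, which holds on the whole open complement of the
  integers.\<close>

lemma Polygamma_1_reflection:
  fixes w :: complex
  assumes w: "w \<notin> \<int>"
  shows "Polygamma 1 w + Polygamma 1 (1 - w) = (of_real pi / sin (of_real pi * w))\<^sup>2"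
proof -
  have w1: "1 - w \<notin> \<int>" using w by (metis Ints_1 Ints_diff diff_diff_eq2 add_diff_cancel_left')
  have np: "w \<notin> \<int>\<^sub>\<le>\<^sub>0" "1 - w \<notin> \<int>\<^sub>\<le>\<^sub>0" using w w1 by (auto dest: nonpos_Ints_Int)
  have "((\<lambda>z :: complex. Digamma (1 - z) - Digamma z) has_field_derivative
      - Polygamma 1 (1 - w) - Polygamma 1 w) (at w)"
    by (rule derivative_eq_intros refl np DERIV_chain2[of "Digamma"] | simp)+
  moreover have "open (- (\<int> :: complex set))" by (simp add: closed_Ints open_Compl)
  hence "((\<lambda>z :: complex. Digamma (1 - z) - Digamma z) has_field_derivative D) (at w) \<longleftrightarrow>
        ((\<lambda>z. of_real pi * cot (of_real pi * z)) has_field_derivative D) (at w)" for D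
    using w by (intro has_field_derivative_cong_ev[OF refl _ refl])
      (auto simp: eventually_nhds Digamma_reflection intro!: exI[of _ "- \<int>"])
  moreover have "((\<lambda>z :: complex. of_real pi * cot (of_real pi * z)) has_field_derivative
      - (of_real pi / sin (of_real pi * w))\<^sup>2) (at w)"
    using sin_pi_times_nonzero[OF w]
    by (auto intro!: derivative_eq_intros DERIV_chain2[OF DERIV_cot] simp: power2_eq_square divide_inverse)
  ultimately have "- Polygamma 1 (1 - w) - Polygamma 1 w = - (of_real pi / sin (of_real pi * w))\<^sup>2"
    using DERIV_unique by metis
  thus ?thesis by (simp add: algebra_simps)
qed

lemma sums_inverse_squares_shifted:
  fixes w :: complex
  assumes w: "w \<notin> \<int>"
  shows "(\<lambda>n. 1 / (w + of_nat (Suc n))\<^sup>2 + 1 / (w - of_nat (Suc n))\<^sup>2) sums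
    ((of_real pi / sin (of_real pi * w))\<^sup>2 - 1 / w\<^sup>2)"
proof -
  have w1: "1 - w \<noteq> 0" "w \<noteq> 0" using w by auto
  have "(\<lambda>k. inverse ((w + of_nat k)\<^sup>2)) sums Polygamma 1 w"
    using Polygamma_LIMSEQ[of w 1] w1 by (simp add: numeral_2_eq_2)
  hence "(\<lambda>k. inverse ((w + of_nat (Suc k))\<^sup>2)) sums (Polygamma 1 w - 1 / w\<^sup>2)"
    by (subst sums_Suc_iff) (simp add: divide_inverse)
  moreover have "(\<lambda>k. inverse ((1 - w + of_nat k)\<^sup>2)) sums Polygamma 1 (1 - w)"
    using Polygamma_LIMSEQ[of "1 - w" 1] w1 by (simp add: numeral_2_eq_2)
  ultimately have "(\<lambda>k. inverse ((w + of_nat (Suc k))\<^sup>2) + inverse ((1 - w + of_nat k)\<^sup>2)) sums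
      (Polygamma 1 w - 1 / w\<^sup>2 + Polygamma 1 (1 - w))"
    by (rule sums_add)
  moreover have "(1 - w + of_nat k)\<^sup>2 = (w - of_nat (Suc k))\<^sup>2" for k
    by (simp add: power2_eq_square algebra_simps)
  ultimately show ?thesis using Polygamma_1_reflection[OF w]
    by (simp add: divide_inverse algebra_simps)
qed

lemma sums_cot:
  fixes w :: complex
  assumes w: "w \<notin> \<int>"
  shows "(\<lambda>n. 1 / (w + of_nat (Suc n)) + 1 / (w - of_nat (Suc n))) sums
    (of_real pi * cot (of_real pi * w) - 1 / w)"
proof -
  have w1: "1 - w \<noteq> 0" "w \<noteq> 0" using w by auto
  have D: "(\<lambda>k. inverse (of_nat (Suc k)) - inverse (z + of_nat k)) sums (Digamma z + euler_mascheroni)"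
    if "z \<noteq> 0" for z :: complex
    using summable_sums[OF summable_Digamma[OF that]] by (simp add: Digamma_def)
  \<comment> \<open>The two Digamma series produce 1/(w + k), but 1/(w + k + 1) is wanted; this
    telescoping series makes the shift and contributes the term -1/w.\<close>
  have tel: "(\<lambda>k. inverse (w + of_nat (Suc k)) - inverse (w + of_nat k)) sums (0 - inverse (w + of_nat 0))"
    by (intro telescope_sums filterlim_compose[OF tendsto_inverse_0]
              tendsto_add_filterlim_at_infinity[OF tendsto_const] tendsto_of_nat)
  have S: "(\<lambda>k. (inverse (of_nat (Suc k)) - inverse (1 - w + of_nat k)) - (inverse (of_nat (Suc k)) - inverse (w + of_nat k))
        + (inverse (w + of_nat (Suc k)) - inverse (w + of_nat k))) sums
      (Digamma (1 - w) + euler_mascheroni - (Digamma w + euler_mascheroni) + (0 - inverse (w + of_nat 0)))"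
    by (intro sums_add sums_diff D w1 tel)
  have "- inverse (1 - w + of_nat k) = inverse (w - of_nat (Suc k))" for k
    by (simp flip: inverse_minus_eq)
  hence eq: "(inverse (of_nat (Suc k)) - inverse (1 - w + of_nat k)) - (inverse (of_nat (Suc k)) - inverse (w + of_nat k))
      + (inverse (w + of_nat (Suc k)) - inverse (w + of_nat k)) =
    1 / (w + of_nat (Suc k)) + 1 / (w - of_nat (Suc k))" for k
    by (simp add: divide_inverse del: of_nat_Suc)
  from S show ?thesis using Digamma_reflection[OF w] unfolding eq
    by (simp add: divide_inverse)
qed

section \<open>The Lambert series of the divisor sum\<close>

lemma divisor_sum_le: "divisor_sum k \<le> k ^ 2"
proof (cases "k = 0")
  case True
  \<comment> \<open>Every number divides 0, so the sum runs over an infinite set and is 0 by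
    convention.\<close>
  hence "{d. d dvd k} = UNIV" by auto
  with True show ?thesis by (simp add: divisor_sum_def)
next
  case False
  have "divisor_sum k \<le> (\<Sum>d\<in>{1..k}. k)"
    unfolding divisor_sum_def using False
    by (intro sum_le_included[where i = id]) (auto simp: dvd_imp_le Suc_le_eq dvd_pos_nat intro: finite_divisors_nat dest: dvd_imp_le)
  thus ?thesis by (simp add: power2_eq_square)
qed

lemma summable_power_mult: "norm (q :: complex) < 1 \<Longrightarrow> summable (\<lambda>n. real (Suc n) * norm q ^ n)"
  using geometric_deriv_sums[of "norm q"] by (auto simp: sums_iff)

lemma sums_power_mult:
  fixes q :: complex
  assumes "norm q < 1"
  shows "(\<lambda>d. of_nat (Suc d) * q ^ Suc d) sums (q / (1 - q)\<^sup>2)"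
  using sums_mult[OF geometric_deriv_sums[OF assms], of q] by (simp add: mult_ac)

text \<open>Expand x / (1-x)^2 as the sum of d x^d at x = q^m and collect the terms with m d = k.
  Both indices are shifted by \<open>Suc\<close> because \<open>m\<close> and \<open>d\<close> start
  at 1.\<close>

lemma lambert_series_divisor_sum:
  fixes q :: complex
  assumes q: "norm q < 1"
  shows "(\<lambda>m. q ^ Suc m / (1 - q ^ Suc m)\<^sup>2) sums (\<Sum>k. of_nat (divisor_sum k) * q ^ k)"
proof -
  let ?f = "\<lambda>(m, d). of_nat (Suc d) * q ^ (Suc m * Suc d)"
  have q1: "norm (q ^ Suc m) < 1" for m
    using q by (simp add: norm_power power_less_one_iff del: power_Suc)
  have "?f summable_on UNIV"
  proof (rule abs_summable_on_prod_bound[where g = "\<lambda>m. norm q ^ m" and h = "\<lambda>d. real (Suc d) * norm q ^ d"])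
    fix m d :: nat
    have "norm q ^ (Suc m * Suc d) \<le> norm q ^ (m + d)"
      by (rule power_decreasing) (use q in auto)
    thus "norm (?f (m, d)) \<le> norm q ^ m * (real (Suc d) * norm q ^ d)"
      by (simp add: norm_mult norm_power power_add mult_ac mult_left_mono del: of_nat_Suc power_Suc mult_Suc mult_Suc_right)
  qed (use q summable_power_mult[OF q] in \<open>auto intro!: summable_geometric\<close>)
  then obtain S where S: "(?f has_sum S) (SIGMA m:UNIV. UNIV)"
    by (auto simp: summable_on_def)
  have rows: "((\<lambda>d. ?f (m, d)) has_sum (q ^ Suc m / (1 - q ^ Suc m)\<^sup>2)) UNIV" for m
  proof (rule norm_summable_imp_has_sum)
    have "summable (\<lambda>n. norm (q ^ Suc m) * (real (Suc n) * norm (q ^ Suc m) ^ n))"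
      by (intro summable_mult summable_power_mult q1)
    moreover have "norm (?f (m, d)) = norm (q ^ Suc m) * (real (Suc d) * norm (q ^ Suc m) ^ d)" for d
      by (simp only: prod.case power_mult power_Suc[of "q ^ Suc m"] norm_mult norm_of_nat norm_power[of "q ^ Suc m"] mult_ac)
    ultimately show "summable (\<lambda>d. norm (?f (m, d)))" by simp
    show "(\<lambda>d. ?f (m, d)) sums (q ^ Suc m / (1 - q ^ Suc m)\<^sup>2)"
      using sums_power_mult[OF q1[of m]] by (simp add: power_mult del: of_nat_Suc power_Suc mult_Suc mult_Suc_right)
  qed
  have A: "((\<lambda>m. q ^ Suc m / (1 - q ^ Suc m)\<^sup>2) has_sum S) UNIV"
    by (rule has_sum_Sigma'[OF S rows])
  have "(?f has_sum S) UNIV \<longleftrightarrow>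
    ((\<lambda>(k, d). of_nat d * q ^ k) has_sum S) (SIGMA k:{1..}. {d. d dvd k})"
  proof (rule has_sum_reindex_bij_witness[where i = "\<lambda>(k, d). (k div d - 1, d - 1)"
          and j = "\<lambda>(m, d). (Suc m * Suc d, Suc d)"], goal_cases)
    case (3 b)
    then obtain k d where b: "b = (k, d)" "1 \<le> k" "d dvd k" by auto
    then obtain m where m: "k = d * m" by auto
    with b obtain d' m' where "d = Suc d'" "m = Suc m'" by (cases d; cases m) auto
    with b m show ?case by (simp del: mult_Suc mult_Suc_right)
  next
    case (1 a)
    obtain m d where "a = (m, d)" by (rule prod.exhaust)
    thus ?case by (simp del: mult_Suc mult_Suc_right add: nonzero_mult_div_cancel_right)
  next
    case (2 a)
    obtain m d where "a = (m, d)" by (rule prod.exhaust)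
    moreover have "Suc d dvd Suc m * Suc d" "Suc m * Suc d \<ge> 1" by (rule dvd_triv_right) simp
    ultimately show ?case by simp
  next
    case (4 b) thus ?case by simp
  next
    case (5 a)
    obtain m d where "a = (m, d)" by (rule prod.exhaust)
    thus ?case by (simp del: mult_Suc mult_Suc_right of_nat_Suc)
  qed simp
  with S have "((\<lambda>(k, d). of_nat d * q ^ k) has_sum S) (SIGMA k:{1..}. {d. d dvd k})" by simp
  hence "((\<lambda>k. of_nat (divisor_sum k) * q ^ k) has_sum S) {1..}"
  proof (rule has_sum_Sigma')
    fix k :: nat assume "k \<in> {1..}"
    hence "finite {d. d dvd k}" by (auto intro: finite_divisors_nat)
    thus "((\<lambda>d. case (k, d) of (k, d) \<Rightarrow> of_nat d * q ^ k) has_sum of_nat (divisor_sum k) * q ^ k) {d. d dvd k}"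
      by (intro has_sum_finiteI) (auto simp: divisor_sum_def sum_distrib_right)
  qed
  \<comment> \<open>The index 0 may be added because \<open>divisor_sum 0 = 0\<close>.\<close>
  also have "?this \<longleftrightarrow> ((\<lambda>k. of_nat (divisor_sum k) * q ^ k) has_sum S) UNIV"
    using divisor_sum_le[of 0] by (intro has_sum_cong_neutral) (auto simp: not_le Suc_le_eq)
  finally have "(\<lambda>k. of_nat (divisor_sum k) * q ^ k) sums S" by (rule has_sum_imp_sums)
  with has_sum_imp_sums[OF A] show ?thesis by (simp add: sums_iff)
qed

abbreviation two_pi_i :: complex where
  "two_pi_i \<equiv> 2 * of_real pi * \<i>"

text \<open>Square sin(pi w) = (E - 1/E) / (2 i) with E^2 = exp(2 pi i w). The form without
  quotients holds at integers too.\<close>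

lemma sin_pi_exp: "(sin (of_real pi * w :: complex))\<^sup>2 * (4 * exp (two_pi_i * w)) = - (1 - exp (two_pi_i * w))\<^sup>2"
proof -
  define E where "E = exp (\<i> * (of_real pi * w))"
  have E: "E \<noteq> 0" "exp (- (\<i> * (of_real pi * w))) = 1 / E"
    by (simp_all add: E_def exp_minus divide_inverse)
  have "exp (two_pi_i * w) = E\<^sup>2"
    by (simp add: E_def power2_eq_square mult_ac flip: exp_add)
  moreover have "sin (of_real pi * w) = (E - 1 / E) / (2 * \<i>)"
    using E by (simp add: sin_exp_eq E_def)
  ultimately have q: "exp (two_pi_i * w) = E\<^sup>2"
      and "sin (of_real pi * w) * (2 * \<i> * E) = E\<^sup>2 - 1"
    using E(1) by (simp_all add: field_simps power2_eq_square)
  from this(2) have "(sin (of_real pi * w) * (2 * \<i> * E))\<^sup>2 = (1 - E\<^sup>2)\<^sup>2"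
    by (simp only: power2_commute[of 1])
  thus ?thesis unfolding q by (simp add: power_mult_distrib mult_ac) (metis minus_minus)
qed

lemma norm_exp_upper_half_plane: "Im z > 0 \<Longrightarrow> norm (exp (two_pi_i * z)) < 1"
  by (simp add: norm_exp_eq_Re)

lemma Im_pos_not_Int: "Im w \<noteq> 0 \<Longrightarrow> w \<notin> \<int>"
  by (auto elim: Ints_cases)

definition divisor_series :: "complex \<Rightarrow> complex" where
  "divisor_series z = (\<Sum>k. of_nat (divisor_sum k) * exp (two_pi_i * z) ^ k)"

text \<open>Row m of Eisenstein's double series, the sum of 1/(m z + n)^2 over all integers n, is
  this cosecant square; in terms of q it is a Lambert term. So summation by rows yields the
  q-series.\<close>

lemma sums_cosecant_squares:
  assumes z: "Im z > 0"
  shows "(\<lambda>m. (of_real pi / sin (of_real pi * (of_nat (Suc m) * z)))\<^sup>2) sums (- 4 * of_real pi ^ 2 * divisor_series z)"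
proof -
  let ?q = "exp (two_pi_i * z)"
  have "(\<lambda>m. - 4 * of_real pi ^ 2 * (?q ^ Suc m / (1 - ?q ^ Suc m)\<^sup>2)) sums (- 4 * of_real pi ^ 2 * divisor_series z)"
    unfolding divisor_series_def by (intro sums_mult lambert_series_divisor_sum norm_exp_upper_half_plane z)
  moreover have "- 4 * of_real pi ^ 2 * (?q ^ Suc m / (1 - ?q ^ Suc m)\<^sup>2) =
      (of_real pi / sin (of_real pi * (of_nat (Suc m) * z)))\<^sup>2" for m
  proof -
    let ?w = "of_nat (Suc m) * z"
    have "Im ?w \<noteq> 0" using z by simp
    hence s: "sin (of_real pi * ?w) \<noteq> 0" by (intro sin_pi_times_nonzero Im_pos_not_Int)
    have "?q ^ Suc m = exp (two_pi_i * ?w)"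
      by (simp only: exp_of_nat_mult[symmetric]) (simp add: mult_ac)
    with sin_pi_exp[of ?w] have *: "(sin (of_real pi * ?w))\<^sup>2 * (4 * ?q ^ Suc m) = - (1 - ?q ^ Suc m)\<^sup>2" by simp
    have "?q ^ Suc m \<noteq> 0" by simp
    have aux: "- 4 * p * (Q / D) = p / T" if "Q \<noteq> 0" "T \<noteq> 0" "T * (4 * Q) = - D" for p Q D T :: complex
    proof -
      have "D = - (T * (4 * Q))" using that by simp
      with that show ?thesis by (simp add: field_simps)
    qed
    show ?thesis unfolding power_divide
      by (rule aux[OF _ _ *]) (use s \<open>?q ^ Suc m \<noteq> 0\<close> in \<open>simp_all del: power_Suc of_nat_Suc\<close>)
  qed
  ultimately show ?thesis by simp
qed

section \<open>The quasi-modularity of the weight 2 Eisenstein series\<close>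

text \<open>Equivalence of norms on the plane: the imaginary part controls \<open>m\<close>, and
  then the triangle inequality controls \<open>t\<close>. Real \<open>t\<close> is allowed because
  arguments shifted by 1/2 occur below.\<close>

lemma lattice_norm_lower_bound:
  assumes z: "Im z > 0"
  shows "\<exists>\<delta>>0. \<forall>m t :: real. \<delta> * max \<bar>m\<bar> \<bar>t\<bar> \<le> norm (of_real m * z + of_real t)"
proof (intro exI conjI allI)
  let ?K = "1 + (norm z + 1) / Im z"
  show "1 / ?K > 0" using z by (simp add: add_pos_nonneg)
  fix m t :: real
  let ?W = "norm (of_real m * z + of_real t)"
  have "\<bar>m\<bar> * Im z = \<bar>Im (of_real m * z + of_real t)\<bar>" using z by (simp add: abs_mult)
  also have "\<dots> \<le> ?W" by (rule abs_Im_le_cmod)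
  finally have m: "\<bar>m\<bar> \<le> ?W / Im z" using z by (simp add: field_simps)
  have "\<bar>t\<bar> = norm ((of_real m * z + of_real t) - of_real m * z)" by simp
  also have "\<dots> \<le> ?W + norm (of_real m * z)" by (rule norm_triangle_ineq4)
  also have "\<dots> = ?W + \<bar>m\<bar> * norm z" by (simp add: norm_mult)
  also have "\<dots> \<le> ?W + ?W / Im z * norm z" using m by (intro add_left_mono mult_right_mono) auto
  also have "\<dots> \<le> ?W * ?K" using z by (simp add: field_simps)
  finally have t: "\<bar>t\<bar> \<le> ?W * ?K" .
  have "?W / Im z \<le> ?W * ?K" using z by (simp add: field_simps)
  with m t have "max \<bar>m\<bar> \<bar>t\<bar> \<le> ?W * ?K" by simp
  moreover have "?K > 0" using z by (simp add: add_pos_nonneg)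
  ultimately have "max \<bar>m\<bar> \<bar>t\<bar> / ?K \<le> ?W" by (subst pos_divide_le_eq)
  thus "1 / ?K * max \<bar>m\<bar> \<bar>t\<bar> \<le> ?W" by (simp only: times_divide_eq_left mult_1)
qed

text \<open>Eisenstein's regularisation: subtracting a telescoping term from \<open>1 / W\<^sup>2\<close> makes
  the lattice sum absolutely convergent.\<close>

definition eis_term :: "complex \<Rightarrow> complex" where
  "eis_term W = 1 / W\<^sup>2 - (1 / (W - 1/2) - 1 / (W + 1/2))"

text \<open>The terms for n and -n are paired, so that partial sums are symmetric and indexed by
  naturals.\<close>

definition eis_pair :: "complex \<Rightarrow> nat \<Rightarrow> complex" where
  "eis_pair w n = (if n = 0 then eis_term w else eis_term (w + of_nat n) + eis_term (w - of_nat n))"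

definition sq_pair :: "complex \<Rightarrow> nat \<Rightarrow> complex" where
  "sq_pair w n = (if n = 0 then 1 / w\<^sup>2 else 1 / (w + of_nat n)\<^sup>2 + 1 / (w - of_nat n)\<^sup>2)"

text \<open>The corrections telescope and only the ends at distance N + 1/2 survive. For fixed
  \<open>w\<close> they tend to 0; summed over all rows first they do not, and this is the source of
  the non-modular term.\<close>

lemma sum_eis_pair:
  "(\<Sum>n\<le>N. eis_pair w n) =
     (\<Sum>n\<le>N. sq_pair w n) - (1 / (w - (of_nat N + 1/2)) - 1 / (w + (of_nat N + 1/2)))"
proof (induction N)
  case (Suc N)
  have "1 + (of_nat N - 1/2) = (of_nat N + 1/2 :: complex)" by simp
  thus ?case using Suc by (simp add: eis_pair_def sq_pair_def eis_term_def algebra_simps)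
qed (simp add: eis_pair_def sq_pair_def eis_term_def)

text \<open>The corrected term equals -1 / (4 W^2 (W^2 - 1/4)), hence decays like W^(-4). One factor
  W^2 is spent on \<open>m\<close>, the other on \<open>t\<close>, which gives the product form
  needed for exchanging sums.\<close>

lemma norm_eis_term_le:
  assumes \<delta>: "\<delta> > 0" "\<And>m t. \<delta> * max \<bar>m\<bar> \<bar>t\<bar> \<le> norm (of_real m * z + of_real t)"
  and t: "t = 0 \<or> \<bar>t\<bar> \<ge> 1"
  shows "norm (eis_term (of_nat (Suc m) * z + of_real t)) \<le> 1 / (\<delta> ^ 4 * (real (Suc m))\<^sup>2 * (1 + t\<^sup>2))"
proof -
  let ?m = "real (Suc m)"
  define W where "W = of_nat (Suc m) * z + of_real t"
  have W: "norm (W + of_real s) \<ge> \<delta> * max ?m \<bar>t + s\<bar>" for s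
    using \<delta>(2)[of ?m "t + s"] unfolding W_def by (simp add: add_ac)
  have pos: "\<delta> * max ?m \<bar>t + s\<bar> > 0" for s using \<delta> by (simp add: less_max_iff_disj)
  have nz: "W + of_real s \<noteq> 0" for s using W[of s] pos[of s] by (metis leD norm_zero)
  have nz': "W \<noteq> 0" "W + 1/2 \<noteq> 0" "W - 1/2 \<noteq> 0" using nz[of 0] nz[of "1/2"] nz[of "-1/2"] by auto
  have eq: "eis_term W = - 1 / (4 * W\<^sup>2 * ((W - 1/2) * (W + 1/2)))"
  proof -
    have "1 / (W - 1/2) - 1 / (W + 1/2) = 1 / ((W - 1/2) * (W + 1/2))"
      using nz' by (simp add: diff_frac_eq)
    moreover have "(W - 1/2) * (W + 1/2) = W\<^sup>2 - 1/4" by (simp add: algebra_simps power2_eq_square)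
    ultimately have "eis_term W = 1 / W\<^sup>2 - 1 / (W\<^sup>2 - 1/4)" by (simp add: eis_term_def)
    also have "\<dots> = - 1 / (4 * W\<^sup>2 * (W\<^sup>2 - 1/4))"
    proof -
      have "W\<^sup>2 - 1/4 \<noteq> 0" using nz' \<open>(W - 1/2) * (W + 1/2) = W\<^sup>2 - 1/4\<close> by (metis mult_eq_0_iff)
      thus ?thesis using nz' by (simp add: diff_frac_eq)
    qed
    finally show ?thesis using \<open>(W - 1/2) * (W + 1/2) = W\<^sup>2 - 1/4\<close> by simp
  qed
  have a: "norm (W\<^sup>2) \<ge> \<delta>\<^sup>2 * ?m\<^sup>2"
  proof -
    have "\<delta> * ?m \<le> norm W" using W[of 0] \<delta>(1)
      by (smt (verit, best) add.right_neutral mult_left_mono of_real_0)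
    hence "(\<delta> * ?m)\<^sup>2 \<le> (norm W)\<^sup>2" using \<delta> by (intro power_mono) auto
    thus ?thesis by (simp add: norm_power power_mult_distrib del: of_nat_Suc)
  qed
  have b: "norm ((W - 1/2) * (W + 1/2)) \<ge> \<delta>\<^sup>2 * ((1 + t\<^sup>2) / 4)"
  proof -
    \<comment> \<open>For t = 0 the entries \<open>?m\<close> of the maxima, at least 1, suffice;
      for |t| >= 1 the claim follows from 3 t^2 >= 2.\<close>
    have "(1 + t\<^sup>2) / 4 \<le> max ?m \<bar>t - 1/2\<bar> * max ?m \<bar>t + 1/2\<bar>"
    proof (cases "t = 0")
      case True
      have "1/4 \<le> (1::real) * 1" by simp
      also have "\<dots> \<le> max ?m \<bar>t - 1/2\<bar> * max ?m \<bar>t + 1/2\<bar>" by (intro mult_mono) auto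
      finally show ?thesis using True by simp
    next
      case False
      hence "1 \<le> t\<^sup>2" using t by (metis one_le_power power2_abs)
      hence "(1 + t\<^sup>2) / 4 \<le> \<bar>t\<^sup>2 - 1/4\<bar>" by (simp add: abs_if)
      also have "t\<^sup>2 - 1/4 = (t - 1/2) * (t + 1/2)" by (simp add: algebra_simps power2_eq_square)
      also have "\<bar>\<dots>\<bar> = \<bar>t - 1/2\<bar> * \<bar>t + 1/2\<bar>" by (simp add: abs_mult)
      also have "\<dots> \<le> max ?m \<bar>t - 1/2\<bar> * max ?m \<bar>t + 1/2\<bar>" by (intro mult_mono) auto
      finally show ?thesis .
    qed
    hence "\<delta>\<^sup>2 * ((1 + t\<^sup>2) / 4) \<le> \<delta>\<^sup>2 * (max ?m \<bar>t - 1/2\<bar> * max ?m \<bar>t + 1/2\<bar>)"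
      by (intro mult_left_mono) auto
    also have "\<dots> = (\<delta> * max ?m \<bar>t - 1/2\<bar>) * (\<delta> * max ?m \<bar>t + 1/2\<bar>)"
      by (simp add: power2_eq_square mult_ac)
    also have "\<dots> \<le> norm (W - 1/2) * norm (W + 1/2)"
      using W[of "1/2"] W[of "-1/2"] pos[of "1/2"] by (intro mult_mono) auto
    finally show ?thesis by (simp add: norm_mult)
  qed
  have ab: "(\<delta>\<^sup>2 * ?m\<^sup>2) * (\<delta>\<^sup>2 * ((1 + t\<^sup>2) / 4)) \<le> norm (W\<^sup>2) * norm ((W - 1/2) * (W + 1/2))"
    using a b by (intro mult_mono) auto
  have "\<delta> ^ 4 * ?m\<^sup>2 * (1 + t\<^sup>2) = 4 * ((\<delta>\<^sup>2 * ?m\<^sup>2) * (\<delta>\<^sup>2 * ((1 + t\<^sup>2) / 4)))"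
    by (simp add: power2_eq_square power4_eq_xxxx mult_ac del: of_nat_Suc)
  also have "\<dots> \<le> 4 * (norm (W\<^sup>2) * norm ((W - 1/2) * (W + 1/2)))"
    using ab by simp
  also have "4 * (norm (W\<^sup>2) * norm ((W - 1/2) * (W + 1/2))) = norm (4 * W\<^sup>2 * ((W - 1/2) * (W + 1/2)))"
    by (simp only: norm_mult norm_numeral mult.assoc)
  finally have "\<delta> ^ 4 * ?m\<^sup>2 * (1 + t\<^sup>2) \<le> norm (4 * W\<^sup>2 * ((W - 1/2) * (W + 1/2)))" .
  moreover have "\<delta> ^ 4 * ?m\<^sup>2 * (1 + t\<^sup>2) > 0"
    using \<delta> by (intro mult_pos_pos) (auto simp: add_pos_nonneg)
  ultimately have "1 / norm (4 * W\<^sup>2 * ((W - 1/2) * (W + 1/2))) \<le> 1 / (\<delta> ^ 4 * ?m\<^sup>2 * (1 + t\<^sup>2))"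
    by (intro frac_le) auto
  thus ?thesis unfolding W_def[symmetric] eq by (simp add: norm_divide del: of_nat_Suc)
qed

lemma norm_eis_pair_le:
  assumes \<delta>: "\<delta> > 0" "\<And>m t. \<delta> * max \<bar>m\<bar> \<bar>t\<bar> \<le> norm (of_real m * z + of_real t)"
  shows "norm (eis_pair (of_nat (Suc m) * z) n) \<le> (4 / \<delta> ^ 4 * (1 / (real m + 1)\<^sup>2)) * (1 / (real n + 1)\<^sup>2)"
proof -
  let ?B = "1 / (\<delta> ^ 4 * (real (Suc m))\<^sup>2 * (1 + (real n)\<^sup>2))"
  have "norm (eis_pair (of_nat (Suc m) * z) n) \<le> 2 * ?B"
  proof (cases "n = 0")
    case True
    have "?B \<ge> 0" using \<delta> by simp
    moreover have "norm (eis_pair (of_nat (Suc m) * z) n) \<le> ?B"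
      using norm_eis_term_le[OF \<delta>, of 0 m] True by (simp add: eis_pair_def)
    ultimately show ?thesis by linarith
  next
    case False
    have "norm (eis_pair (of_nat (Suc m) * z) n) \<le>
        norm (eis_term (of_nat (Suc m) * z + of_real (real n))) + norm (eis_term (of_nat (Suc m) * z + of_real (- real n)))"
      using False by (auto simp: eis_pair_def norm_triangle_ineq)
    also have "\<dots> \<le> ?B + ?B"
    proof (rule add_mono)
      show "norm (eis_term (of_nat (Suc m) * z + of_real (real n))) \<le> ?B"
        by (rule norm_eis_term_le[OF \<delta>]) (use False in auto)
      have "norm (eis_term (of_nat (Suc m) * z + of_real (- real n))) \<le>
          1 / (\<delta> ^ 4 * (real (Suc m))\<^sup>2 * (1 + (- real n)\<^sup>2))"
        by (rule norm_eis_term_le[OF \<delta>]) (use False in auto)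
      thus "norm (eis_term (of_nat (Suc m) * z + of_real (- real n))) \<le> ?B"
        by (simp only: power2_minus)
    qed
    finally show ?thesis by (simp only: mult_2)
  qed
  also have "(real n + 1)\<^sup>2 \<le> 2 * (1 + (real n)\<^sup>2)"
    using zero_le_power2[of "real n - 1"] by (simp add: power2_eq_square algebra_simps)
  hence "2 * ?B \<le> (4 / \<delta> ^ 4 * (1 / (real m + 1)\<^sup>2)) * (1 / (real n + 1)\<^sup>2)"
  proof -
    assume h: "(real n + 1)\<^sup>2 \<le> 2 * (1 + (real n)\<^sup>2)"
    have "1 / (1 + (real n)\<^sup>2) \<le> 2 / (real n + 1)\<^sup>2"
      using h by (simp add: divide_simps add_pos_nonneg)
    hence "2 / (\<delta> ^ 4 * (real (Suc m))\<^sup>2) * (1 / (1 + (real n)\<^sup>2)) \<le> 2 / (\<delta> ^ 4 * (real (Suc m))\<^sup>2) * (2 / (real n + 1)\<^sup>2)"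
      using \<delta> by (intro mult_left_mono) auto
    thus ?thesis by (simp add: add_ac)
  qed
  finally show ?thesis .
qed

lemma sums_sq_pair:
  assumes w: "w \<notin> \<int>"
  shows "sq_pair w sums (of_real pi / sin (of_real pi * w))\<^sup>2"
proof -
  have "(\<lambda>n. sq_pair w (Suc n)) sums ((of_real pi / sin (of_real pi * w))\<^sup>2 - sq_pair w 0)"
    using sums_inverse_squares_shifted[OF w] by (simp add: sq_pair_def)
  thus ?thesis by (subst (asm) sums_Suc_iff) simp
qed

lemma sums_eis_pair:
  assumes w: "w \<notin> \<int>"
  shows "eis_pair w sums (of_real pi / sin (of_real pi * w))\<^sup>2"
proof -
  have "(\<lambda>N. \<Sum>n\<le>N. sq_pair w n) \<longlonglongrightarrow> (of_real pi / sin (of_real pi * w))\<^sup>2"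
    using sums_sq_pair[OF w] by (simp add: sums_def_le)
  moreover have "(\<lambda>N. 1 / (w - (of_nat N + 1/2))) \<longlonglongrightarrow> 0" "(\<lambda>N. 1 / (w + (of_nat N + 1/2))) \<longlonglongrightarrow> 0"
  proof -
    have *: "filterlim (\<lambda>N. c + of_nat N :: complex) at_infinity sequentially" for c
      by (intro tendsto_add_filterlim_at_infinity[OF tendsto_const] tendsto_of_nat)
    have "(\<lambda>N. 1 / (c + of_nat N :: complex)) \<longlonglongrightarrow> 0" for c
      unfolding inverse_eq_divide[symmetric] by (intro filterlim_compose[OF tendsto_inverse_0] *)
    from this[of "w + 1/2"] tendsto_minus[OF this[of "1/2 - w"]]
    show "(\<lambda>N. 1 / (w - (of_nat N + 1/2))) \<longlonglongrightarrow> 0" "(\<lambda>N. 1 / (w + (of_nat N + 1/2))) \<longlonglongrightarrow> 0"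
      by (simp_all add: algebra_simps minus_divide_right)
  qed
  ultimately have "(\<lambda>N. \<Sum>n\<le>N. eis_pair w n) \<longlonglongrightarrow> (of_real pi / sin (of_real pi * w))\<^sup>2 - (0 - 0)"
    unfolding sum_eis_pair by (intro tendsto_diff)
  thus ?thesis by (simp add: sums_def_le)
qed

text \<open>cot(pi w) = i (Q + 1) / (Q - 1) with Q = exp(2 pi i w), and Q tends to 0 along the
  half-integer multiples of \<open>z\<close>.\<close>

lemma cot_upper_half_plane_limit:
  assumes z: "Im z > 0"
  shows "(\<lambda>N. cot (of_real pi * ((of_nat N + 1/2) * z))) \<longlonglongrightarrow> - \<i>"
proof -
  let ?q = "exp (two_pi_i * z)"
  have q: "norm ?q < 1" using z by (rule norm_exp_upper_half_plane)
  have cot_eq: "cot (of_real pi * w) = \<i> * (Q + 1) / (Q - 1)" if "Q = exp (two_pi_i * w)" for w Q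
  proof -
    define E where "E = exp (\<i> * (of_real pi * w))"
    have E: "E \<noteq> 0" "exp (- (\<i> * (of_real pi * w))) = 1 / E"
      by (simp_all add: E_def exp_minus divide_inverse)
    have "Q = E\<^sup>2"
      by (simp add: E_def power2_eq_square mult_ac that flip: exp_add)
    moreover have "sin (of_real pi * w) = (E - 1 / E) / (2 * \<i>)" "cos (of_real pi * w) = (E + 1 / E) / 2"
      using E by (simp_all add: sin_exp_eq cos_exp_eq E_def)
    ultimately have Q: "Q = E\<^sup>2" and "cot (of_real pi * w) = ((E + 1 / E) / 2) / ((E - 1 / E) / (2 * \<i>))"
      by (simp_all only: cot_def)
    note this(2)
    also have "\<dots> = \<i> * ((E + 1 / E) * E) / ((E - 1 / E) * E)"
    proof -
      have "a / 2 / (b / (2 * \<i>)) = \<i> * (a * E) / (b * E)" for a b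
        using E(1) by (cases "b = 0") (simp_all add: field_simps)
      thus ?thesis .
    qed
    also have "(E + 1 / E) * E = E\<^sup>2 + 1" using E(1) by (simp add: algebra_simps power2_eq_square)
    also have "(E - 1 / E) * E = E\<^sup>2 - 1" using E(1) by (simp add: algebra_simps power2_eq_square)
    finally show ?thesis using Q by simp
  qed
  have "exp (two_pi_i * ((of_nat N + 1/2) * z)) = ?q ^ N * exp (of_real pi * \<i> * z)" for N
    by (simp add: algebra_simps flip: exp_of_nat_mult exp_add)
  note eq = cot_eq[OF this[symmetric]]
  have "(\<lambda>N. ?q ^ N * exp (of_real pi * \<i> * z)) \<longlonglongrightarrow> 0 * exp (of_real pi * \<i> * z)"
    by (intro tendsto_intros LIMSEQ_power_zero q)
  hence "(\<lambda>N. \<i> * (?q ^ N * exp (of_real pi * \<i> * z) + 1) / (?q ^ N * exp (of_real pi * \<i> * z) - 1)) \<longlonglongrightarrow> \<i> * (0 + 1) / (0 - 1)"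
    by (intro tendsto_intros) auto
  thus ?thesis by (simp add: eq)
qed

lemma Im_minus_inverse_pos: "Im z > 0 \<Longrightarrow> Im (- 1 / z) > 0"
  by (simp add: Im_divide power2_eq_square add_nonneg_pos)

text \<open>The series of \<open>eis_pair\<close> is summed in both orders. By rows the corrections
  cancel and the series at \<open>z\<close> appears; by columns the uncorrected part gives the
  series at -1/z, and the corrections tend to a cotangent limit. In terms of E_2 = 1 - 24 D this
  reads E_2(-1/z) = z^2 E_2(z) + 6 z / (pi i).\<close>

theorem divisor_series_inversion:
  assumes z: "Im z > 0"
  shows "24 * z\<^sup>2 * divisor_series z = 24 * divisor_series (- 1 / z) - 1 + z\<^sup>2 - 6 * \<i> * z / of_real pi"
proof -
  let ?pi = "of_real pi :: complex"
  define z' where "z' = - 1 / z"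
  have z0: "z \<noteq> 0" using z by auto
  have z': "Im z' > 0" unfolding z'_def by (rule Im_minus_inverse_pos[OF z])
  have z'0: "z' \<noteq> 0" using z' by auto
  obtain \<delta> where \<delta>: "\<delta> > 0" "\<And>m t. \<delta> * max \<bar>m\<bar> \<bar>t\<bar> \<le> norm (of_real m * z + of_real t)"
    using lattice_norm_lower_bound[OF z] by blast
  define f where "f = (\<lambda>m n. eis_pair (of_nat (Suc m) * z) n)"
  define g where "g = (\<lambda>m. 4 / \<delta> ^ 4 * (1 / (real m + 1)\<^sup>2))"
  define h where "h = (\<lambda>n. 1 / (real n + 1)\<^sup>2)"
  have h: "summable h" "\<And>n. h n \<ge> 0" using inverse_squares_sums by (auto simp: h_def sums_iff add_ac)
  have g: "summable g" "\<And>m. g m \<ge> 0" using summable_mult[OF h(1), of "4 / \<delta> ^ 4"] \<delta> by (auto simp: g_def h_def)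
  have bd: "norm (f m n) \<le> g m * h n" for m n
    unfolding f_def g_def h_def by (rule norm_eis_pair_le[OF \<delta>])
  define A where "A = (\<lambda>m. (?pi / sin (?pi * (of_nat (Suc m) * z)))\<^sup>2)"
  have A: "f m sums A m" for m
    unfolding f_def A_def by (rule sums_eis_pair, rule Im_pos_not_Int) (use z in simp)
  define B where "B = (\<lambda>n. \<Sum>m. f m n)"
  have B: "(\<lambda>m. f m n) sums B n" for n
    unfolding B_def
    by (rule summable_sums, rule summable_comparison_test'[of "\<lambda>m. g m * h n" 0])
      (use bd g in \<open>auto intro: summable_mult2\<close>)
  obtain S where S: "A sums S" "B sums S" using sums_swap[OF bd g h A B] by blast
  have "A sums (- 4 * ?pi\<^sup>2 * divisor_series z)"
    unfolding A_def by (rule sums_cosecant_squares[OF z])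
  with S have S_eq: "S = - 4 * ?pi\<^sup>2 * divisor_series z" by (simp add: sums_iff)
  \<comment> \<open>Value of the uncorrected column: dividing by z^2 turns it into a cosecant series
    at n/z. The sum has only m >= 1, so the row m = 0 appears as the subtracted 1/n^2.\<close>
  define C where "C = (\<lambda>n. if n = 0 then ?pi\<^sup>2 / 6 / z\<^sup>2
      else (?pi / sin (?pi * (of_nat n * z')))\<^sup>2 / z\<^sup>2 - 1 / (of_nat n)\<^sup>2)"
  have sq2: "(\<lambda>m. 1 / (of_nat (Suc m) :: complex)\<^sup>2) sums (?pi\<^sup>2 / 6)"
  proof -
    have "(\<lambda>m. of_real (1 / (real m + 1)\<^sup>2) :: complex) sums of_real (pi\<^sup>2 / 6)"
      using inverse_squares_sums by (intro sums_of_real) (simp add: add_ac)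
    thus ?thesis by (simp add: add_ac)
  qed
  have C: "(\<lambda>m. sq_pair (of_nat (Suc m) * z) n) sums C n" for n
  proof (cases "n = 0")
    case True
    thus ?thesis using sums_divide[OF sq2, of "z\<^sup>2"] by (simp add: sq_pair_def C_def power_mult_distrib del: of_nat_Suc)
  next
    case False
    define w where "w = of_nat n / z"
    have "Im w \<noteq> 0" using False z by (simp add: w_def Im_divide)
    hence w: "w \<notin> \<int>" by (rule Im_pos_not_Int)
    have "(\<lambda>m. (1 / (w + of_nat (Suc m))\<^sup>2 + 1 / (w - of_nat (Suc m))\<^sup>2) / z\<^sup>2) sums
        (((?pi / sin (?pi * w))\<^sup>2 - 1 / w\<^sup>2) / z\<^sup>2)"
      by (intro sums_divide sums_inverse_squares_shifted w)
    moreover have "(1 / (w + of_nat (Suc m))\<^sup>2 + 1 / (w - of_nat (Suc m))\<^sup>2) / z\<^sup>2 = sq_pair (of_nat (Suc m) * z) n" for m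
    proof -
      have "(w + of_nat (Suc m))\<^sup>2 * z\<^sup>2 = (of_nat (Suc m) * z + of_nat n)\<^sup>2"
        "(w - of_nat (Suc m))\<^sup>2 * z\<^sup>2 = (of_nat (Suc m) * z - of_nat n)\<^sup>2"
        using z0 by (simp_all add: w_def algebra_simps flip: power_mult_distrib del: of_nat_Suc)
          (simp add: power2_commute algebra_simps)
      thus ?thesis using False by (simp add: sq_pair_def add_divide_distrib del: of_nat_Suc)
    qed
    moreover have "((?pi / sin (?pi * w))\<^sup>2 - 1 / w\<^sup>2) / z\<^sup>2 = C n"
    proof -
      have "?pi * (of_nat n * z') = - (?pi * w)" by (simp add: z'_def w_def)
      hence "(sin (?pi * (of_nat n * z')))\<^sup>2 = (sin (?pi * w))\<^sup>2" by simp
      moreover have "1 / w\<^sup>2 / z\<^sup>2 = 1 / (of_nat n)\<^sup>2" using z0 by (simp add: w_def power_divide)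
      ultimately show ?thesis using False by (simp add: C_def power_divide diff_divide_distrib)
    qed
    ultimately show ?thesis by simp
  qed
  define w where "w = (\<lambda>N. (of_nat N + 1/2) * z')"
  have w: "w N \<notin> \<int>" for N
  proof (rule Im_pos_not_Int)
    have "Im (w N) = (real N + 1/2) * Im z'" by (simp add: w_def)
    thus "Im (w N) \<noteq> 0" using z' by (simp add: add_nonneg_eq_0_iff)
  qed
  \<comment> \<open>The end terms of the first columns up to N, summed over all rows by the
    cotangent series.\<close>
  define T where "T = (\<lambda>N. (?pi * cot (?pi * w N) - 1 / w N) / z)"
  have T: "(\<lambda>m. 1 / (of_nat (Suc m) * z - (of_nat N + 1/2)) - 1 / (of_nat (Suc m) * z + (of_nat N + 1/2))) sums T N" for N
  proof -
    have "(\<lambda>m. (1 / (w N + of_nat (Suc m)) + 1 / (w N - of_nat (Suc m))) / z) sums T N"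
      unfolding T_def by (intro sums_divide sums_cot w)
    moreover have "(1 / (w N + of_nat (Suc m)) + 1 / (w N - of_nat (Suc m))) / z =
        1 / (of_nat (Suc m) * z - (of_nat N + 1/2)) - 1 / (of_nat (Suc m) * z + (of_nat N + 1/2))" for m
    proof -
      have wz: "w N * z = - (of_nat N + 1/2)" using z0 by (simp add: w_def z'_def)
      have "(w N + of_nat (Suc m)) * z = of_nat (Suc m) * z - (of_nat N + 1/2)"
        "(w N - of_nat (Suc m)) * z = - (of_nat (Suc m) * z + (of_nat N + 1/2))"
        unfolding ring_distribs wz by simp_all
      moreover have "(1 / (w N + of_nat (Suc m)) + 1 / (w N - of_nat (Suc m))) / z =
          1 / ((w N + of_nat (Suc m)) * z) + 1 / ((w N - of_nat (Suc m)) * z)"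
        by (simp add: add_divide_distrib)
      ultimately show ?thesis by (simp only: divide_minus_right diff_conv_add_uminus)
    qed
    ultimately show ?thesis by simp
  qed
  have partial: "(\<Sum>n\<le>N. B n) = (\<Sum>n\<le>N. C n) - T N" for N
  proof (rule sums_unique2)
    show "(\<lambda>m. \<Sum>n\<le>N. f m n) sums (\<Sum>n\<le>N. B n)" by (intro sums_sum B)
    show "(\<lambda>m. \<Sum>n\<le>N. f m n) sums ((\<Sum>n\<le>N. C n) - T N)"
      unfolding f_def sum_eis_pair by (intro sums_diff sums_sum C T)
  qed
  have "C sums (?pi\<^sup>2 / 6 / z\<^sup>2 + (- 4 * ?pi\<^sup>2 * divisor_series z' / z\<^sup>2 - ?pi\<^sup>2 / 6))"
  proof -
    have "(\<lambda>n. C (Suc n)) sums (- 4 * ?pi\<^sup>2 * divisor_series z' / z\<^sup>2 - ?pi\<^sup>2 / 6)"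
      unfolding C_def using sums_diff[OF sums_divide[OF sums_cosecant_squares[OF z'], of "z\<^sup>2"] sq2] by simp
    thus ?thesis by (subst (asm) sums_Suc_iff) (simp add: C_def add_ac)
  qed
  moreover have "T \<longlonglongrightarrow> (?pi * (- \<i>) - 0) / z"
  proof -
    have "filterlim (\<lambda>N. 1/2 + of_nat N :: complex) at_infinity sequentially"
      by (intro tendsto_add_filterlim_at_infinity[OF tendsto_const] tendsto_of_nat)
    hence "(\<lambda>N. 1 / (1/2 + of_nat N :: complex)) \<longlonglongrightarrow> 0"
      unfolding inverse_eq_divide[symmetric] by (intro filterlim_compose[OF tendsto_inverse_0])
    from tendsto_divide[OF this tendsto_const, of z'] have "(\<lambda>N. 1 / w N) \<longlonglongrightarrow> 0"
      using z'0 by (simp add: w_def add_ac)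
    thus ?thesis unfolding T_def
      using cot_upper_half_plane_limit[OF z'] z0 by (intro tendsto_intros) (simp_all add: w_def)
  qed
  ultimately have "(\<lambda>N. \<Sum>n\<le>N. B n) \<longlonglongrightarrow>
      ?pi\<^sup>2 / 6 / z\<^sup>2 + (- 4 * ?pi\<^sup>2 * divisor_series z' / z\<^sup>2 - ?pi\<^sup>2 / 6) - (?pi * (- \<i>) - 0) / z"
    unfolding partial by (intro tendsto_diff) (simp_all add: sums_def_le)
  moreover have "(\<lambda>N. \<Sum>n\<le>N. B n) \<longlonglongrightarrow> S" using S(2) by (simp add: sums_def_le)
  ultimately have "S = ?pi\<^sup>2 / 6 / z\<^sup>2 + (- 4 * ?pi\<^sup>2 * divisor_series z' / z\<^sup>2 - ?pi\<^sup>2 / 6) - (?pi * (- \<i>) - 0) / z"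
    by (metis LIMSEQ_unique)
  \<comment> \<open>This multiplier normalises the coefficient of the divisor series to 24.\<close>
  hence "(- 6 * z\<^sup>2 / ?pi\<^sup>2) * (- 4 * ?pi\<^sup>2 * divisor_series z) = (- 6 * z\<^sup>2 / ?pi\<^sup>2) *
     (?pi\<^sup>2 / 6 / z\<^sup>2 + (- 4 * ?pi\<^sup>2 * divisor_series z' / z\<^sup>2 - ?pi\<^sup>2 / 6) - (?pi * (- \<i>) - 0) / z)"
    unfolding S_eq by (rule arg_cong)
  also have "(- 6 * z\<^sup>2 / ?pi\<^sup>2) * (- 4 * ?pi\<^sup>2 * divisor_series z) = 24 * z\<^sup>2 * divisor_series z"
    by simp
  also have "(- 6 * z\<^sup>2 / ?pi\<^sup>2) *
     (?pi\<^sup>2 / 6 / z\<^sup>2 + (- 4 * ?pi\<^sup>2 * divisor_series z' / z\<^sup>2 - ?pi\<^sup>2 / 6) - (?pi * (- \<i>) - 0) / z) =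
     24 * divisor_series z' - 1 + z\<^sup>2 - 6 * \<i> * z / ?pi"
    using z0 by (simp add: field_simps power2_eq_square)
  finally show ?thesis unfolding z'_def .
qed

section \<open>The generating function and its modular inversion\<close>

text \<open>The logarithm of the product of 1 / (1 - q^n). Its constant term is 0 / 0 = 0, so the
  exponential series may be composed with it.\<close>

definition divisor_fps :: "complex fps" where
  "divisor_fps = Abs_fps (\<lambda>k. of_nat (divisor_sum k) / of_nat k)"

definition p24_fps :: "complex fps" where
  "p24_fps = Abs_fps (\<lambda>n. of_nat (p24 n))"

lemma norm_divisor_coeff_le: "norm (of_nat (divisor_sum k) / of_nat k :: complex) \<le> real k"
proof -
  have "real (divisor_sum k) \<le> real k ^ 2" using divisor_sum_le[of k] by (metis of_nat_le_iff of_nat_power)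
  thus ?thesis by (cases "k = 0") (auto simp: norm_divide field_simps power2_eq_square)
qed

lemma summable_nat_power: "norm (q :: complex) < 1 \<Longrightarrow> summable (\<lambda>k. real k * norm q ^ k)"
  using summable_mult[OF summable_power_mult, of q "norm q"]
    summable_Suc_iff[of "\<lambda>k. real k * norm q ^ k"] by (simp add: mult_ac del: of_nat_Suc)

lemma conv_radius_divisor_fps: "fps_conv_radius divisor_fps \<ge> 1"
  unfolding fps_conv_radius_def
proof (rule conv_radius_geI_ex)
  fix r :: real assume r: "0 < r" "ereal r < 1"
  have "norm (fps_nth divisor_fps n * of_real r ^ n) \<le> real n * norm (of_real r :: complex) ^ n" for n
    unfolding norm_mult norm_power divisor_fps_def fps_nth_Abs_fps
    by (intro mult_right_mono norm_divisor_coeff_le) simp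
  hence "summable (\<lambda>n. fps_nth divisor_fps n * of_real r ^ n)"
    using r by (intro summable_comparison_test'[OF summable_nat_power[of "of_real r"], of 0]) auto
  thus "\<exists>z. norm z = r \<and> summable (\<lambda>n. fps_nth divisor_fps n * z ^ n)"
    using r by (intro exI[of _ "of_real r"]) auto
qed

lemma nth_deriv_divisor_fps: "fps_nth (fps_deriv divisor_fps) n = of_nat (divisor_sum (Suc n))"
  by (simp add: divisor_fps_def del: of_nat_Suc)

lemma deriv_p24_fps: "fps_deriv p24_fps = (24 * fps_deriv divisor_fps) * p24_fps"
proof (rule fps_ext)
  fix n
  have "Suc n * p24 (Suc n) = 24 * (\<Sum>k=1..Suc n. divisor_sum k * p24 (Suc n - k))"
    unfolding p24_def by (rule colored_partitions_recurrence)
  also have "(\<Sum>k=1..Suc n. divisor_sum k * p24 (Suc n - k)) = (\<Sum>k=0..n. divisor_sum (Suc k) * p24 (n - k))"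
    using sum.shift_bounds_cl_Suc_ivl[of "\<lambda>k. divisor_sum k * p24 (Suc n - k)" 0 n] by simp
  finally have "of_nat (Suc n * p24 (Suc n)) = (of_nat (24 * (\<Sum>k=0..n. divisor_sum (Suc k) * p24 (n - k))) :: complex)"
    by (rule arg_cong)
  hence "of_nat (Suc n) * of_nat (p24 (Suc n)) =
      (24 * (\<Sum>k=0..n. of_nat (divisor_sum (Suc k)) * of_nat (p24 (n - k))) :: complex)"
    by (simp only: of_nat_mult of_nat_sum of_nat_numeral)
  moreover have L: "fps_nth (fps_deriv p24_fps) n = of_nat (Suc n) * of_nat (p24 (Suc n))"
    by (simp add: p24_fps_def del: of_nat_Suc)
  moreover have R: "fps_nth (fps_deriv divisor_fps * p24_fps) n =
      (\<Sum>k=0..n. of_nat (divisor_sum (Suc k)) * of_nat (p24 (n - k)))"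
    unfolding fps_mult_nth nth_deriv_divisor_fps by (simp add: p24_fps_def)
  moreover have "fps_nth (24 * fps_deriv divisor_fps * p24_fps) n =
      24 * fps_nth (fps_deriv divisor_fps * p24_fps) n"
    by (simp only: mult.assoc numeral_fps_const fps_mult_left_const_nth)
  ultimately show "fps_nth (fps_deriv p24_fps) n = fps_nth (24 * fps_deriv divisor_fps * p24_fps) n"
    by (simp only: L R)
qed

text \<open>The product has derivative 0. Exhibiting an inverse through the equation with opposite
  sign avoids dividing power series; two solutions with a common inverse coincide.\<close>

lemma fps_linear_ode_unique:
  fixes A H G :: "complex fps"
  assumes "fps_deriv A = G * A" "fps_deriv H = - G * H" "fps_nth A 0 = 1" "fps_nth H 0 = 1"
  shows "A * H = 1"
proof -
  have "fps_deriv (A * H) = 0" using assms by (simp add: algebra_simps)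
  hence "A * H = fps_const (fps_nth (A * H) 0)" by (simp only: fps_deriv_eq_0_iff)
  thus ?thesis using assms by simp
qed

lemma p24_fps_eq_exp: "p24_fps = fps_compose (fps_exp 24) divisor_fps"
proof -
  let ?G = "24 * fps_deriv divisor_fps"
  have 0: "fps_nth divisor_fps 0 = 0" by (simp add: divisor_fps_def)
  have d: "fps_deriv (fps_compose (fps_exp c) divisor_fps) =
      fps_const c * fps_deriv divisor_fps * fps_compose (fps_exp c) divisor_fps" for c
    using fps_compose_deriv[OF 0, of "fps_exp c"] 0
    by (simp add: fps_const_mult_apply_left[symmetric] fps_compose_mult_distrib mult_ac)
  have H: "fps_deriv (fps_compose (fps_exp (-24)) divisor_fps) = - ?G * fps_compose (fps_exp (-24)) divisor_fps"
    unfolding d by (simp add: fps_const_neg[symmetric] numeral_fps_const del: fps_const_neg)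
  have F: "fps_deriv (fps_compose (fps_exp 24) divisor_fps) = ?G * fps_compose (fps_exp 24) divisor_fps"
    unfolding d by (simp add: numeral_fps_const)
  have "fps_nth p24_fps 0 = 1"
    by (simp add: p24_fps_def p24_def colored_partitions_0)
  with fps_linear_ode_unique[OF deriv_p24_fps H] fps_linear_ode_unique[OF F H]
  have 1: "p24_fps * fps_compose (fps_exp (-24)) divisor_fps = 1"
    and 2: "fps_compose (fps_exp 24) divisor_fps * fps_compose (fps_exp (-24)) divisor_fps = 1" by simp_all
  have "p24_fps = p24_fps * (fps_compose (fps_exp 24) divisor_fps * fps_compose (fps_exp (-24)) divisor_fps)"
    unfolding 2 by simp
  also have "\<dots> = fps_compose (fps_exp 24) divisor_fps * (p24_fps * fps_compose (fps_exp (-24)) divisor_fps)"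
    by (simp only: mult_ac)
  finally show ?thesis unfolding 1 by simp
qed

definition divisor_log :: "complex \<Rightarrow> complex" where
  "divisor_log = eval_fps divisor_fps"

text \<open>No growth bound for \<open>p24\<close> is needed in advance: exp(24 L) is holomorphic in
  the unit disc, so its Taylor series, which is \<open>p24_fps\<close>, converges there.\<close>

lemma sums_p24:
  fixes q :: complex
  assumes q: "norm q < 1"
  shows "(\<lambda>n. of_nat (p24 n) * q ^ n) sums exp (24 * divisor_log q)"
proof -
  let ?f = "\<lambda>q. exp (24 * divisor_log q)"
  have holo: "?f holomorphic_on eball 0 1"
    unfolding divisor_log_def
    by (intro holomorphic_intros holomorphic_on_subset[OF holomorphic_on_eval_fps] eball_mono conv_radius_divisor_fps)
  have r: "fps_conv_radius divisor_fps > 0" using conv_radius_divisor_fps by (rule less_le_trans[rotated]) simp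
  have "divisor_log has_fps_expansion divisor_fps"
    unfolding divisor_log_def has_fps_expansion_def using r by simp
  hence "((\<lambda>x. exp (24 * x)) \<circ> divisor_log) has_fps_expansion fps_compose (fps_exp 24) divisor_fps"
    by (intro has_fps_expansion_compose has_fps_expansion_exp) (simp_all add: divisor_fps_def)
  hence 1: "?f has_fps_expansion p24_fps" by (simp add: o_def p24_fps_eq_exp)
  have 2: "?f has_fps_expansion fps_expansion ?f 0"
    by (rule has_fps_expansion_fps_expansion[OF _ _ holo]) auto
  have eq: "fps_expansion ?f 0 = p24_fps" by (rule fps_expansion_unique_complex[OF 2 1])
  have "eval_fps p24_fps q = ?f q" "fps_conv_radius p24_fps \<ge> 1"
    using eval_fps_expansion'[OF holo, of q] conv_radius_fps_expansion[OF holo] q unfolding eq by auto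
  moreover have "(\<lambda>n. fps_nth p24_fps n * q ^ n) sums eval_fps p24_fps q"
    by (rule sums_eval_fps) (use q less_le_trans[of "ereal (norm q)" 1, OF _ \<open>fps_conv_radius p24_fps \<ge> 1\<close>] in simp)
  ultimately show ?thesis by (simp add: p24_fps_def)
qed

lemma has_field_derivative_divisor_log:
  assumes z: "Im z > 0"
  shows "((\<lambda>z. divisor_log (exp (two_pi_i * z))) has_field_derivative
    two_pi_i * divisor_series z) (at z)"
proof -
  let ?q = "exp (two_pi_i * z)"
  have q: "norm ?q < 1" using z by (rule norm_exp_upper_half_plane)
  have r: "ereal (norm ?q) < fps_conv_radius divisor_fps"
    using q conv_radius_divisor_fps by (intro less_le_trans[OF _ conv_radius_divisor_fps]) auto
  have "(\<lambda>n. fps_nth (fps_deriv divisor_fps) n * ?q ^ n) sums eval_fps (fps_deriv divisor_fps) ?q"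
    by (rule sums_eval_fps) (use r in \<open>auto intro: less_le_trans[OF _ fps_conv_radius_deriv]\<close>)
  from sums_mult[OF this, of ?q] have "(\<lambda>n. of_nat (divisor_sum (Suc n)) * ?q ^ Suc n) sums (?q * eval_fps (fps_deriv divisor_fps) ?q)"
    unfolding nth_deriv_divisor_fps by (simp add: mult_ac)
  hence "(\<lambda>n. of_nat (divisor_sum n) * ?q ^ n) sums (?q * eval_fps (fps_deriv divisor_fps) ?q)"
    using divisor_sum_le[of 0] by (subst (asm) sums_Suc_iff) simp
  hence "divisor_series z = ?q * eval_fps (fps_deriv divisor_fps) ?q"
    by (simp add: divisor_series_def sums_iff)
  moreover have "(divisor_log has_field_derivative eval_fps (fps_deriv divisor_fps) ?q) (at ?q)"
    unfolding divisor_log_def by (rule has_field_derivative_eval_fps[OF r])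
  moreover have "((\<lambda>z. exp (two_pi_i * z)) has_field_derivative two_pi_i * ?q) (at z)"
    by (auto intro!: derivative_eq_intros)
  ultimately have "divisor_series z = ?q * eval_fps (fps_deriv divisor_fps) ?q" and
    l: "(divisor_log has_field_derivative eval_fps (fps_deriv divisor_fps) ?q) (at ?q)" and
    e: "((\<lambda>z. exp (two_pi_i * z)) has_field_derivative two_pi_i * ?q) (at z)"
    by blast+
  moreover from DERIV_chain2[where f = divisor_log and g = "\<lambda>z. exp (two_pi_i * z)" and x = z, OF l e]
  have "((\<lambda>z. divisor_log (exp (two_pi_i * z))) has_field_derivative
      eval_fps (fps_deriv divisor_fps) ?q * (two_pi_i * ?q)) (at z)" .
  ultimately show ?thesis by (simp add: mult_ac)
qed

text \<open>The function q^(-1) times the product of (1 - q^n)^(-24). As a single exponential it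
  visibly never vanishes, and its logarithmic derivative is that of the exponent.\<close>

definition inv_delta :: "complex \<Rightarrow> complex" where
  "inv_delta z = exp (24 * divisor_log (exp (two_pi_i * z)) - 2 * of_real pi * \<i> * z)"

text \<open>The quotient \<open>W\<close> of the two sides has derivative 0 by the weight 2
  inversion; the anomaly there cancels the derivative of z^12. The constant is found at the fixed
  point i, where i^12 = 1.\<close>

theorem inv_delta_inversion:
  assumes z: "Im z > 0"
  shows "inv_delta z = z ^ 12 * inv_delta (- 1 / z)"
proof -
  let ?H = "{z. Im z > 0}"
  let ?l = "\<lambda>z. divisor_log (exp (two_pi_i * z))"
  define W where "W = (\<lambda>z. exp (24 * ?l (- 1 / z) - 2 * of_real pi * \<i> * (- 1 / z) - (24 * ?l z - 2 * of_real pi * \<i> * z)) * z ^ 12)"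
  have "(W has_field_derivative 0) (at z within ?H)" if "z \<in> ?H" for z
  proof -
    have z: "Im z > 0" "z \<noteq> 0" using that by auto
    have z': "Im (- 1 / z) > 0" by (rule Im_minus_inverse_pos[OF z(1)])
    have d1: "((\<lambda>z. ?l (- 1 / z)) has_field_derivative
        (two_pi_i * divisor_series (- 1 / z)) * (1 / z\<^sup>2)) (at z)"
      by (rule DERIV_chain2[where f = ?l and g = "\<lambda>z. - 1 / z" and x = z, OF has_field_derivative_divisor_log[OF z']])
        (use z in \<open>auto intro!: derivative_eq_intros simp: power2_eq_square field_simps\<close>)
    note d2 = has_field_derivative_divisor_log[OF z(1)]
    let ?X = "exp (24 * ?l (- 1 / z) - 2 * of_real pi * \<i> * (- 1 / z) - (24 * ?l z - 2 * of_real pi * \<i> * z))"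
    let ?Y = "24 * ((two_pi_i * divisor_series (- 1 / z)) * (1 / z\<^sup>2)) - 2 * of_real pi * \<i> * (1 / z\<^sup>2)
          - (24 * (two_pi_i * divisor_series z) - 2 * of_real pi * \<i>)"
    have d3: "((\<lambda>z. - 1 / z) has_field_derivative 1 / z\<^sup>2) (at z)"
      using z by (auto intro!: derivative_eq_intros simp: power2_eq_square field_simps)
    have "((\<lambda>z. 24 * ?l (- 1 / z) - 2 * of_real pi * \<i> * (- 1 / z) - (24 * ?l z - 2 * of_real pi * \<i> * z))
        has_field_derivative ?Y) (at z)"
      by (intro DERIV_diff DERIV_cmult d1 d2 d3 DERIV_cmult_Id)
    from DERIV_chain2[OF DERIV_exp this]
    have "(W has_field_derivative (?X * ?Y) * z ^ 12 + (of_nat 12 * (1 * z ^ (12 - Suc 0))) * ?X) (at z)"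
      unfolding W_def by (intro DERIV_mult DERIV_power DERIV_ident)
    moreover have "(?X * ?Y) * z ^ 12 + (of_nat 12 * (1 * z ^ (12 - Suc 0))) * ?X = ?X * z ^ 11 * (?Y * z + 12)"
      by (simp add: algebra_simps eval_nat_numeral)
    moreover have "?Y * z + 12 = 0"
    proof -
      let ?S = "divisor_series z" and ?S' = "divisor_series (- 1 / z)"
      have "?Y * z + 12 = (two_pi_i * (24 * ?S' - 1 - 24 * z\<^sup>2 * ?S + z\<^sup>2) + 12 * z) / z"
        using z by (simp add: field_simps power2_eq_square)
      also have "24 * ?S' - 1 - 24 * z\<^sup>2 * ?S + z\<^sup>2 = 6 * \<i> * z / of_real pi"
        using divisor_series_inversion[OF z(1)] by (simp add: algebra_simps)
      also have "(two_pi_i * (6 * \<i> * z / of_real pi) + 12 * z) / z = 0"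
        using z by (simp add: field_simps)
      finally show ?thesis .
    qed
    ultimately show ?thesis by (simp add: has_field_derivative_at_within)
  qed
  moreover have "convex ?H" by (rule convex_halfspace_Im_gt)
  ultimately obtain c where c: "\<And>z. z \<in> ?H \<Longrightarrow> W z = c"
    using has_field_derivative_zero_constant[of ?H W] by blast
  have "- 1 / \<i> = \<i>" by (simp add: field_simps)
  moreover have "\<i> ^ 12 = 1" by (simp add: eval_nat_numeral)
  ultimately have "W \<i> = 1" unfolding W_def by (simp only: diff_self exp_zero mult_1_left)
  moreover have "W \<i> = c" "W z = c" using c z by auto
  ultimately have "W z = 1" by simp
  moreover have "W z = inv_delta (- 1 / z) / inv_delta z * z ^ 12"
    by (simp only: W_def inv_delta_def exp_diff[symmetric])
  moreover have "inv_delta z \<noteq> 0" by (simp add: inv_delta_def)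
  ultimately show ?thesis by (simp add: field_simps)
qed

section \<open>The circle method\<close>

lemma has_contour_integral_exp_period:
  fixes a :: complex and k :: int
  shows "((\<lambda>z. exp (two_pi_i * of_int k * z)) has_contour_integral (if k = 0 then 1 else 0)) (linepath a (a + 1))"
proof (cases "k = 0")
  case True
  have "((\<lambda>z :: complex. 1 :: complex) has_contour_integral (1 * ((a + 1) - a))) (linepath a (a + 1))"
    by (rule has_contour_integral_const_linepath)
  with True show ?thesis by simp
next
  case False
  define c where "c = two_pi_i * (of_int k :: complex)"
  have c: "c \<noteq> 0" using False by (simp add: c_def)
  have "((\<lambda>z. exp (c * z)) has_contour_integral
      (exp (c * pathfinish (linepath a (a + 1))) / c - exp (c * pathstart (linepath a (a + 1))) / c)) (linepath a (a + 1))"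
    by (rule contour_integral_primitive[where S = UNIV])
      (use c in \<open>auto intro!: derivative_eq_intros\<close>)
  moreover have "exp (c * (a + 1)) = exp (c * a)"
    by (simp add: c_def ring_distribs exp_eq)
  ultimately show ?thesis using False by (simp add: c_def)
qed

text \<open>Termwise integration over one period. The frequency is n - 1 because
  \<open>inv_delta\<close> carries the factor q^(-1).\<close>

lemma p24_contour_integral:
  assumes y: "y > 0"
  shows "((\<lambda>z. inv_delta z * exp (- 2 * of_real pi * \<i> * (of_nat n - 1) * z)) has_contour_integral of_nat (p24 n))
    (linepath (Complex (-1/2) y) (Complex (1/2) y))"
proof -
  let ?f = "\<lambda>z. inv_delta z * exp (- 2 * of_real pi * \<i> * (of_nat n - 1) * z)"
  let ?a = "Complex (-1/2) y" and ?b = "Complex (1/2) y"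
  let ?\<gamma> = "linepath ?a ?b"
  have ab: "?b = ?a + 1" by (simp add: complex_eq_iff)
  define t where "t = (\<lambda>m z. of_nat (p24 m) * exp (two_pi_i * of_int (int m - int n) * z))"
  have Im: "Im z = y" if "z \<in> path_image ?\<gamma>" for z
    using that by (auto simp: closed_segment_same_Im)
  have t: "(t m has_contour_integral (of_nat (p24 m) * (if int m - int n = 0 then 1 else 0))) ?\<gamma>" for m
    unfolding t_def ab by (intro has_contour_integral_lmul has_contour_integral_exp_period)
  have t_eq: "t m z = of_nat (p24 m) * exp (two_pi_i * z) ^ m * exp (- 2 * of_real pi * \<i> * of_nat n * z)" for m z
    unfolding t_def mult.assoc by (simp add: algebra_simps flip: exp_of_nat_mult exp_add)
  have sums_t: "(\<lambda>m. t m z) sums (?f z)"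
    if "Im z > 0" for z
  proof -
    have "(\<lambda>m. t m z) sums (exp (24 * divisor_log (exp (two_pi_i * z))) * exp (- 2 * of_real pi * \<i> * of_nat n * z))"
      unfolding t_eq by (intro sums_mult2 sums_p24 norm_exp_upper_half_plane that)
    thus ?thesis by (simp add: inv_delta_def algebra_simps flip: exp_add)
  qed
  have "uniform_limit (path_image ?\<gamma>) (\<lambda>K z. \<Sum>m<K. t m z) (\<lambda>z. suminf (\<lambda>m. t m z)) sequentially"
  proof (rule Weierstrass_m_test)
    fix m z assume "z \<in> path_image ?\<gamma>"
    thus "norm (t m z) \<le> real (p24 m) * exp (- 2 * pi * y) ^ m * exp (2 * pi * real n * y)"
      by (simp add: t_eq norm_mult norm_power Im)
  next
    have "(\<lambda>m. of_nat (p24 m) * (of_real (exp (- 2 * pi * y)) :: complex) ^ m) sums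
        exp (24 * divisor_log (of_real (exp (- 2 * pi * y))))"
      by (rule sums_p24) (use y in simp)
    hence "summable (\<lambda>m. complex_of_real (real (p24 m) * exp (- 2 * pi * y) ^ m))"
      by (simp add: sums_iff)
    hence "summable (\<lambda>m. real (p24 m) * exp (- 2 * pi * y) ^ m)" by (rule summable_of_real_iff[THEN iffD1])
    thus "summable (\<lambda>m. real (p24 m) * exp (- 2 * pi * y) ^ m * exp (2 * pi * real n * y))"
      by (rule summable_mult2)
  qed
  also have "?this \<longleftrightarrow> uniform_limit (path_image ?\<gamma>) (\<lambda>K z. \<Sum>m<K. t m z)
      ?f sequentially"
    by (rule uniform_limit_cong') (use sums_t Im y in \<open>auto simp: sums_iff\<close>)
  finally have lim: "uniform_limit (path_image ?\<gamma>) (\<lambda>K z. \<Sum>m<K. t m z)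
      ?f sequentially" .
  have int: "((\<lambda>z. \<Sum>m<K. t m z) has_contour_integral (\<Sum>m<K. of_nat (p24 m) * (if int m - int n = 0 then 1 else 0))) ?\<gamma>" for K
    by (intro has_contour_integral_sum t) auto
  have ev: "\<forall>\<^sub>F K in sequentially. (\<lambda>z. \<Sum>m<K. t m z) contour_integrable_on ?\<gamma>"
    using int by (intro always_eventually allI) (rule has_contour_integral_integrable)
  have B: "norm (vector_derivative ?\<gamma> (at x)) \<le> norm (?b - ?a)" for x by simp
  note L = contour_integral_uniform_limit[OF ev lim B valid_path_linepath trivial_limit_sequentially]
  have "(\<lambda>K. contour_integral ?\<gamma> (\<lambda>z. \<Sum>m<K. t m z)) \<longlonglongrightarrow> of_nat (p24 n)"
  proof (rule tendsto_eventually, rule eventually_sequentiallyI[of "Suc n"])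
    fix K assume "Suc n \<le> K"
    hence "(\<Sum>m<K. of_nat (p24 m) * (if int m - int n = 0 then 1 else 0)) = (of_nat (p24 n) :: complex)"
      by (simp add: if_distrib cong: if_cong)
    thus "contour_integral ?\<gamma> (\<lambda>z. \<Sum>m<K. t m z) = of_nat (p24 n)"
      by (simp only: contour_integral_unique[OF int])
  qed
  from LIMSEQ_unique[OF L(2) this] L(1) show ?thesis
    using has_contour_integral_integral by fastforce
qed

lemma p24_series_real:
  assumes r: "0 \<le> r" "r < 1"
  shows "summable (\<lambda>n. real (p24 n) * r ^ n)"
    "exp (24 * divisor_log (of_real r)) = of_real (\<Sum>n. real (p24 n) * r ^ n)"
proof -
  have *: "(\<lambda>m. complex_of_real (real (p24 m) * r ^ m)) sums exp (24 * divisor_log (of_real r))"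
    using sums_p24[of "of_real r"] r by simp
  hence "summable (\<lambda>m. complex_of_real (real (p24 m) * r ^ m))" by (simp add: sums_iff)
  thus s: "summable (\<lambda>m. real (p24 m) * r ^ m)" by (rule summable_of_real_iff[THEN iffD1])
  from sums_of_real[OF summable_sums[OF s], where 'a = complex] * 
  show "exp (24 * divisor_log (of_real r)) = of_real (\<Sum>n. real (p24 n) * r ^ n)"
    by (metis sums_unique2)
qed

lemma p24_0: "p24 0 = 1"
  by (simp add: p24_def colored_partitions_0)

section \<open>Size of \<open>inv_delta\<close> beyond its polar term\<close>

lemma norm_divisor_log_le:
  assumes r: "0 \<le> r" "r < 1"
  shows "norm (divisor_log (of_real r)) \<le> r / (1 - r)\<^sup>2"
proof -
  have "(\<lambda>d. real (Suc d) * r ^ Suc d) sums (r / (1 - r)\<^sup>2)"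
    using sums_mult[OF geometric_deriv_sums[of r], of r] r by (simp add: mult_ac)
  hence s0: "(\<lambda>d. real d * r ^ d) sums (r / (1 - r)\<^sup>2)" by (subst (asm) sums_Suc_iff) simp
  have b: "norm (fps_nth divisor_fps n * of_real r ^ n) \<le> real n * r ^ n" for n
  proof -
    have "norm (of_real r ^ n :: complex) = r ^ n" using r by (simp add: norm_power)
    with mult_right_mono[OF norm_divisor_coeff_le[of n], of "r ^ n"] r show ?thesis
      unfolding norm_mult divisor_fps_def fps_nth_Abs_fps by simp
  qed
  have sn: "summable (\<lambda>n. norm (fps_nth divisor_fps n * of_real r ^ n))"
    by (rule summable_comparison_test'[of "\<lambda>d. real d * r ^ d" 0])
      (use b in \<open>simp_all add: sums_summable[OF s0]\<close>)
  have "norm (divisor_log (of_real r)) \<le> (\<Sum>n. norm (fps_nth divisor_fps n * of_real r ^ n))"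
    unfolding divisor_log_def eval_fps_def by (rule summable_norm[OF sn])
  also have "\<dots> \<le> (\<Sum>d. real d * r ^ d)"
    by (rule suminf_le[OF b sn sums_summable[OF s0]])
  also have "\<dots> = r / (1 - r)\<^sup>2" by (rule sums_unique[OF s0, symmetric])
  finally show ?thesis .
qed

text \<open>At r = 1/100, which exceeds exp(-2 pi), the exponent 24 L is at most 24/96 = 1/4, and
  exp(1/4) <= 2.\<close>

lemma p24_series_small:
  "(\<Sum>n. real (p24 n) * (1 / 100) ^ n) \<le> 2"
proof -
  let ?r = "1 / 100 :: real"
  have "norm (divisor_log (of_real ?r)) \<le> ?r / (1 - ?r)\<^sup>2"
    by (rule norm_divisor_log_le) auto
  also have "?r / (1 - ?r)\<^sup>2 \<le> 1 / 96" by (simp add: power2_eq_square)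
  finally have "norm (24 * divisor_log (of_real ?r)) \<le> 1 / 4" by (simp add: norm_mult)
  hence "norm (exp (24 * divisor_log (of_real ?r))) \<le> exp (1 / 4)"
    using norm_exp[of "24 * divisor_log (of_real ?r)"] by (meson exp_le_cancel_iff order_trans)
  also have "exp (1 / 4) \<le> (2 :: real)"
    using exp_bound[of "1/4"] by (simp add: power2_eq_square)
  finally have "norm (complex_of_real (\<Sum>n. real (p24 n) * ?r ^ n)) \<le> 2"
    by (subst (asm) p24_series_real(2)) auto
  thus ?thesis by (simp only: norm_of_real abs_le_iff)
qed

text \<open>The coefficients are nonnegative, so (P(r) - 1) / r increases with r; its value at r =
  1/100 is at most 100 because P(1/100) <= 2.\<close>

lemma p24_series_le:
  assumes r: "0 \<le> r" "r \<le> 1 / 100"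
  shows "(\<Sum>n. real (p24 n) * r ^ n) - 1 \<le> 100 * r" "(\<Sum>n. real (p24 n) * r ^ n) \<le> 2"
proof -
  have s: "summable (\<lambda>n. real (p24 (Suc n)) * x ^ n)" if "0 \<le> x" "x < 1" for x
  proof (cases "x = 0")
    case True
    show ?thesis unfolding True by (rule summable_finite[of "{0}"]) auto
  next
    case False
    have "summable (\<lambda>n. real (p24 (Suc n)) * x ^ Suc n * (1 / x))"
      using p24_series_real(1)[OF that] by (intro summable_mult2) (simp only: summable_Suc_iff[of "\<lambda>n. real (p24 n) * x ^ n"])
    thus ?thesis using False by simp
  qed
  have e: "(\<Sum>n. real (p24 n) * x ^ n) - 1 = x * (\<Sum>n. real (p24 (Suc n)) * x ^ n)" if "0 \<le> x" "x < 1" for x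
    using suminf_split_head[OF p24_series_real(1)[OF that]] suminf_mult[OF s[OF that], of x]
    by (simp add: p24_0 mult_ac)
  have "(\<Sum>n. real (p24 (Suc n)) * r ^ n) \<le> (\<Sum>n. real (p24 (Suc n)) * (1 / 100) ^ n)"
    using r by (intro suminf_le s mult_left_mono power_mono) auto
  moreover have "(\<Sum>n. real (p24 (Suc n)) * (1 / 100) ^ n) \<le> 100"
    using e[of "1 / 100"] p24_series_small by simp
  ultimately have "r * (\<Sum>n. real (p24 (Suc n)) * r ^ n) \<le> r * 100"
    using r by (intro mult_left_mono) auto
  thus "(\<Sum>n. real (p24 n) * r ^ n) - 1 \<le> 100 * r" using e[of r] r by simp
  thus "(\<Sum>n. real (p24 n) * r ^ n) \<le> 2" using r by simp
qed

lemma exp_minus_two_pi_le: "exp (- 2 * pi * v) \<le> 1 / 100" if "v \<ge> 1"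
proof -
  have "(5 / 2) ^ 6 \<le> (exp 1 :: real) ^ 6"
    using exp_lower_Taylor_quadratic[of 1] by (intro power_mono) auto
  also have "\<dots> = exp 6" by (simp flip: exp_of_nat_mult)
  also have "\<dots> \<le> exp (2 * pi * v)"
  proof -
    have "6 * 1 \<le> (2 * pi) * v" using pi_gt3 that by (intro mult_mono) auto
    thus ?thesis by simp
  qed
  finally have "100 \<le> exp (2 * pi * v)" by (simp add: eval_nat_numeral)
  thus ?thesis by (simp add: exp_minus field_simps)
qed

lemma inv_delta_imaginary_axis:
  assumes "v > 0"
  shows "inv_delta (\<i> * of_real v) = of_real (exp (2 * pi * v) * (\<Sum>n. real (p24 n) * exp (- 2 * pi * v) ^ n))"
proof -
  have "exp (two_pi_i * (\<i> * of_real v)) = complex_of_real (exp (- 2 * pi * v))"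
    by (simp add: mult_ac flip: exp_of_real)
  moreover have "- (two_pi_i * (\<i> * of_real v)) = complex_of_real (2 * pi * v)" by (simp add: mult_ac)
  ultimately have "inv_delta (\<i> * of_real v) =
      exp (24 * divisor_log (of_real (exp (- 2 * pi * v)))) * exp (of_real (2 * pi * v))"
    unfolding inv_delta_def by (simp only: diff_conv_add_uminus exp_add)
  also have "exp (24 * divisor_log (of_real (exp (- 2 * pi * v)))) =
      complex_of_real (\<Sum>n. real (p24 n) * exp (- 2 * pi * v) ^ n)"
    by (rule p24_series_real(2)) (use assms in auto)
  finally show ?thesis by (simp only: exp_of_real of_real_mult[symmetric] mult.commute)
qed

text \<open>Nonnegative coefficients reduce the bound to the imaginary axis at height v = Im w. For
  v >= 1 the remainder is at most exp(2 pi v) * 100 exp(-2 pi v) = 100; for v < 1 the inversion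
  formula moves i v to i / v, where the series is at most 2.\<close>

lemma norm_inv_delta_remainder_le:
  assumes w: "Im w > 0"
  shows "norm (inv_delta w - exp (- 2 * of_real pi * \<i> * w)) \<le> 100 + 2 * Im w ^ 12 * exp (2 * pi / Im w)"
proof -
  define v where "v = Im w"
  have v: "v > 0" using w by (simp add: v_def)
  define r where "r = exp (- 2 * pi * v)"
  have r: "0 < r" "r < 1" using v by (simp_all add: r_def)
  let ?q = "exp (two_pi_i * w)"
  have q: "norm ?q = r" by (simp add: r_def v_def)
  let ?P = "\<lambda>r. \<Sum>n. real (p24 n) * r ^ n"
  have *: "norm (inv_delta w - exp (- 2 * of_real pi * \<i> * w)) \<le> exp (2 * pi * v) * (?P r - 1)"
  proof -
    have 1: "(\<lambda>n. of_nat (p24 n) * ?q ^ n) sums exp (24 * divisor_log ?q)"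
      by (rule sums_p24) (use q r in simp)
    hence 2: "(\<lambda>n. of_nat (p24 (Suc n)) * ?q ^ Suc n) sums (exp (24 * divisor_log ?q) - 1)"
      by (subst sums_Suc_iff) (simp add: p24_0)
    have 3: "(\<lambda>n. real (p24 (Suc n)) * r ^ Suc n) sums (?P r - 1)"
      using summable_sums[OF p24_series_real(1)[of r]] r by (subst sums_Suc_iff) (simp add: p24_0)
    have n: "norm (of_nat (p24 (Suc n)) * ?q ^ Suc n) = real (p24 (Suc n)) * r ^ Suc n" for n
      by (simp only: norm_mult norm_power q norm_of_nat)
    have "norm (exp (24 * divisor_log ?q) - 1) \<le> (\<Sum>n. norm (of_nat (p24 (Suc n)) * ?q ^ Suc n))"
      unfolding sums_unique[OF 2] by (rule summable_norm) (use 3 in \<open>simp only: n sums_iff\<close>)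
    also have "\<dots> = ?P r - 1" using 3 by (simp only: n sums_iff)
    finally have "norm (exp (24 * divisor_log ?q) - 1) \<le> ?P r - 1" .
    moreover have "inv_delta w - exp (- 2 * of_real pi * \<i> * w) =
        exp (- 2 * of_real pi * \<i> * w) * (exp (24 * divisor_log ?q) - 1)"
      by (simp add: inv_delta_def algebra_simps flip: exp_add)
    moreover have "norm (exp (- 2 * of_real pi * \<i> * w)) = exp (2 * pi * v)" by (simp add: v_def)
    ultimately show ?thesis by (simp only: norm_mult mult_left_mono exp_ge_zero)
  qed
  show ?thesis
  proof (cases "v \<ge> 1")
    case True
    have "?P r - 1 \<le> 100 * r"
      by (rule p24_series_le) (use r exp_minus_two_pi_le[OF True] in \<open>auto simp: r_def\<close>)
    hence "exp (2 * pi * v) * (?P r - 1) \<le> exp (2 * pi * v) * (100 * r)" by (intro mult_left_mono) auto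
    also have "\<dots> = 100" by (simp add: r_def exp_minus)
    also have "\<dots> \<le> 100 + 2 * v ^ 12 * exp (2 * pi / v)" using v by simp
    finally show ?thesis using * by (simp add: v_def)
  next
    case False
    have "complex_of_real (exp (2 * pi * v) * ?P r) = inv_delta (\<i> * of_real v)"
      unfolding r_def by (rule inv_delta_imaginary_axis[symmetric, OF v])
    also have "\<dots> = (\<i> * of_real v) ^ 12 * inv_delta (- 1 / (\<i> * of_real v))"
      by (rule inv_delta_inversion) (use v in simp)
    also have "- 1 / (\<i> * of_real v) = \<i> * of_real (1 / v)" using v by (simp add: field_simps)
    also have "inv_delta (\<i> * of_real (1 / v)) = of_real (exp (2 * pi * (1 / v)) * ?P (exp (- 2 * pi * (1 / v))))"
      by (rule inv_delta_imaginary_axis) (use v in simp)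
    also have "(\<i> * of_real v) ^ 12 = complex_of_real (v ^ 12)"
    proof -
      have "\<i> ^ 12 = 1" by (simp add: eval_nat_numeral)
      thus ?thesis by (simp only: power_mult_distrib of_real_power mult_1)
    qed
    finally have "exp (2 * pi * v) * ?P r = v ^ 12 * (exp (2 * pi * (1 / v)) * ?P (exp (- 2 * pi * (1 / v))))"
      unfolding of_real_mult[symmetric] of_real_eq_iff .
    also have "\<dots> \<le> v ^ 12 * (exp (2 * pi * (1 / v)) * 2)"
      by (intro mult_left_mono p24_series_le exp_minus_two_pi_le) (use v False in auto)
    also have "2 * pi * (1 / v) = 2 * pi / v" by simp
    finally have "exp (2 * pi * v) * (?P r - 1) \<le> 100 + 2 * v ^ 12 * exp (2 * pi / v)"
      using exp_gt_zero[of "2 * pi * v"] unfolding right_diff_distrib by linarith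
    with * show ?thesis by (simp add: v_def)
  qed
qed

section \<open>The integral of the polar term as a Bessel function\<close>

definition bessel_sum :: "real \<Rightarrow> real" where
  "bessel_sum X = (\<Sum>j. X ^ j / (fact j * fact (j + 13)))"

text \<open>\<open>bessel_sum X\<close> is X^(-13/2) I_13(2 sqrt X), so this is 2 pi \<nu>^(-13/2)
  I_13(4 pi sqrt \<nu>).\<close>

abbreviation bessel_main :: "real \<Rightarrow> real" where
  "bessel_main \<nu> \<equiv> (2 * pi) ^ 14 * bessel_sum (4 * pi\<^sup>2 * \<nu>)"

text \<open>The polar term exp(-2 pi i w) of \<open>inv_delta w\<close> at w = -1/z, with the weight
  factor z^12 and the exponential for \<nu> = n - 1.\<close>

definition circle_main :: "real \<Rightarrow> complex \<Rightarrow> complex" where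
  "circle_main \<nu> z = z ^ 12 * exp (two_pi_i / z) * exp (- 2 * of_real pi * \<i> * of_real \<nu> * z)"

lemma holomorphic_circle_main: "circle_main \<nu> holomorphic_on - {0}"
  unfolding circle_main_def by (intro holomorphic_intros) auto

lemma norm_circle_main:
  assumes "z \<noteq> 0"
  shows "norm (circle_main \<nu> z) = norm z ^ 12 * exp (2 * pi * Im z / (norm z)\<^sup>2 + 2 * pi * \<nu> * Im z)"
proof -
  have "Re (two_pi_i / z) = 2 * pi * Im z / (norm z)\<^sup>2"
    unfolding Re_divide cmod_power2 by simp
  thus ?thesis by (simp add: circle_main_def norm_mult norm_power exp_add mult_ac)
qed

lemma higher_deriv_exp_linear: "(deriv ^^ n) (\<lambda>z :: complex. exp (b * z)) = (\<lambda>z. b ^ n * exp (b * z))"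
proof (induction n)
  case (Suc n)
  have "deriv (\<lambda>z. b ^ n * exp (b * z)) z = b ^ Suc n * exp (b * z)" for z
    by (rule DERIV_imp_deriv) (auto intro!: derivative_eq_intros simp: mult_ac)
  thus ?case by (simp add: Suc.IH)
qed simp

text \<open>Expand exp(2 pi i / z) in powers of 1/z, uniformly on the circle, and evaluate every
  term by Cauchy's formulas.\<close>

lemma contour_integral_circle_main:
  assumes \<nu>: "\<nu> \<ge> 0"
  shows "contour_integral (circlepath 0 1) (circle_main \<nu>) = - of_real (bessel_main \<nu>)"
proof -
  define a where "a = two_pi_i"
  define b where "b = - 2 * of_real pi * \<i> * of_real \<nu>"
  define t where "t = (\<lambda>k z. a ^ k / fact k * (z ^ 12 / z ^ k * exp (b * z)))"
  \<comment> \<open>For k <= 12 the term has no pole. Otherwise z^12 / z^k has a pole of order k -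
    12, and the derivative of order k - 13 of exp(b z) at 0 appears.\<close>
  define c where "c = (\<lambda>k :: nat. if k \<le> 12 then 0 else a ^ k / fact k * (two_pi_i / fact (k - 13) * b ^ (k - 13)))"
  have t: "(t k has_contour_integral c k) (circlepath 0 1)" for k
  proof (cases "k \<le> 12")
    case True
    have "((\<lambda>z. a ^ k / fact k * (z ^ (12 - k) * exp (b * z))) has_contour_integral 0) (circlepath 0 1)"
      by (rule Cauchy_theorem_convex_simple[where S = UNIV]) (auto intro!: holomorphic_intros)
    moreover have "t k z = a ^ k / fact k * (z ^ (12 - k) * exp (b * z))" if "norm z = 1" for z
    proof -
      have "z \<noteq> 0" using that by auto
      thus ?thesis using True by (simp add: t_def power_diff)
    qed
    moreover have "c k = 0" using True by (simp add: c_def)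
    ultimately show ?thesis
      by (subst has_contour_integral_cong[of _ _ "\<lambda>z. a ^ k / fact k * (z ^ (12 - k) * exp (b * z))"]) auto
  next
    case False
    have "((\<lambda>u. exp (b * u) / (u - 0) ^ Suc (k - 13)) has_contour_integral
        ((2 * pi * \<i>) / fact (k - 13) * (deriv ^^ (k - 13)) (\<lambda>z. exp (b * z)) 0)) (circlepath 0 1)"
      by (rule Cauchy_has_contour_integral_higher_derivative_circlepath)
        (auto intro!: continuous_intros holomorphic_intros)
    from has_contour_integral_lmul[OF this, of "a ^ k / fact k"]
    have "((\<lambda>u. a ^ k / fact k * (exp (b * u) / (u - 0) ^ Suc (k - 13))) has_contour_integral c k) (circlepath 0 1)"
      using False by (simp add: c_def higher_deriv_exp_linear)
    moreover have "t k z = a ^ k / fact k * (exp (b * z) / (z - 0) ^ Suc (k - 13))" if "norm z = 1" for z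
    proof -
      have "z \<noteq> 0" using that by auto
      moreover
      have "z ^ k = z ^ 12 * z ^ Suc (k - 13)" using False by (simp flip: power_add del: power_Suc)
      ultimately show ?thesis by (simp add: t_def)
    qed
    ultimately show ?thesis
      by (subst has_contour_integral_cong[of _ _ "\<lambda>u. a ^ k / fact k * (exp (b * u) / (u - 0) ^ Suc (k - 13))"]) auto
  qed
  have sums_t: "(\<lambda>k. t k z) sums circle_main \<nu> z" if "z \<noteq> 0" for z
  proof -
    have "(\<lambda>k. ((a / z) ^ k /\<^sub>R fact k) * (z ^ 12 * exp (b * z))) sums (exp (a / z) * (z ^ 12 * exp (b * z)))"
      by (intro sums_mult2 exp_converges)
    thus ?thesis by (simp add: t_def circle_main_def a_def b_def scaleR_conv_of_real power_divide field_simps)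
  qed
  have "uniform_limit (path_image (circlepath 0 1)) (\<lambda>K z. \<Sum>k<K. t k z) (\<lambda>z. suminf (\<lambda>k. t k z)) sequentially"
  proof (rule Weierstrass_m_test)
    fix k z assume "z \<in> path_image (circlepath 0 1)"
    hence z: "norm z = 1" by simp
    have "Re (b * z) \<le> norm b * norm z" by (metis complex_Re_le_cmod norm_mult)
    hence "norm (exp (b * z)) \<le> exp (norm b)" using z by simp
    hence "norm a ^ k /\<^sub>R fact k * norm (exp (b * z)) \<le> norm a ^ k /\<^sub>R fact k * exp (norm b)"
      by (rule mult_left_mono) simp
    moreover have "norm (t k z) = norm a ^ k /\<^sub>R fact k * norm (exp (b * z))"
      using z by (simp add: t_def norm_mult norm_divide norm_power divide_inverse norm_inverse del: norm_exp_eq_Re)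
    ultimately show "norm (t k z) \<le> norm a ^ k /\<^sub>R fact k * exp (norm b)" by simp
  next
    show "summable (\<lambda>k. norm a ^ k /\<^sub>R fact k * exp (norm b))"
      by (intro summable_mult2 summable_exp_generic)
  qed
  also have "?this \<longleftrightarrow> uniform_limit (path_image (circlepath 0 1)) (\<lambda>K z. \<Sum>k<K. t k z) (circle_main \<nu>) sequentially"
  proof (rule uniform_limit_cong')
    fix z assume "z \<in> path_image (circlepath 0 (1 :: real))"
    hence "z \<noteq> 0" by auto
    from sums_t[OF this] show "suminf (\<lambda>k. t k z) = circle_main \<nu> z" by (simp add: sums_iff)
  qed simp
  finally have lim: "uniform_limit (path_image (circlepath 0 1)) (\<lambda>K z. \<Sum>k<K. t k z) (circle_main \<nu>) sequentially" .
  have int: "((\<lambda>z. \<Sum>k<K. t k z) has_contour_integral (\<Sum>k<K. c k)) (circlepath 0 1)" for K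
    by (intro has_contour_integral_sum t) auto
  have ev: "\<forall>\<^sub>F K in sequentially. (\<lambda>z. \<Sum>k<K. t k z) contour_integrable_on (circlepath 0 1)"
    using int by (intro always_eventually allI) (rule has_contour_integral_integrable)
  have "(\<lambda>K. contour_integral (circlepath 0 1) (\<lambda>z. \<Sum>k<K. t k z)) \<longlonglongrightarrow> contour_integral (circlepath 0 1) (circle_main \<nu>)"
    using lim by (intro contour_integral_uniform_limit_circlepath[OF ev]) auto
  hence "c sums contour_integral (circlepath 0 1) (circle_main \<nu>)"
    unfolding contour_integral_unique[OF int] sums_def .
  moreover have "(\<Sum>k<13. c k) = 0" by (intro sum.neutral) (auto simp: c_def)
  ultimately have *: "(\<lambda>j. c (j + 13)) sums contour_integral (circlepath 0 1) (circle_main \<nu>)"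
    using sums_iff_shift[of c 13 "contour_integral (circlepath 0 1) (circle_main \<nu>)"] by simp
  let ?X = "4 * pi\<^sup>2 * \<nu>"
  have s: "summable (\<lambda>j. ?X ^ j / (fact j * fact (j + 13)))"
  proof (rule summable_comparison_test')
    show "summable (\<lambda>j. ?X ^ j /\<^sub>R fact j)" by (rule summable_exp_generic)
    show "norm (?X ^ j / (fact j * fact (j + 13))) \<le> ?X ^ j /\<^sub>R fact j" if "j \<ge> 0" for j
    proof -
      have "?X ^ j / (fact j * fact (j + 13)) \<le> ?X ^ j / (fact j * 1)"
        using \<nu> by (intro divide_left_mono mult_left_mono) auto
      thus ?thesis using \<nu> by (simp add: divide_inverse mult_ac)
    qed
  qed
  have "c (j + 13) = - of_real ((2 * pi) ^ 14 * (?X ^ j / (fact j * fact (j + 13))))" for j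
  proof -
    have ab: "a * b = of_real ?X" by (simp add: a_def b_def power2_eq_square)
    \<comment> \<open>Fourteen factors 2 pi i: thirteen from the power of \<open>a\<close>, one from
      Cauchy's formula. The resulting minus sign reflects that the counterclockwise contour runs
      through its upper side from right to left.\<close>
    have "\<i> ^ 14 = -1" by (simp add: eval_nat_numeral)
    hence a14: "a ^ 14 = - of_real ((2 * pi) ^ 14)"
      by (simp add: a_def power_mult_distrib)
    have "c (j + 13) = a ^ 14 * (a * b) ^ j / (fact j * fact (j + 13))"
    proof -
      have "a ^ 14 * (a * b) ^ j = a ^ (j + 13) * two_pi_i * b ^ j"
        by (simp add: a_def power_mult_distrib power_add eval_nat_numeral)
      moreover have "c (j + 13) = a ^ (j + 13) * two_pi_i * b ^ j / (fact j * fact (j + 13))"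
        by (simp add: c_def mult.commute mult.left_commute)
      ultimately show ?thesis by (simp only:)
    qed
    also have "\<dots> = - of_real ((2 * pi) ^ 14) * of_real ?X ^ j / (fact j * fact (j + 13))"
      by (simp only: ab a14)
    finally show ?thesis by simp
  qed
  with * have "(\<lambda>j. - of_real ((2 * pi) ^ 14 * (?X ^ j / (fact j * fact (j + 13))))) sums contour_integral (circlepath 0 1) (circle_main \<nu>)"
    by simp
  moreover have "(\<lambda>j. - complex_of_real ((2 * pi) ^ 14 * (?X ^ j / (fact j * fact (j + 13))))) sums - of_real ((2 * pi) ^ 14 * bessel_sum ?X)"
    unfolding bessel_sum_def by (intro sums_minus sums_of_real sums_mult summable_sums s)
  ultimately show ?thesis by (rule sums_unique2)
qed

lemma contour_integral_rectpath_circle_main: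
  assumes \<nu>: "\<nu> \<ge> 0" and y: "y > 0"
  shows "contour_integral (rectpath (Complex (-1/2) (-y)) (Complex (1/2) y)) (circle_main \<nu>) =
     - of_real (bessel_main \<nu>)"
proof -
  let ?R = "rectpath (Complex (-1/2) (-y)) (Complex (1/2) y)"
  have z: "0 \<in> box (Complex (-1/2) (-y)) (Complex (1/2) y)" using y by (simp add: in_box_complex_iff)
  have "contour_integral ?R (circle_main \<nu>) = 2 * pi * \<i> * (\<Sum>p\<in>{0}. winding_number ?R p * residue (circle_main \<nu>) p)"
  proof (rule Residue_theorem)
    show "circle_main \<nu> holomorphic_on UNIV - {0}" using holomorphic_circle_main[of \<nu>] by (simp add: Compl_eq_Diff_UNIV)
    show "path_image ?R \<subseteq> UNIV - {0}"
      using y by (auto simp: path_image_rectpath)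
  qed auto
  also have "\<dots> = 2 * pi * \<i> * residue (circle_main \<nu>) 0"
    using winding_number_rectpath[OF z] by simp
  also have "\<dots> = contour_integral (circlepath 0 1) (circle_main \<nu>)"
  proof (rule contour_integral_unique[symmetric], rule base_residue[of UNIV])
    show "circle_main \<nu> holomorphic_on UNIV - {0}" using holomorphic_circle_main[of \<nu>] by (simp add: Compl_eq_Diff_UNIV)
  qed auto
  finally show ?thesis by (simp add: contour_integral_circle_main[OF \<nu>])
qed

text \<open>Close the segment to a rectangle around 0 and reverse its upper side. On the lower side
  both exponents are nonpositive, so the integrand is at most 1; on the vertical sides, each of
  length 2 y, |z|^2 >= 1/4 bounds the polar exponent by 8 pi y.\<close>

lemma horizontal_integral_circle_main:
  assumes \<nu>: "\<nu> \<ge> 0" and y: "0 < y" "y \<le> 1 / 2"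
  shows "circle_main \<nu> contour_integrable_on (linepath (Complex (-1/2) y) (Complex (1/2) y))"
    "norm (contour_integral (linepath (Complex (-1/2) y) (Complex (1/2) y)) (circle_main \<nu>) -
       of_real (bessel_main \<nu>)) \<le> 1 + 4 * y * exp (8 * pi * y + 2 * pi * \<nu> * y)"
proof -
  define a1 a2 a3 a4 where "a1 = Complex (-1/2) (-y)" and "a2 = Complex (1/2) (-y)"
    and "a3 = Complex (1/2) y" and "a4 = Complex (-1/2) y"
  note defs = a1_def a2_def a3_def a4_def
  let ?f = "circle_main \<nu>"
  have nz: "0 \<notin> closed_segment a1 a2" "0 \<notin> closed_segment a2 a3" "0 \<notin> closed_segment a3 a4" "0 \<notin> closed_segment a4 a1"
    "0 \<notin> closed_segment a4 a3"
    using y by (auto simp: defs closed_segment_same_Im closed_segment_same_Re)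
  have int: "?f contour_integrable_on linepath p q" if "0 \<notin> closed_segment p q" for p q
    by (intro contour_integrable_continuous_linepath holomorphic_on_imp_continuous_on
        holomorphic_on_subset[OF holomorphic_circle_main]) (use that in auto)
  note i = int[OF nz(1)] int[OF nz(2)] int[OF nz(3)] int[OF nz(4)] int[OF nz(5)]
  show "?f contour_integrable_on (linepath (Complex (-1/2) y) (Complex (1/2) y))"
    using i(5) by (simp add: defs)
  let ?I = "\<lambda>p q. contour_integral (linepath p q) ?f"
  have "contour_integral (rectpath a1 a3) ?f = ?I a1 a2 + (?I a2 a3 + (?I a3 a4 + ?I a4 a1))"
    unfolding rectpath_def Let_def using i by (simp add: defs contour_integrable_join)
  moreover have "contour_integral (rectpath a1 a3) ?f = - of_real (bessel_main \<nu>)"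
    using contour_integral_rectpath_circle_main[OF \<nu> y(1)] by (simp add: defs)
  moreover have "?I a3 a4 = - ?I a4 a3" by (rule contour_integral_reverse_linepath[OF continuous_on_subset])
      (use nz holomorphic_on_imp_continuous_on[OF holomorphic_circle_main[of \<nu>]] in auto)
  ultimately have eq: "?I a4 a3 - of_real (bessel_main \<nu>) = ?I a1 a2 + ?I a2 a3 + ?I a4 a1"
    by (simp add: algebra_simps)
  let ?B = "exp (8 * pi * y + 2 * pi * \<nu> * y)"
  have nrm: "norm z ^ 12 \<le> 1" if "\<bar>Re z\<bar> \<le> 1 / 2" "\<bar>Im z\<bar> \<le> y" for z
    using that y cmod_le[of z] by (intro power_le_one) auto
  have 1: "norm (?I a1 a2) \<le> 1 * norm (a2 - a1)"
  proof (rule contour_integral_bound_linepath[OF i(1)])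
    fix z assume z: "z \<in> closed_segment a1 a2"
    hence zz: "\<bar>Re z\<bar> \<le> 1 / 2" "Im z = - y" by (auto simp: defs closed_segment_same_Im closed_segment_eq_real_ivl)
    have "z \<noteq> 0" using z nz by auto
    moreover have "2 * pi * Im z / (norm z)\<^sup>2 + 2 * pi * \<nu> * Im z \<le> 0"
      using zz y \<nu> by (intro add_nonpos_nonpos divide_nonpos_nonneg mult_nonneg_nonpos) auto
    moreover have "norm z ^ 12 \<le> 1" using nrm[of z] zz y by simp
    ultimately show "norm (?f z) \<le> 1" by (simp add: norm_circle_main mult_le_one)
  qed simp
  have side: "norm (?f z) \<le> ?B" if "\<bar>Re z\<bar> = 1 / 2" "\<bar>Im z\<bar> \<le> y" for z
  proof -
    have "z \<noteq> 0" using that by auto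
    have "1 / 4 \<le> (norm z)\<^sup>2"
    proof -
      have "\<bar>Re z\<bar>\<^sup>2 \<le> (norm z)\<^sup>2" by (intro power_mono abs_Re_le_cmod) auto
      thus ?thesis using that by (simp add: power2_eq_square)
    qed
    hence "2 * pi * Im z / (norm z)\<^sup>2 \<le> 2 * pi * y / (1 / 4)"
      using that y by (intro frac_le mult_left_mono) auto
    moreover have "2 * pi * \<nu> * Im z \<le> 2 * pi * \<nu> * y" using that \<nu> by (intro mult_left_mono) auto
    ultimately have "2 * pi * Im z / (norm z)\<^sup>2 + 2 * pi * \<nu> * Im z \<le> 2 * pi * y / (1 / 4) + 2 * pi * \<nu> * y"
      by (rule add_mono)
    also have "\<dots> = 8 * pi * y + 2 * pi * \<nu> * y" by simp
    finally have "exp (2 * pi * Im z / (norm z)\<^sup>2 + 2 * pi * \<nu> * Im z) \<le> ?B"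
      unfolding exp_le_cancel_iff .
    moreover have "norm z ^ 12 \<le> 1" using nrm that by simp
    ultimately have "norm z ^ 12 * exp (2 * pi * Im z / (norm z)\<^sup>2 + 2 * pi * \<nu> * Im z) \<le> 1 * ?B"
      by (intro mult_mono) auto
    thus ?thesis using \<open>z \<noteq> 0\<close> by (simp add: norm_circle_main)
  qed
  have 2: "norm (?I a2 a3) \<le> ?B * norm (a3 - a2)"
    by (rule contour_integral_bound_linepath[OF i(2)])
      (use y side in \<open>auto simp: defs closed_segment_same_Re closed_segment_eq_real_ivl\<close>)
  have 3: "norm (?I a4 a1) \<le> ?B * norm (a1 - a4)"
    by (rule contour_integral_bound_linepath[OF i(4)])
      (use y side in \<open>auto simp: defs closed_segment_same_Re closed_segment_eq_real_ivl\<close>)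
  have n: "norm (a2 - a1) = 1" "norm (a3 - a2) = 2 * y" "norm (a1 - a4) = 2 * y"
    using y by (simp_all add: defs cmod_def complex_diff real_sqrt_mult)
  have "norm (?I a1 a2 + ?I a2 a3 + ?I a4 a1) \<le> 1 + ?B * (2 * y) + ?B * (2 * y)"
    using 1 2 3 unfolding n by (intro order_trans[OF norm_triangle_ineq] add_mono) auto
  thus "norm (contour_integral (linepath (Complex (-1/2) y) (Complex (1/2) y)) (circle_main \<nu>) -
       of_real (bessel_main \<nu>)) \<le> 1 + 4 * y * ?B"
    using eq by (simp add: defs algebra_simps)
qed

text \<open>By inversion the integrand minus \<open>circle_main\<close> is z^12 times the remainder
  of \<open>inv_delta\<close> at -1/z, whose height is v = y / |z|^2.\<close>

lemma p24_bessel_estimate_aux: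
  assumes n: "n \<ge> 1" and y: "0 < y" "y \<le> 1 / 2"
  defines "\<nu> \<equiv> real n - 1"
  shows "\<bar>real (p24 n) - bessel_main \<nu>\<bar> \<le>
    (100 + 2 * exp (pi / (2 * y) + 2 * pi * y)) * exp (2 * pi * \<nu> * y) + (1 + 4 * y * exp (8 * pi * y + 2 * pi * \<nu> * y))"
proof -
  let ?D = "\<lambda>z. inv_delta (- 1 / z) - exp (- 2 * of_real pi * \<i> * (- 1 / z))"
  have \<nu>: "\<nu> \<ge> 0" using n by (simp add: \<nu>_def)
  let ?a = "Complex (-1/2) y" and ?b = "Complex (1/2) y"
  let ?\<gamma> = "linepath ?a ?b"
  let ?e = "\<lambda>z. exp (- 2 * of_real pi * \<i> * of_real \<nu> * z)"
  let ?B = "(100 + 2 * exp (pi / (2 * y) + 2 * pi * y)) * exp (2 * pi * \<nu> * y)"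
  have 1: "((\<lambda>z. inv_delta z * ?e z) has_contour_integral of_nat (p24 n)) ?\<gamma>"
    using p24_contour_integral[OF y(1), of n] by (simp add: \<nu>_def)
  have "((\<lambda>z. inv_delta z * ?e z - circle_main \<nu> z) has_contour_integral
      (of_nat (p24 n) - contour_integral ?\<gamma> (circle_main \<nu>))) ?\<gamma>"
    by (intro has_contour_integral_diff 1 has_contour_integral_integral horizontal_integral_circle_main \<nu> y)
  hence "norm (of_nat (p24 n) - contour_integral ?\<gamma> (circle_main \<nu>)) \<le> ?B * norm (?b - ?a)"
  proof (rule has_contour_integral_bound_linepath)
    fix z assume "z \<in> closed_segment ?a ?b"
    hence z: "\<bar>Re z\<bar> \<le> 1 / 2" "Im z = y"
      by (auto simp: closed_segment_same_Im closed_segment_eq_real_ivl)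
    have z0: "z \<noteq> 0" "norm z > 0" using z y by auto
    define v where "v = Im (- 1 / z)"
    have v: "v = y / (norm z)\<^sup>2" using z by (simp add: v_def Im_divide cmod_power2)
    have vpos: "v > 0" using v y z0 by simp
    have nz: "norm z \<le> 1" using z y cmod_le[of z] by simp
    have inv: "inv_delta z * ?e z - circle_main \<nu> z =
        z ^ 12 * (?D z) * ?e z"
      using inv_delta_inversion[of z] z y by (simp add: circle_main_def algebra_simps)
    have "norm (?D z) \<le> 100 + 2 * v ^ 12 * exp (2 * pi / v)"
      using norm_inv_delta_remainder_le[of "- 1 / z"] vpos unfolding v_def by simp
    hence "norm z ^ 12 * norm (?D z) \<le>
        norm z ^ 12 * (100 + 2 * v ^ 12 * exp (2 * pi / v))" by (intro mult_left_mono) auto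
    also have "\<dots> = norm z ^ 12 * 100 + 2 * (norm z * v) ^ 12 * exp (2 * pi / v)"
      by (simp add: power_mult_distrib algebra_simps)
    \<comment> \<open>The factor v^12 is harmless since |z| v = y / |z| <= 1, and 2 pi / v = 2 pi
      |z|^2 / y with |z|^2 <= 1/4 + y^2.\<close>
    also have "\<dots> \<le> 1 * 100 + 2 * 1 * exp (pi / (2 * y) + 2 * pi * y)"
    proof (intro add_mono mult_mono mult_left_mono)
      show "norm z ^ 12 \<le> 1" using nz by (intro power_le_one) auto
      have "norm z * v = y / norm z" using z0 by (simp add: v power2_eq_square)
      also have "\<dots> \<le> 1" using z0 abs_Im_le_cmod[of z] z y by simp
      finally show "(norm z * v) ^ 12 \<le> 1" using vpos by (intro power_le_one) auto
      have "(norm z)\<^sup>2 \<le> 1 / 4 + y\<^sup>2"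
      proof -
        have "\<bar>Re z\<bar>\<^sup>2 \<le> (1/2)\<^sup>2" using z by (intro power_mono) auto
        thus ?thesis unfolding cmod_power2 z(2) by (simp add: power_divide)
      qed
      hence "(norm z)\<^sup>2 / y \<le> (1 / 4 + y\<^sup>2) / y" using y by (intro divide_right_mono) auto
      also have "\<dots> = 1 / (4 * y) + y" using y by (simp add: field_simps power2_eq_square)
      finally have "2 * pi * ((norm z)\<^sup>2 / y) \<le> 2 * pi * (1 / (4 * y) + y)" by (intro mult_left_mono) auto
      also have "2 * pi * ((norm z)\<^sup>2 / y) = 2 * pi / v" using v by simp
      also have "2 * pi * (1 / (4 * y) + y) = pi / (2 * y) + 2 * pi * y" by (simp add: field_simps)
      finally show "exp (2 * pi / v) \<le> exp (pi / (2 * y) + 2 * pi * y)" by simp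
    qed (use vpos in auto)
    finally have "norm z ^ 12 * norm (?D z) \<le>
        100 + 2 * exp (pi / (2 * y) + 2 * pi * y)" by simp
    moreover have "norm (?e z) = exp (2 * pi * \<nu> * y)" using z by simp
    ultimately show "norm (inv_delta z * ?e z - circle_main \<nu> z) \<le> ?B"
      unfolding inv norm_mult norm_power by (simp only:) (intro mult_right_mono, auto)
  qed simp
  also have "norm (?b - ?a) = 1" by (simp add: cmod_def complex_diff)
  finally have "norm (of_nat (p24 n) - contour_integral ?\<gamma> (circle_main \<nu>)) \<le> ?B" by simp
  moreover have "norm (contour_integral ?\<gamma> (circle_main \<nu>) - of_real (bessel_main \<nu>)) \<le>
      1 + 4 * y * exp (8 * pi * y + 2 * pi * \<nu> * y)"
    by (rule horizontal_integral_circle_main[OF \<nu> y])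
  ultimately have "norm (of_nat (p24 n) - complex_of_real (bessel_main \<nu>)) \<le>
      ?B + (1 + 4 * y * exp (8 * pi * y + 2 * pi * \<nu> * y))"
    by (rule norm_diff_triangle_le)
  moreover have "of_nat (p24 n) - complex_of_real (bessel_main \<nu>) =
      of_real (real (p24 n) - bessel_main \<nu>)" by simp
  ultimately show ?thesis by (simp only: norm_of_real)
qed

text \<open>The height y = 1/t with t = sqrt(n-1) is the saddle point of the polar term on the
  imaginary axis. The exponents 2 pi t and pi t / 2 add up to 5/2 pi t; t >= 10 bounds the leftovers
  exp(2 pi / t) and exp(8 pi / t) by 3 and 81.\<close>

lemma p24_bessel_estimate:
  assumes n: "n \<ge> 101"
  shows "\<bar>real (p24 n) - bessel_main (real n - 1)\<bar> \<le> 200 * exp (5 / 2 * pi * sqrt (real n - 1))"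
proof -
  define t where "t = sqrt (real n - 1)"
  have "10\<^sup>2 \<le> real n - 1" using n by simp
  hence t: "t \<ge> 10" unfolding t_def by (rule real_le_rsqrt)
  have t2: "real n - 1 = t\<^sup>2" unfolding t_def using n by simp
  have pi: "3 < pi" "pi < 4" using pi_gt3 pi_less_4 by auto
  define E where "E = exp (2 * pi * t)"
  have E: "E \<ge> 1" using t by (simp add: E_def)
  define F where "F = exp (pi * t / 2)"
  have F: "F \<ge> 1" using t by (simp add: F_def)
  have EF: "E * F = exp (5 / 2 * pi * t)" by (simp add: E_def F_def algebra_simps flip: exp_add)
  have e1: "exp (1 :: real) \<le> 3" by (rule exp_le)
  have "\<bar>real (p24 n) - bessel_main (real n - 1)\<bar> \<le>
      (100 + 2 * exp (pi / (2 * (1 / t)) + 2 * pi * (1 / t))) * exp (2 * pi * (real n - 1) * (1 / t))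
      + (1 + 4 * (1 / t) * exp (8 * pi * (1 / t) + 2 * pi * (real n - 1) * (1 / t)))"
    by (rule p24_bessel_estimate_aux) (use n t in auto)
  also have "2 * pi * (real n - 1) * (1 / t) = 2 * pi * t" unfolding t2 using t by (simp add: power2_eq_square)
  also have "exp (pi / (2 * (1 / t)) + 2 * pi * (1 / t)) = F * exp (2 * pi * (1 / t))"
    using t by (simp add: F_def exp_add)
  also have "exp (8 * pi * (1 / t) + 2 * pi * t) = exp (8 * pi * (1 / t)) * E" by (simp add: E_def exp_add)
  also have "exp (2 * pi * t) = E" by (simp add: E_def)
  finally have *: "\<bar>real (p24 n) - bessel_main (real n - 1)\<bar> \<le>
      (100 + 2 * (F * exp (2 * pi * (1 / t)))) * E + (1 + 4 * (1 / t) * (exp (8 * pi * (1 / t)) * E))" .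
  have "pi * (1 / t) \<le> 4 * (1 / 10)" using t pi by (intro mult_mono frac_le) auto
  hence "2 * pi * (1 / t) \<le> 1" "8 * pi * (1 / t) \<le> of_nat 4 * 1" by simp_all
  hence a1: "exp (2 * pi * (1 / t)) \<le> exp 1" and b1: "exp (8 * pi * (1 / t)) \<le> exp (of_nat 4 * 1)"
    by (simp_all only: exp_le_cancel_iff)
  have a: "exp (2 * pi * (1 / t)) \<le> 3" using a1 e1 by (rule order_trans)
  have "exp (of_nat 4 * 1 :: real) \<le> 3 ^ 4" unfolding exp_of_nat_mult by (intro power_mono exp_le) auto
  with b1 have b: "exp (8 * pi * (1 / t)) \<le> 81" by (rule order_trans[THEN order_trans]) simp
  have "(100 + 2 * (F * exp (2 * pi * (1 / t)))) * E \<le> (100 * F + 2 * (F * 3)) * E"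
    using a E F by (intro mult_right_mono add_mono mult_left_mono) auto
  moreover have "4 * (1 / t) * (exp (8 * pi * (1 / t)) * E) \<le> 4 * (1 / 10) * (81 * E)"
    using b t E by (intro mult_mono frac_le) auto
  moreover have "E \<le> E * F" "1 \<le> E * F" using E F mult_mono[of 1 E 1 F] by auto
  ultimately have "(100 + 2 * (F * exp (2 * pi * (1 / t)))) * E + (1 + 4 * (1 / t) * (exp (8 * pi * (1 / t)) * E)) \<le> 200 * (E * F)"
  proof -
    assume *: "(100 + 2 * (F * exp (2 * pi * (1 / t)))) * E \<le> (100 * F + 2 * (F * 3)) * E"
      "4 * (1 / t) * (exp (8 * pi * (1 / t)) * E) \<le> 4 * (1 / 10) * (81 * E)" "E \<le> E * F" "1 \<le> E * F"
    have "(100 * F + 2 * (F * 3)) * E = 106 * (E * F)" by simp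
    with * show ?thesis by linarith
  qed
  with * show ?thesis unfolding EF t_def by linarith
qed

section \<open>The Laplace integral of the Bessel function\<close>

definition binom25 :: "nat \<Rightarrow> real" where
  "binom25 k = (25 / 2) gchoose k"

lemma binom25_Suc: "binom25 (Suc k) = binom25 k * (25 / 2 - real k) / (real k + 1)"
  using gbinomial_mult_1[of "25 / 2 :: real" k] by (simp add: binom25_def field_simps)

lemma binom25_0: "binom25 0 = 1"
  by (simp add: binom25_def)

lemma binom25_values:
  "binom25 1 = 25 / 2" "binom25 2 = 575 / 8" "binom25 3 = 4025 / 16" "binom25 4 = 76475 / 128"
  "binom25 5 = 260015 / 256" "binom25 6 = 1300075 / 1024"
  using binom25_Suc[of 0] binom25_Suc[of 1] binom25_Suc[of 2] binom25_Suc[of 3] binom25_Suc[of 4] binom25_Suc[of 5]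
  by (simp_all add: binom25_0 eval_nat_numeral)

lemma sum_abs_binom25_le: "(\<Sum>k<L. \<bar>binom25 k\<bar>) \<le> 6000"
proof -
  \<comment> \<open>The left side does not depend on \<open>L\<close>: for k > 25/2 the ratio of
    consecutive coefficients gives k |b_k| - (k+1) |b_(k+1)| = 25/2 |b_k|, so the added term is
    exactly the room for all later coefficients.\<close>
  have "(\<Sum>k<13 + L. \<bar>binom25 k\<bar>) + real (13 + L) * \<bar>binom25 (13 + L)\<bar> / (25 / 2) \<le> 6000" for L
  proof (induction L)
    case 0
    show ?case
      by (simp add: eval_nat_numeral lessThan_Suc binom25_Suc binom25_0)
  next
    case (Suc L)
    have "\<bar>binom25 (Suc (13 + L))\<bar> = \<bar>binom25 (13 + L)\<bar> * (real (13 + L) - 25 / 2) / (real (13 + L) + 1)"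
      unfolding binom25_Suc abs_mult abs_divide by simp
    hence h: "real (Suc (13 + L)) * \<bar>binom25 (Suc (13 + L))\<bar> = \<bar>binom25 (13 + L)\<bar> * (real (13 + L) - 25 / 2)"
      by simp
    have "(\<Sum>k<13 + Suc L. \<bar>binom25 k\<bar>) + real (13 + Suc L) * \<bar>binom25 (13 + Suc L)\<bar> / (25 / 2) =
        (\<Sum>k<13 + L. \<bar>binom25 k\<bar>) + (\<bar>binom25 (13 + L)\<bar> + \<bar>binom25 (13 + L)\<bar> * (real (13 + L) - 25 / 2) / (25 / 2))"
      unfolding add_Suc_right h sum.lessThan_Suc by (simp only: add.assoc)
    also have "\<bar>binom25 (13 + L)\<bar> + \<bar>binom25 (13 + L)\<bar> * (real (13 + L) - 25 / 2) / (25 / 2) =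
        real (13 + L) * \<bar>binom25 (13 + L)\<bar> / (25 / 2)"
    proof -
      have "X + X * (r - 25 / 2) / (25 / 2) = r * X / (25 / 2)" for X r :: real
        by (simp add: field_simps)
      thus ?thesis .
    qed
    finally show ?case using Suc by simp
  qed
  note le = this[of L]
  have "(\<Sum>k<L. \<bar>binom25 k\<bar>) \<le> (\<Sum>k<13 + L. \<bar>binom25 k\<bar>)" by (rule sum_mono2) auto
  also have "\<dots> \<le> (\<Sum>k<13 + L. \<bar>binom25 k\<bar>) + real (13 + L) * \<bar>binom25 (13 + L)\<bar> / (25 / 2)" by simp
  finally show ?thesis using le by linarith
qed

text \<open>From k = 6 on, consecutive coefficients have quotient at most 1 in absolute value, and
  the value at 6 is about 1270.\<close>

lemma abs_binom25_le: "\<bar>binom25 k\<bar> \<le> 1300"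
proof -
  have "\<bar>binom25 (6 + j)\<bar> \<le> 1300" for j
  proof (induction j)
    case (Suc j)
    have "\<bar>binom25 (6 + Suc j)\<bar> = \<bar>binom25 (6 + j)\<bar> * (\<bar>25 / 2 - real (6 + j)\<bar> / (real (6 + j) + 1))"
      unfolding add_Suc_right binom25_Suc abs_mult abs_divide by simp
    also have "\<dots> \<le> \<bar>binom25 (6 + j)\<bar> * 1"
      by (intro mult_left_mono) (auto simp: divide_simps)
    finally show ?case using Suc by simp
  qed (simp add: binom25_values)
  from this[of "k - 6"] show ?thesis
  proof (cases "k \<ge> 6")
    case False
    hence "k \<in> {0, 1, 2, 3, 4, 5}" by auto
    thus ?thesis using binom25_values binom25_0 by auto
  qed simp
qed

lemma summable_abs_binom25: "summable (\<lambda>k. \<bar>binom25 k\<bar>)"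
  by (rule summableI_nonneg_bounded[of _ 6000]) (use sum_abs_binom25_le in auto)

text \<open>The cut-off at \<open>u = 1\<close> agrees with the continuous extension by zero, so that the Taylor
  remainder bound holds on the whole half line.\<close>

definition cut_power :: "real \<Rightarrow> real" where
  "cut_power u = (if u \<le> 1 then (1 - u) powr (25 / 2) else 0)"

text \<open>For u < 1 this is the tail of the absolutely convergent binomial series; for u >= 1 the
  function is 0 and every power in the polynomial is at most u^M. In both cases the absolute sum of
  the coefficients is the constant, whatever \<open>M\<close> is.\<close>

lemma cut_power_remainder:
  assumes u: "u \<ge> 0"
  shows "\<bar>cut_power u - (\<Sum>k<M. (-1) ^ k * binom25 k * u ^ k)\<bar> \<le> 6000 * u ^ M"
proof (cases "u < 1")
  case True
  have s: "(\<lambda>k. (-1) ^ k * binom25 k * u ^ k) sums cut_power u"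
    using gen_binomial_real[of "- u" "25 / 2"] u True
    by (simp add: cut_power_def binom25_def power_minus[of u] mult_ac)
  have "(\<lambda>k. (-1) ^ (k + M) * binom25 (k + M) * u ^ (k + M)) sums (cut_power u - (\<Sum>k<M. (-1) ^ k * binom25 k * u ^ k))"
    using s by (subst sums_iff_shift) simp
  hence eq: "cut_power u - (\<Sum>k<M. (-1) ^ k * binom25 k * u ^ k) = (\<Sum>k. (-1) ^ (k + M) * binom25 (k + M) * u ^ (k + M))"
    by (simp add: sums_iff)
  have sb: "summable (\<lambda>k. \<bar>binom25 (k + M)\<bar>)" using summable_abs_binom25 by (rule summable_ignore_initial_segment)
  have b: "norm ((-1) ^ (k + M) * binom25 (k + M) * u ^ (k + M)) \<le> u ^ M * \<bar>binom25 (k + M)\<bar>" for k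
  proof -
    have "u ^ (k + M) \<le> u ^ M" using u True by (intro power_decreasing) auto
    thus ?thesis using u by (simp add: abs_mult power_abs mult.commute[of "u ^ M"] mult_left_mono)
  qed
  have sn: "summable (\<lambda>k. norm ((-1) ^ (k + M) * binom25 (k + M) * u ^ (k + M)))"
    by (rule summable_comparison_test'[OF summable_mult[OF sb, of "u ^ M"], of 0]) (use b in simp)
  have "\<bar>\<Sum>k. (-1) ^ (k + M) * binom25 (k + M) * u ^ (k + M)\<bar> \<le> (\<Sum>k. norm ((-1) ^ (k + M) * binom25 (k + M) * u ^ (k + M)))"
    using summable_norm[OF sn] by simp
  also have "\<dots> \<le> (\<Sum>k. u ^ M * \<bar>binom25 (k + M)\<bar>)" by (rule suminf_le[OF b sn summable_mult[OF sb]])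
  also have "\<dots> = u ^ M * (\<Sum>k. \<bar>binom25 (k + M)\<bar>)" by (rule suminf_mult[OF sb])
  also have "\<dots> \<le> u ^ M * 6000"
  proof (rule mult_left_mono)
    have "(\<Sum>k. \<bar>binom25 (k + M)\<bar>) \<le> (\<Sum>k. \<bar>binom25 k\<bar>)"
      using suminf_split_initial_segment[OF summable_abs_binom25, of M] by (simp add: sum_nonneg)
    also have "\<dots> \<le> 6000" by (rule suminf_le_const[OF summable_abs_binom25]) (rule sum_abs_binom25_le)
    finally show "(\<Sum>k. \<bar>binom25 (k + M)\<bar>) \<le> 6000" .
  qed (use u in simp)
  finally show ?thesis unfolding eq by (simp only: mult.commute[of "u ^ M"])
next
  case False
  hence "cut_power u = 0" by (auto simp: cut_power_def)
  have "\<bar>\<Sum>k<M. (-1) ^ k * binom25 k * u ^ k\<bar> \<le> (\<Sum>k<M. \<bar>(-1) ^ k * binom25 k * u ^ k\<bar>)" by (rule sum_abs)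
  also have "\<dots> \<le> (\<Sum>k<M. \<bar>binom25 k\<bar> * u ^ M)"
  proof (rule sum_mono)
    fix k assume "k \<in> {..<M}"
    hence "u ^ k \<le> u ^ M" using False by (intro power_increasing) auto
    thus "\<bar>(-1) ^ k * binom25 k * u ^ k\<bar> \<le> \<bar>binom25 k\<bar> * u ^ M"
      using u by (simp add: abs_mult power_abs mult_left_mono)
  qed
  also have "\<dots> = (\<Sum>k<M. \<bar>binom25 k\<bar>) * u ^ M" by (simp add: sum_distrib_right)
  also have "\<dots> \<le> 6000 * u ^ M" using u by (intro mult_right_mono sum_abs_binom25_le) auto
  finally show ?thesis using \<open>cut_power u = 0\<close> by simp
qed

section \<open>Poisson's integral for I_13: moments of the weight (1 - t^2)^(25/2)\<close>

definition semi_weight :: "real \<Rightarrow> real" where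
  "semi_weight t = (1 - t\<^sup>2) powr (25 / 2)"

lemma one_minus_square_nonneg: "t \<in> {-1..1} \<Longrightarrow> 0 \<le> 1 - t\<^sup>2" for t :: real
  by (simp add: abs_square_le_1 abs_le_iff)

lemma continuous_semi_weight: "continuous_on {-1..1} semi_weight"
  unfolding semi_weight_def
  by (intro continuous_on_powr' continuous_intros) (use one_minus_square_nonneg in auto)

definition semi_moment :: "nat \<Rightarrow> real" where
  "semi_moment j = integral {-1..1} (\<lambda>t. t ^ j * semi_weight t)"

lemma has_integral_semi_moment: "((\<lambda>t. t ^ j * semi_weight t) has_integral semi_moment j) {-1..1}"
  unfolding semi_moment_def
  by (intro integrable_integral integrable_continuous_real continuous_intros continuous_semi_weight)

lemma semi_moment_odd: "semi_moment (2 * k + 1) = 0"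
proof -
  have "((\<lambda>t. (- t) ^ (2 * k + 1) * semi_weight (- t)) has_integral semi_moment (2 * k + 1)) {- 1..- (-1)}"
    by (subst has_integral_reflect_real) (rule has_integral_semi_moment)
  hence "((\<lambda>t. - (t ^ (2 * k + 1) * semi_weight t)) has_integral semi_moment (2 * k + 1)) {-1..1}"
    by (simp add: semi_weight_def)
  from has_integral_unique[OF this has_integral_neg[OF has_integral_semi_moment]]
  show ?thesis by simp
qed

text \<open>Integrate the derivative of t^(k+1) (1 - t^2)^(27/2), which vanishes at both
  ends.\<close>

lemma semi_moment_rec: "real (k + 28) * semi_moment (k + 2) = real (k + 1) * semi_moment k"
proof -
  let ?F = "\<lambda>t :: real. t ^ (k + 1) * (1 - t\<^sup>2) powr (27 / 2)"
  let ?f = "\<lambda>t. real (k + 1) * (t ^ k * semi_weight t) - real (k + 28) * (t ^ (k + 2) * semi_weight t)"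
  have "(?f has_integral (?F 1 - ?F (-1))) {-1..1}"
  proof (rule fundamental_theorem_of_calculus_interior)
    show "continuous_on {-1..1} ?F"
      by (intro continuous_on_mult continuous_on_powr' continuous_intros) (use one_minus_square_nonneg in auto)
    fix t :: real assume t: "t \<in> {-1<..<1}"
    hence pos: "1 - t\<^sup>2 > 0" by (simp add: abs_square_less_1 abs_less_iff)
    have "((\<lambda>t. t ^ (k + 1)) has_real_derivative real (k + 1) * t ^ k) (at t)"
      by (rule DERIV_cong[OF DERIV_pow]) simp
    moreover have "((\<lambda>t. (1 - t\<^sup>2) powr (27 / 2)) has_real_derivative
        (27 / 2) * (1 - t\<^sup>2) powr (25 / 2) * (- (2 * t))) (at t)"
      using pos by (auto intro!: derivative_eq_intros)
    ultimately have "(?F has_real_derivative real (k + 1) * t ^ k * (1 - t\<^sup>2) powr (27 / 2) +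
        (27 / 2) * (1 - t\<^sup>2) powr (25 / 2) * (- (2 * t)) * t ^ (k + 1)) (at t)"
      by (rule DERIV_mult)
    moreover have Z: "(1 - t\<^sup>2) powr (27 / 2) = (1 - t\<^sup>2) * (1 - t\<^sup>2) powr (25 / 2)"
      using pos powr_add[of "1 - t\<^sup>2" 1 "25 / 2"] by simp
    have "real (k + 1) * t ^ k * (1 - t\<^sup>2) powr (27 / 2) +
        (27 / 2) * (1 - t\<^sup>2) powr (25 / 2) * (- (2 * t)) * t ^ (k + 1) = ?f t"
      unfolding Z semi_weight_def by (simp add: algebra_simps power2_eq_square)
    ultimately have "(?F has_real_derivative ?f t) (at t)" by (simp only:)
    thus "(?F has_vector_derivative ?f t) (at t)"
      by (simp add: has_real_derivative_iff_has_vector_derivative)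
  qed simp
  hence 1: "(?f has_integral 0) {-1..1}" by simp
  have 2: "(?f has_integral (real (k + 1) * semi_moment k - real (k + 28) * semi_moment (k + 2))) {-1..1}"
    by (intro has_integral_diff has_integral_mult_right has_integral_semi_moment)
  from has_integral_unique[OF 1 2] show ?thesis by simp
qed

text \<open>The substitution u = t^2 leads to a Beta integral. The second moment is taken because
  its integrand u^(1/2) (1-u)^(25/2) is continuous, whereas moment 0 would involve u^(-1/2); the
  recurrence then yields moment 0.\<close>

lemma semi_moment_2: "semi_moment 2 = Beta (3 / 2) (27 / 2)"
proof -
  let ?f = "\<lambda>u :: real. u powr (3 / 2 - 1) * (1 - u) powr (27 / 2 - 1)"
  have "((\<lambda>t. (2 * t) *\<^sub>R ?f (t\<^sup>2)) has_integral integral {0\<^sup>2..1\<^sup>2} ?f) {0..1}"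
  proof (rule has_integral_substitution)
    show "continuous_on {0..1} ?f"
      by (intro continuous_on_mult continuous_on_powr' continuous_intros) auto
    show "(\<lambda>t :: real. t\<^sup>2) ` {0..1} \<subseteq> {0..1}" by (auto simp: power_le_one)
  qed (auto intro!: derivative_eq_intros)
  also have "integral {0\<^sup>2..1\<^sup>2} ?f = Beta (3 / 2) (27 / 2)"
    using has_integral_Beta_real[of "3 / 2" "27 / 2"] by (simp add: integral_unique)
  finally have "((\<lambda>t. 2 * (t ^ 2 * semi_weight t)) has_integral Beta (3 / 2) (27 / 2)) {0..1}"
  proof (rule has_integral_eq[rotated])
    fix t :: real assume t: "t \<in> {0..1}"
    have "t\<^sup>2 powr (1 / 2) = t" using t by (simp add: powr_half_sqrt)
    thus "(2 * t) *\<^sub>R ?f (t\<^sup>2) = 2 * (t ^ 2 * semi_weight t)"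
      by (simp add: semi_weight_def power2_eq_square)
  qed
  from has_integral_mult_right[OF this, of "1/2"]
  have h: "((\<lambda>t. t ^ 2 * semi_weight t) has_integral Beta (3 / 2) (27 / 2) / 2) {0..1}" by simp
  hence "((\<lambda>t. (- t) ^ 2 * semi_weight (- t)) has_integral Beta (3 / 2) (27 / 2) / 2) {-1..-0}"
    by (subst has_integral_reflect_real)
  hence "((\<lambda>t. t ^ 2 * semi_weight t) has_integral Beta (3 / 2) (27 / 2) / 2) {-1..0}"
    by (simp add: semi_weight_def)
  from has_integral_combine[OF _ _ this h]
  have "((\<lambda>t. t ^ 2 * semi_weight t) has_integral Beta (3 / 2) (27 / 2)) {-1..1}" by simp
  from has_integral_unique[OF has_integral_semi_moment this] show ?thesis .
qed

lemma semi_moment_0: "semi_moment 0 = sqrt pi * Gamma (27 / 2) / fact 13"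
proof -
  have "semi_moment 0 = 28 * Beta (3 / 2) (27 / 2)"
    using semi_moment_rec[of 0] semi_moment_2 by (simp add: numeral_2_eq_2)
  also have "Beta (3 / 2) (27 / 2) = Gamma (3 / 2) * Gamma (27 / 2) / Gamma (15 :: real)"
    by (simp add: Beta_def)
  also have "Gamma (3 / 2 :: real) = sqrt pi / 2"
  proof -
    have "(1 / 2 :: real) \<notin> \<int>\<^sub>\<le>\<^sub>0" using nonpos_Ints_nonpos by force
    thus ?thesis using Gamma_plus1[of "1 / 2 :: real"] Gamma_one_half_real by simp
  qed
  also have "Gamma (15 :: real) = 14 * fact 13"
    using Gamma_fact[of 14, where 'a = real] by (simp add: fact_numeral)
  finally show ?thesis by simp
qed

lemma semi_moment_even: "semi_moment (2 * k) = semi_moment 0 * fact 13 * fact (2 * k) / (4 ^ k * fact k * fact (k + 13))"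
proof (induction k)
  case (Suc k)
  have "semi_moment (2 * Suc k) = real (2 * k + 1) * semi_moment (2 * k) / real (2 * k + 28)"
    using semi_moment_rec[of "2 * k"] by (simp add: field_simps)
  also have "\<dots> = real (2 * k + 1) * (semi_moment 0 * fact 13 * fact (2 * k) / (4 ^ k * fact k * fact (k + 13))) / real (2 * k + 28)"
    by (simp only: Suc.IH)
  also have "\<dots> = semi_moment 0 * fact 13 * (real (2 * k + 2) * (real (2 * k + 1) * fact (2 * k))) /
      (4 ^ Suc k * (real (Suc k) * fact k) * (real (k + 14) * fact (k + 13)))"
    by (simp add: divide_simps) (simp add: algebra_simps)
  also have "real (2 * k + 2) * (real (2 * k + 1) * fact (2 * k)) = fact (2 * Suc k)" by simp
  also have "real (Suc k) * fact k = fact (Suc k)" by simp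
  also have "real (k + 14) * fact (k + 13) = fact (Suc k + 13)" using fact_Suc[of "k + 13", where 'a = real] by simp
  finally show ?case .
qed simp

text \<open>Integrate the exponential series termwise. Odd moments vanish, and the even ones turn
  the coefficients into those of \<open>bessel_sum\<close>.\<close>

lemma semi_exp_integral:
  "((\<lambda>t. semi_weight t * exp (- x * t)) has_integral sqrt pi * Gamma (27 / 2) * bessel_sum ((x / 2)\<^sup>2)) {-1..1}"
proof -
  let ?b = "\<lambda>k. ((x / 2)\<^sup>2) ^ k / (fact k * fact (k + 13))"
  let ?f = "\<lambda>K t. \<Sum>j<K. (- x) ^ j / fact j * (t ^ j * semi_weight t)"
  obtain B where "\<forall>y\<in>semi_weight ` {-1..1}. norm y \<le> B"
    using compact_imp_bounded[OF compact_continuous_image[OF continuous_semi_weight compact_Icc]]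
    unfolding bounded_iff by blast
  hence B: "\<bar>semi_weight t\<bar> \<le> B" if "t \<in> {-1..1}" for t
    using that by simp
  have lim: "uniform_limit {-1..1} ?f (\<lambda>t. \<Sum>j. (- x) ^ j / fact j * (t ^ j * semi_weight t)) sequentially"
  proof (rule Weierstrass_m_test)
    fix j t assume t: "t \<in> {-1..1 :: real}"
    have "\<bar>t ^ j\<bar> \<le> 1" using t by (auto simp: power_abs abs_le_iff intro!: power_le_one)
    hence "\<bar>t ^ j\<bar> * \<bar>semi_weight t\<bar> \<le> 1 * B" using B[OF t] by (intro mult_mono) auto
    hence "\<bar>x\<bar> ^ j / fact j * (\<bar>t ^ j\<bar> * \<bar>semi_weight t\<bar>) \<le> \<bar>x\<bar> ^ j / fact j * (1 * B)" by (intro mult_left_mono) auto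
    thus "norm ((- x) ^ j / fact j * (t ^ j * semi_weight t)) \<le> \<bar>x\<bar> ^ j /\<^sub>R fact j * B"
      by (simp add: abs_mult power_abs divide_inverse mult_ac)
  qed (intro summable_mult2 summable_exp_generic)
  have "(\<lambda>j. (- x) ^ j / fact j * (t ^ j * semi_weight t)) sums (semi_weight t * exp (- x * t))" for t
  proof -
    have "(\<lambda>j. semi_weight t * ((- x * t) ^ j /\<^sub>R fact j)) sums (semi_weight t * exp (- x * t))"
      by (intro sums_mult exp_converges)
    thus ?thesis unfolding power_mult_distrib by (simp add: divide_inverse mult_ac)
  qed
  hence "(\<lambda>t. \<Sum>j. (- x) ^ j / fact j * (t ^ j * semi_weight t)) = (\<lambda>t. semi_weight t * exp (- x * t))"
    by (simp add: sums_iff fun_eq_iff)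
  with lim have lim: "uniform_limit {-1..1} ?f (\<lambda>t. semi_weight t * exp (- x * t)) sequentially" by simp
  have cont: "continuous_on {-1..1} (?f K)" for K
    by (intro continuous_intros continuous_semi_weight)
  obtain I J where IJ: "\<And>K. (?f K has_integral I K) {-1..1}"
      "((\<lambda>t. semi_weight t * exp (- x * t)) has_integral J) {-1..1}" "I \<longlonglongrightarrow> J"
    using uniform_limit_integral[OF lim cont trivial_limit_sequentially] by blast
  have "(?f K has_integral (\<Sum>j<K. (- x) ^ j / fact j * semi_moment j)) {-1..1}" for K
    by (intro has_integral_sum has_integral_mult_right has_integral_semi_moment) auto
  with IJ(1) have "I = (\<lambda>K. \<Sum>j<K. (- x) ^ j / fact j * semi_moment j)"
    using has_integral_unique by blast
  with IJ(3) have s: "(\<lambda>j. (- x) ^ j / fact j * semi_moment j) sums J" by (simp add: sums_def)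
  define f where "f = (\<lambda>j. (- x) ^ j / fact j * semi_moment j)"
  have "(\<lambda>k. f (2 * k)) sums J \<longleftrightarrow> f sums J"
  proof (rule sums_mono_reindex)
    show "f j = 0" if j: "j \<notin> range (\<lambda>k :: nat. 2 * k)" for j
    proof -
      have "odd j" using j by (auto simp: dvd_def)
      then obtain k where "j = 2 * k + 1" by (elim oddE)
      thus ?thesis unfolding f_def by (simp only: semi_moment_odd mult_zero_right)
    qed
  qed (simp add: strict_mono_def)
  with s have "(\<lambda>k. (- x) ^ (2 * k) / fact (2 * k) * semi_moment (2 * k)) sums J"
    unfolding f_def by blast
  moreover have "(- x) ^ (2 * k) / fact (2 * k) * semi_moment (2 * k) =
      semi_moment 0 * fact 13 * (?b k)" for k
  proof -
    have "(- x)\<^sup>2 = 4 * (x / 2)\<^sup>2" by (simp add: power2_eq_square)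
    hence "(- x) ^ (2 * k) = 4 ^ k * ((x / 2)\<^sup>2) ^ k"
      by (simp only: power_mult power_mult_distrib)
    thus ?thesis unfolding semi_moment_even[of k] by (simp add: divide_simps)
  qed
  moreover have c: "semi_moment 0 * fact 13 = sqrt pi * Gamma (27 / 2)" by (simp add: semi_moment_0)
  ultimately have "(\<lambda>k. sqrt pi * Gamma (27 / 2) * (?b k)) sums J" by simp
  note 1 = sums_divide[OF this, of "sqrt pi * Gamma (27 / 2)"]
  have c0: "sqrt pi * Gamma (27 / 2 :: real) \<noteq> 0"
    by (rule less_imp_neq[THEN not_sym]) (simp add: Gamma_real_pos)
  have "(\<lambda>k. ?b k) sums (J / (sqrt pi * Gamma (27 / 2)))"
    using 1 unfolding nonzero_mult_div_cancel_left[OF c0] .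
  hence "bessel_sum ((x / 2)\<^sup>2) = J / (sqrt pi * Gamma (27 / 2))"
    unfolding bessel_sum_def by (rule sums_unique[symmetric])
  with c0 have "sqrt pi * Gamma (27 / 2) * bessel_sum ((x / 2)\<^sup>2) = J" by simp
  with IJ(2) show ?thesis by simp
qed

lemma has_integral_Gamma_power:
  fixes x :: real
  shows "((\<lambda>u. u powr (25 / 2) / exp u * (u / (2 * x)) ^ k) has_integral Gamma (27 / 2) * pochhammer (27 / 2) k / (2 * x) ^ k) {0..}"
proof -
  have "((\<lambda>u. u powr ((27 / 2 + real k) - 1) / exp u) has_integral Gamma (27 / 2 + real k)) {0..}"
    by (rule Gamma_integral_real) simp
  from has_integral_mult_right[OF this, of "1 / (2 * x) ^ k"]
  have "((\<lambda>u. 1 / (2 * x) ^ k * (u powr ((27 / 2 + real k) - 1) / exp u)) has_integral 1 / (2 * x) ^ k * Gamma (27 / 2 + real k)) {0..}" .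
  note 1 = this
  have G: "Gamma (27 / 2 + real k) = Gamma (27 / 2) * pochhammer (27 / 2) k"
  proof -
    have "(27 / 2 :: real) \<notin> \<int>\<^sub>\<le>\<^sub>0" using nonpos_Ints_nonpos by force
    moreover have "Gamma (27 / 2 :: real) \<noteq> 0"
      by (rule less_imp_neq[THEN not_sym]) (simp add: Gamma_real_pos)
    ultimately show ?thesis using pochhammer_Gamma[of "27 / 2 :: real" k] by simp
  qed
  have 2: "1 / (2 * x) ^ k * (u powr ((27 / 2 + real k) - 1) / exp u) = u powr (25 / 2) / exp u * (u / (2 * x)) ^ k"
    if "u \<in> {0..}" for u
  proof -
    have "u powr ((27 / 2 + real k) - 1) = u powr (25 / 2) * u ^ k"
    proof (cases "u = 0")
      case False
      hence "u powr (25 / 2 + real k) = u powr (25 / 2) * u ^ k"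
        using that by (simp add: powr_add powr_realpow)
      thus ?thesis by (simp add: algebra_simps)
    qed simp
    thus ?thesis by (simp add: power_divide)
  qed
  from has_integral_eq[OF 2 1] show ?thesis by (simp add: G)
qed

text \<open>Substitute t = u/x - 1, which moves the end t = -1, where the exponential is largest, to
  u = 0. Then 1 - t^2 = (2u/x) (1 - u/(2x)), and \<open>cut_power\<close> extends the interval
  {0..2x} to the half line.\<close>

lemma semi_exp_integral_scaled:
  assumes x: "x > 0"
  shows "((\<lambda>u. u powr (25 / 2) / exp u * cut_power (u / (2 * x))) has_integral
     x * (x / 2) powr (25 / 2) * exp (- x) * (sqrt pi * Gamma (27 / 2) * bessel_sum ((x / 2)\<^sup>2))) {0..}"
proof -
  let ?I = "sqrt pi * Gamma (27 / 2) * bessel_sum ((x / 2)\<^sup>2)"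
  have "((\<lambda>t. semi_weight t * exp (- x * t)) has_integral ?I) (cbox (-1) 1)"
    using semi_exp_integral[of x] by simp
  from has_integral_affinity'[OF this, of "1 / x" "-1"]
  have aff: "((\<lambda>u. semi_weight ((1 / x) *\<^sub>R u + - 1) * exp (- x * ((1 / x) *\<^sub>R u + - 1))) has_integral
      ?I /\<^sub>R (1 / x) ^ DIM(real)) (cbox ((- 1 - - 1) /\<^sub>R (1 / x)) ((1 - - 1) /\<^sub>R (1 / x)))"
    using x by simp
  have e1: "(1 / x) *\<^sub>R u + - 1 = u / x - 1" for u by simp
  have e2: "cbox ((- 1 - - 1) /\<^sub>R (1 / x)) ((1 - - 1) /\<^sub>R (1 / x)) = {0..2 * x}" by simp
  have e3: "?I /\<^sub>R (1 / x) ^ DIM(real) = x * ?I" by simp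
  from has_integral_mult_right[OF aff[unfolded e1 e2 e3], of "(x / 2) powr (25 / 2) * exp (- x)"]
  have "((\<lambda>u. (x / 2) powr (25 / 2) * exp (- x) * (semi_weight (u / x - 1) * exp (- x * (u / x - 1)))) has_integral
      x * (x / 2) powr (25 / 2) * exp (- x) * ?I) {0..2 * x}" by (simp only: mult_ac)
  note 1 = this
  have 2: "(x / 2) powr (25 / 2) * exp (- x) * (semi_weight (u / x - 1) * exp (- x * (u / x - 1))) =
      u powr (25 / 2) / exp u * cut_power (u / (2 * x))" if "u \<in> {0..2 * x}" for u
  proof -
    have u: "0 \<le> u" "u / (2 * x) \<le> 1" using that x by auto
    have e: "exp (- x) * exp (- x * (u / x - 1)) = 1 / exp u"
    proof -
      have "- x + - x * (u / x - 1) = - u" using x by (simp add: field_simps)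
      hence "exp (- x) * exp (- x * (u / x - 1)) = exp (- u)" by (simp only: exp_add[symmetric])
      thus ?thesis by (simp only: exp_minus[of u] inverse_eq_divide)
    qed
    have "1 - (u / x - 1)\<^sup>2 = u * (1 - u / (2 * x)) / (x / 2)"
      using x by (simp add: field_simps power2_eq_square)
    hence "semi_weight (u / x - 1) = (u * (1 - u / (2 * x)) / (x / 2)) powr (25 / 2)" by (simp add: semi_weight_def)
    also have "\<dots> = u powr (25 / 2) * (1 - u / (2 * x)) powr (25 / 2) / (x / 2) powr (25 / 2)"
      using u x by (simp add: powr_mult powr_divide)
    finally have "(x / 2) powr (25 / 2) * semi_weight (u / x - 1) = u powr (25 / 2) * cut_power (u / (2 * x))"
      using u x by (simp add: cut_power_def)
    note w = this
    have "(x / 2) powr (25 / 2) * exp (- x) * (semi_weight (u / x - 1) * exp (- x * (u / x - 1))) =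
        ((x / 2) powr (25 / 2) * semi_weight (u / x - 1)) * (exp (- x) * exp (- x * (u / x - 1)))"
      by (simp only: mult_ac)
    also have "\<dots> = u powr (25 / 2) / exp u * cut_power (u / (2 * x))"
      unfolding w e by simp
    finally show ?thesis .
  qed
  have "((\<lambda>u. u powr (25 / 2) / exp u * cut_power (u / (2 * x))) has_integral
      x * (x / 2) powr (25 / 2) * exp (- x) * ?I) {0..2 * x}"
    by (rule has_integral_eq[OF 2 1])
  hence "((\<lambda>u. if u \<in> {0..2 * x} then u powr (25 / 2) / exp u * cut_power (u / (2 * x)) else 0) has_integral
      x * (x / 2) powr (25 / 2) * exp (- x) * ?I) {0..}"
    by (subst has_integral_restrict) auto
  thus ?thesis
  proof (rule has_integral_eq[rotated])
    fix u :: real assume "u \<in> {0..}"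
    show "(if u \<in> {0..2 * x} then u powr (25 / 2) / exp u * cut_power (u / (2 * x)) else 0) =
        u powr (25 / 2) / exp u * cut_power (u / (2 * x))"
      using \<open>u \<in> {0..}\<close> x by (auto simp: cut_power_def field_simps)
  qed
qed

lemma a13_eq: "a13 k = binom25 k * pochhammer (27 / 2) k / 2 ^ k"
  by (simp add: a13_def binom25_def)

text \<open>Watson's lemma with an explicit remainder: the bound for \<open>cut_power\<close> is
  integrated against u^(25/2) exp(-u), so the error is at most 6000 times the Gamma moment of order
  \<open>M\<close>.\<close>

lemma bessel_sum_expansion:
  assumes x: "x > 0"
  shows "\<exists>\<rho>. \<bar>\<rho>\<bar> \<le> 6000 * pochhammer (27 / 2) M / (2 * x) ^ M \<and>
    sqrt pi * x * (x / 2) powr (25 / 2) * exp (- x) * bessel_sum ((x / 2)\<^sup>2) = (\<Sum>k<M. (-1) ^ k * a13 k / x ^ k) + \<rho>"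
proof -
  let ?g = "\<lambda>u. u powr (25 / 2) / exp u"
  let ?h = "\<lambda>u. ?g u * cut_power (u / (2 * x)) - (\<Sum>k<M. (-1) ^ k * binom25 k * (?g u * (u / (2 * x)) ^ k))"
  define J where "J = x * (x / 2) powr (25 / 2) * exp (- x) * (sqrt pi * Gamma (27 / 2) * bessel_sum ((x / 2)\<^sup>2))"
  define P where "P = (\<lambda>k. Gamma (27 / 2) * pochhammer (27 / 2) k / (2 * x) ^ k)"
  have P: "((\<lambda>u. ?g u * (u / (2 * x)) ^ k) has_integral P k) {0..}" for k
    unfolding P_def by (rule has_integral_Gamma_power)
  have "(?h has_integral
      J - (\<Sum>k<M. (-1) ^ k * binom25 k * P k)) {0..}"
    unfolding J_def by (intro has_integral_diff has_integral_sum has_integral_mult_right P semi_exp_integral_scaled x) auto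
  moreover have "((\<lambda>u. 6000 * (?g u * (u / (2 * x)) ^ M)) has_integral 6000 * P M) {0..}"
    by (intro has_integral_mult_right P)
  moreover have "norm (?h u)
      \<le> 6000 * (?g u * (u / (2 * x)) ^ M)" if "u \<in> {0..}" for u
  proof -
    have "?h u =
        ?g u * (cut_power (u / (2 * x)) - (\<Sum>k<M. (-1) ^ k * binom25 k * (u / (2 * x)) ^ k))"
      by (simp add: right_diff_distrib sum_distrib_left mult_ac)
    also have "norm \<dots> = ?g u * \<bar>cut_power (u / (2 * x)) - (\<Sum>k<M. (-1) ^ k * binom25 k * (u / (2 * x)) ^ k)\<bar>"
      by (simp add: abs_mult)
    also have "\<dots> \<le> ?g u * (6000 * (u / (2 * x)) ^ M)"
      by (intro mult_left_mono cut_power_remainder) (use that x in auto)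
    finally show ?thesis by (simp only: mult.left_commute)
  qed
  ultimately have D: "\<bar>J - (\<Sum>k<M. (-1) ^ k * binom25 k * P k)\<bar> \<le> 6000 * P M"
    using integral_norm_bound_integral[of ?h "{0..}"
        "\<lambda>u. 6000 * (?g u * (u / (2 * x)) ^ M)"]
    by (simp add: integral_unique has_integral_integrable)
  define G where "G = Gamma (27 / 2 :: real)"
  have G: "G > 0" by (simp add: G_def Gamma_real_pos)
  define L where "L = sqrt pi * x * (x / 2) powr (25 / 2) * exp (- x) * bessel_sum ((x / 2)\<^sup>2)"
  have J: "J = G * L" by (simp add: J_def L_def G_def)
  have s: "(\<Sum>k<M. (-1) ^ k * binom25 k * P k) = G * (\<Sum>k<M. (-1) ^ k * a13 k / x ^ k)"
    unfolding sum_distrib_left by (intro sum.cong refl) (simp add: P_def G_def a13_eq power_mult_distrib)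
  have "G * \<bar>L - (\<Sum>k<M. (-1) ^ k * a13 k / x ^ k)\<bar> = \<bar>G * (L - (\<Sum>k<M. (-1) ^ k * a13 k / x ^ k))\<bar>"
    using G by (simp add: abs_mult)
  also have "\<dots> \<le> 6000 * P M" using D unfolding J s by (simp only: right_diff_distrib)
  also have "\<dots> = G * (6000 * pochhammer (27 / 2) M / (2 * x) ^ M)" by (simp add: P_def G_def)
  finally have "\<bar>L - (\<Sum>k<M. (-1) ^ k * a13 k / x ^ k)\<bar> \<le> 6000 * pochhammer (27 / 2) M / (2 * x) ^ M"
    using G by (simp only: mult_le_cancel_left_pos)
  thus ?thesis unfolding L_def[symmetric]
    by (intro exI[of _ "L - (\<Sum>k<M. (-1) ^ k * a13 k / x ^ k)"]) simp
qed

lemma main_term_expansion: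
  assumes \<nu>: "\<nu> > 0"
  defines "x \<equiv> 4 * pi * sqrt \<nu>"
  shows "\<exists>\<rho>. \<bar>\<rho>\<bar> \<le> 6000 * pochhammer (27 / 2) M / (2 * x) ^ M \<and>
    bessel_main \<nu> = exp x / (sqrt 2 * \<nu> powr (27 / 4)) * ((\<Sum>k<M. (-1) ^ k * a13 k / x ^ k) + \<rho>)"
proof -
  have x: "x > 0" using \<nu> by (simp add: x_def)
  have x2: "(x / 2)\<^sup>2 = 4 * pi\<^sup>2 * \<nu>" using \<nu> by (simp add: x_def power_mult_distrib)
  obtain \<rho> where \<rho>: "\<bar>\<rho>\<bar> \<le> 6000 * pochhammer (27 / 2) M / (2 * x) ^ M"
    and eq: "sqrt pi * x * (x / 2) powr (25 / 2) * exp (- x) * bessel_sum ((x / 2)\<^sup>2) = (\<Sum>k<M. (-1) ^ k * a13 k / x ^ k) + \<rho>"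
    using bessel_sum_expansion[OF x, of M] by blast
  \<comment> \<open>With x/2 = 2 pi sqrt \<nu>, the power \<nu>^(27/4) cancels, and 2 sqrt pi / sqrt
    2 = (2 pi)^(1/2) completes (2 pi)^(27/2) to (2 pi)^14.\<close>
  have c: "exp x / (sqrt 2 * \<nu> powr (27 / 4)) * (sqrt pi * x * (x / 2) powr (25 / 2) * exp (- x)) = (2 * pi) ^ 14"
  proof -
    define y where "y = x / 2"
    have y: "y > 0" "x = 2 * y" using x by (auto simp: y_def)
    have y': "y = 2 * pi * sqrt \<nu>" by (simp add: y_def x_def)
    have "x * (x / 2) powr (25 / 2) = 2 * y powr (27 / 2)"
      using y powr_add[of y 1 "25 / 2"] by simp
    also have "y powr (27 / 2) = (2 * pi) powr (27 / 2) * \<nu> powr (27 / 4)"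
      using \<nu> unfolding y' by (simp add: powr_mult powr_powr flip: powr_half_sqrt)
    finally have a: "x * (x / 2) powr (25 / 2) = 2 * ((2 * pi) powr (27 / 2) * \<nu> powr (27 / 4))" .
    have "2 * sqrt pi / sqrt 2 = (2 * pi) powr (1 / 2)"
    proof -
      have "2 / sqrt 2 = sqrt 2" by (simp add: real_div_sqrt)
      thus ?thesis by (simp add: powr_half_sqrt real_sqrt_mult) (metis times_divide_eq_left)
    qed
    hence "2 * sqrt pi / sqrt 2 * (2 * pi) powr (27 / 2) = (2 * pi) powr 14"
      by (simp flip: powr_add)
    also have "\<dots> = (2 * pi) ^ 14" using powr_realpow[of "2 * pi" 14] by simp
    finally have b: "2 * sqrt pi / sqrt 2 * (2 * pi) powr (27 / 2) = (2 * pi) ^ 14" .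
    have "exp x / (sqrt 2 * \<nu> powr (27 / 4)) * (sqrt pi * x * (x / 2) powr (25 / 2) * exp (- x)) =
        sqrt pi * (x * (x / 2) powr (25 / 2)) / (sqrt 2 * \<nu> powr (27 / 4)) * (exp x * exp (- x))"
      by simp
    also have "\<dots> = 2 * sqrt pi / sqrt 2 * (2 * pi) powr (27 / 2)"
      unfolding a using \<nu> by (simp add: exp_minus)
    finally show ?thesis using b by simp
  qed
  have "bessel_main \<nu> =
      exp x / (sqrt 2 * \<nu> powr (27 / 4)) * (sqrt pi * x * (x / 2) powr (25 / 2) * exp (- x) * bessel_sum ((x / 2)\<^sup>2))"
    unfolding c[symmetric] x2 by (simp only: mult.assoc)
  also have "\<dots> = exp x / (sqrt 2 * \<nu> powr (27 / 4)) * ((\<Sum>k<M. (-1) ^ k * a13 k / x ^ k) + \<rho>)"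
    by (simp only: eq)
  finally show ?thesis using \<rho> by blast
qed

section \<open>Taylor coefficients of the main term\<close>

lemma of_real_gbinomial: "of_real (a gchoose k) = (of_real a :: complex) gchoose k"
  by (simp add: gbinomial_prod_rev)

definition binomial_sq_fps :: "real \<Rightarrow> complex fps" where
  "binomial_sq_fps c = fps_compose (fps_binomial (of_real c)) (- (fps_X ^ 2))"

lemma nth_binomial_sq_fps:
  "fps_nth (binomial_sq_fps c) n = (if even n then of_real ((-1) ^ (n div 2) * (c gchoose (n div 2))) else 0)"
proof -
  have pw: "fps_nth ((- (fps_X ^ 2)) ^ i) n = (if n = 2 * i then (-1) ^ i else 0 :: complex)" for i
  proof -
    have "(- (fps_X ^ 2)) ^ i = (- 1) ^ i * (fps_X :: complex fps) ^ (2 * i)"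
      by (simp only: power_minus[of "fps_X ^ 2"] power_mult)
    also have "fps_nth \<dots> n = (if n = 2 * i then (-1) ^ i else 0)"
    proof (cases "even i")
      case True
      thus ?thesis by (simp only: neg_one_even_power mult_1 fps_X_power_nth)
    next
      case False
      show ?thesis
        unfolding neg_one_odd_power[OF False] mult_minus_left mult_1 fps_neg_nth fps_X_power_nth by simp
    qed
    finally show ?thesis .
  qed
  have "fps_nth (binomial_sq_fps c) n = (\<Sum>i=0..n. (of_real c gchoose i) * (if n = 2 * i then (-1) ^ i else 0))"
    unfolding binomial_sq_fps_def fps_compose_nth pw by simp
  also have "\<dots> = (\<Sum>i=0..n. if even n \<and> i = n div 2 then (of_real c gchoose i) * (-1) ^ i else 0)"
    by (intro sum.cong refl) auto
  also have "\<dots> = (if even n then (of_real c gchoose (n div 2)) * (-1) ^ (n div 2) else 0)"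
    by (cases "even n") simp_all
  finally show ?thesis by (simp add: of_real_gbinomial mult.commute)
qed

lemma has_fps_expansion_binomial_sq:
  "(\<lambda>z :: complex. (1 - z\<^sup>2) powr of_real c) has_fps_expansion binomial_sq_fps c"
proof -
  have "(\<lambda>z :: complex. - (z ^ 2)) has_fps_expansion - (fps_X ^ 2)"
    by (intro fps_expansion_intros)
  from has_fps_expansion_compose[OF has_fps_expansion_binomial_complex[of "of_real c"] this]
  show ?thesis by (simp add: o_def binomial_sq_fps_def)
qed

text \<open>For z = sin(theta) this is tan(theta/2), and at z = 1/sqrt n it is sqrt n - sqrt(n-1).
  With the root in the denominator, no singularity at 0 has to be removed.\<close>

definition half_tan :: "complex \<Rightarrow> complex" where
  "half_tan z = z / (1 + csqrt (1 - z\<^sup>2))"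

lemma one_plus_csqrt_nonzero: "1 + csqrt x \<noteq> 0"
proof
  assume "1 + csqrt x = 0"
  hence "Re (1 + csqrt x) = 0" by (simp only: zero_complex.sel)
  thus False using Re_csqrt[of x] by (simp del: csqrt.simps)
qed

lemma norm_one_plus_csqrt: "norm (1 + csqrt x) \<ge> 1"
  using abs_Re_le_cmod[of "1 + csqrt x"] Re_csqrt[of x] by (simp del: csqrt.simps)

lemma one_minus_sq_not_nonpos: "norm z < 1 \<Longrightarrow> 1 - z\<^sup>2 \<notin> \<real>\<^sub>\<le>\<^sub>0" for z :: complex
proof
  assume z: "norm z < 1" and "1 - z\<^sup>2 \<in> \<real>\<^sub>\<le>\<^sub>0"
  from this(2) have "Re (z\<^sup>2) \<ge> 1" by (simp add: complex_nonpos_Reals_iff)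
  moreover have "Re (z\<^sup>2) \<le> norm z ^ 2" using complex_Re_le_cmod[of "z\<^sup>2"] by (simp add: norm_power)
  moreover have "norm z ^ 2 < 1" using z by (simp add: abs_square_less_1)
  ultimately show False by simp
qed

lemma holomorphic_half_tan: "half_tan holomorphic_on ball 0 1"
  unfolding half_tan_def
  by (intro holomorphic_intros) (use one_minus_sq_not_nonpos one_plus_csqrt_nonzero in auto)

lemma half_tan_eq: "2 * half_tan z = z * (1 + half_tan z ^ 2)"
proof -
  define c where "c = csqrt (1 - z\<^sup>2)"
  have c: "1 + c \<noteq> 0" unfolding c_def by (rule one_plus_csqrt_nonzero)
  have "c\<^sup>2 = 1 - z\<^sup>2" by (simp add: c_def)
  hence "(1 + c)\<^sup>2 + z\<^sup>2 = 2 * (1 + c)" by (simp add: power2_eq_square algebra_simps)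
  moreover have "z * (1 + half_tan z ^ 2) = z * ((1 + c)\<^sup>2 + z\<^sup>2) / (1 + c)\<^sup>2"
    using c by (simp add: half_tan_def c_def[symmetric] field_simps)
  ultimately have "z * (1 + half_tan z ^ 2) = z * (2 * (1 + c)) / (1 + c)\<^sup>2" by simp
  also have "\<dots> = 2 * (z / (1 + c))"
  proof -
    have "z * (2 * d) / d\<^sup>2 = 2 * (z / d)" if "d \<noteq> 0" for d using that by (simp add: power2_eq_square)
    thus ?thesis using c .
  qed
  also have "\<dots> = 2 * half_tan z" by (simp only: half_tan_def c_def)
  finally show ?thesis by simp
qed

definition half_tan_fps :: "complex fps" where
  "half_tan_fps = fps_expansion half_tan 0"

lemma has_fps_expansion_half_tan: "half_tan has_fps_expansion half_tan_fps"
  unfolding half_tan_fps_def by (rule has_fps_expansion_fps_expansion[OF _ _ holomorphic_half_tan]) auto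

lemma half_tan_fps_0: "fps_nth half_tan_fps 0 = 0"
  using has_fps_expansion_imp_0_eq_fps_nth_0[OF has_fps_expansion_half_tan] by (simp add: half_tan_def)

lemma half_tan_fps_eq: "2 * half_tan_fps = fps_X * (1 + half_tan_fps ^ 2)"
proof (rule fps_expansion_unique_complex)
  show "(\<lambda>z. 2 * half_tan z) has_fps_expansion 2 * half_tan_fps"
    by (intro fps_expansion_intros has_fps_expansion_half_tan)
  show "(\<lambda>z. 2 * half_tan z) has_fps_expansion fps_X * (1 + half_tan_fps ^ 2)"
    unfolding half_tan_eq by (intro fps_expansion_intros has_fps_expansion_half_tan)
qed

text \<open>Multiply the equation 2 w = z (1 + w^2) by w^j and compare coefficients.\<close>

lemma half_tan_power_rec:
  "2 * fps_nth (half_tan_fps ^ Suc j) (Suc n) = fps_nth (half_tan_fps ^ j) n + fps_nth (half_tan_fps ^ (j + 2)) n"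
proof -
  have "2 * half_tan_fps ^ Suc j = (2 * half_tan_fps) * half_tan_fps ^ j" by (simp add: mult_ac)
  also have "\<dots> = fps_X * (half_tan_fps ^ j + half_tan_fps ^ (j + 2))"
    unfolding half_tan_fps_eq by (simp add: power_add algebra_simps power2_eq_square)
  finally have "fps_nth (fps_const 2 * half_tan_fps ^ Suc j) (Suc n) = fps_nth (fps_X * (half_tan_fps ^ j + half_tan_fps ^ (j + 2))) (Suc n)"
    by (simp only: numeral_fps_const)
  thus ?thesis by (simp only: fps_mult_left_const_nth fps_X_mult_nth) simp
qed

lemma half_tan_power_low: "n < j \<Longrightarrow> fps_nth (half_tan_fps ^ j) n = 0"
  using startsby_zero_power_prefix[OF half_tan_fps_0] by blast

lemma half_tan_power_odd: "odd (n + j) \<Longrightarrow> fps_nth (half_tan_fps ^ j) n = 0"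
proof (induction n arbitrary: j)
  case 0
  hence "0 < j" by (cases j) auto
  thus ?case by (rule half_tan_power_low)
next
  case (Suc n)
  show ?case
  proof (cases j)
    case 0
    thus ?thesis by simp
  next
    case (Suc i)
    have "fps_nth (half_tan_fps ^ i) n = 0" "fps_nth (half_tan_fps ^ (i + 2)) n = 0"
      using Suc.IH[of i] Suc.IH[of "i + 2"] Suc.prems \<open>j = Suc i\<close> by auto
    thus ?thesis using half_tan_power_rec[of i n] \<open>j = Suc i\<close> by simp
  qed
qed

text \<open>The ballot numbers, as in Lagrange inversion of \<open>2 w = z (1 + w\<^sup>2)\<close>.\<close>

lemma half_tan_power_nth:
  "n = j + 2 * i \<Longrightarrow> j \<ge> 1 \<Longrightarrow>
     fps_nth (half_tan_fps ^ j) n = of_nat j * fact (n - 1) / (2 ^ n * fact i * fact (i + j))"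
proof (induction n arbitrary: j i)
  case (Suc n)
  then obtain j' where j: "j = Suc j'" by (cases j) auto
  have n: "n = j' + 2 * i" using Suc.prems j by simp
  have rec: "fps_nth (half_tan_fps ^ j) (Suc n) = (fps_nth (half_tan_fps ^ j') n + fps_nth (half_tan_fps ^ (j' + 2)) n) / 2"
  proof -
    have "x = y / 2" if "2 * x = y" for x y :: complex using that by (simp add: field_simps)
    from this[OF half_tan_power_rec[of j' n]] show ?thesis by (simp only: j)
  qed
  show ?case
  proof (cases "n = 0")
    case True
    hence "j' = 0" "i = 0" using n by auto
    thus ?thesis using rec True j half_tan_power_low[of 0 "Suc (Suc 0)"] by simp
  next
    case False
    then obtain n' where n': "n = Suc n'" by (cases n) auto
    \<comment> \<open>The induction hypothesis needs a positive exponent. For \<open>j' = 0\<close>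
      the power is 1, its coefficient at n > 0 vanishes, and so does the factor
      \<open>of_nat j'\<close>.\<close>
    have 1: "fps_nth (half_tan_fps ^ j') n = of_nat j' * fact n' / (2 ^ n * fact i * fact (i + j'))"
    proof (cases "j' = 0")
      case True
      thus ?thesis using False by simp
    next
      case False
      hence "1 \<le> j'" by simp
      from Suc.IH[OF n this] show ?thesis by (simp only: n' diff_Suc_1)
    qed
    \<comment> \<open>The factor \<open>of_nat i\<close> covers \<open>i = 0\<close>, where this
      power starts beyond degree \<open>n\<close>.\<close>
    have 2: "fps_nth (half_tan_fps ^ (j' + 2)) n = of_nat (j' + 2) * fact n' * of_nat i / (2 ^ n * fact i * fact (Suc (i + j')))"
    proof (cases i)
      case 0
      thus ?thesis using half_tan_power_low[of n "j' + 2"] n by simp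
    next
      case (Suc i')
      have IH: "fps_nth (half_tan_fps ^ (j' + 2)) n = of_nat (j' + 2) * fact (n - 1) / (2 ^ n * fact i' * fact (i' + (j' + 2)))"
        by (rule Suc.IH) (use n Suc in auto)
      have e: "i' + (j' + 2) = Suc (i + j')" "n - 1 = n'" using Suc n' by simp_all
      have fi: "(fact i :: complex) = of_nat i * fact i'" and nz: "(of_nat i :: complex) \<noteq> 0"
        using Suc by (simp_all del: of_nat_Suc)
      have aux: "a / (P * g * H) = a * I / (P * (I * g) * H)" if "I \<noteq> 0" for a P g H I :: complex
        using that by simp
      show ?thesis unfolding IH e fi by (rule aux[OF nz])
    qed
    have num: "of_nat j' * of_nat (Suc (i + j')) + of_nat (j' + 2) * of_nat i = (of_nat j * of_nat n :: complex)"
      unfolding n j by (simp add: algebra_simps)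
    have "fps_nth (half_tan_fps ^ j) (Suc n) =
        (of_nat j' * of_nat (Suc (i + j')) + of_nat (j' + 2) * of_nat i) * fact n' / (2 * 2 ^ n * fact i * fact (Suc (i + j')))"
    proof -
      have aux: "(a * F / (P * f * h) + b * F * c / (P * f * (m * h))) / 2 = (a * m + b * c) * F / (2 * P * f * (m * h))"
        if "m \<noteq> 0" for a b c f h m F P :: complex
        by (cases "P = 0 \<or> f = 0 \<or> h = 0") (use that in \<open>auto simp: field_simps\<close>)
      have "(fact (Suc (i + j')) :: complex) = of_nat (Suc (i + j')) * fact (i + j')" by (rule fact_Suc)
      thus ?thesis unfolding rec 1 2 by (simp only: aux[OF of_nat_neq_0])
    qed
    also have "\<dots> = of_nat j * (of_nat n * fact n') / (2 * 2 ^ n * fact i * fact (Suc (i + j')))"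
      unfolding num by (simp only: mult.assoc)
    also have "of_nat n * fact n' = (fact n :: complex)" by (simp add: n')
    finally show ?thesis using j by (simp add: add_ac)
  qed
qed simp

text \<open>The last factor of the product is 1/2; the others, reversed, are (-1)^k (1/2)_k, and
  (1/2)_k = (2k)! / (4^k k!).\<close>

lemma pochhammer_half: "(-1) ^ k * pochhammer (1/2 - real k) (k + 1) = fact (2 * k) / (2 * 4 ^ k * fact k)"
proof -
  have "(-1) ^ k * pochhammer (1/2 - real k) k = fact (2 * k) / (4 ^ k * fact k)"
  proof -
    have e: "1/2 - real k = - (real k - 1/2)" by simp
    have "pochhammer (1/2 - real k) k = (-1) ^ k * pochhammer (1/2) k"
      unfolding e pochhammer_minus by simp
    moreover have "(-1) ^ k * (-1) ^ k = (1 :: real)" by (simp flip: power_mult_distrib)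
    ultimately have "(-1) ^ k * pochhammer (1/2 - real k) k = pochhammer (1/2) k"
      by (simp only: mult.assoc[symmetric] mult_1)
    moreover have "(2 :: real) ^ (2 * k) = 4 ^ k" by (simp add: power_mult)
    ultimately show ?thesis using fact_double[of k, where 'a = real] by simp
  qed
  moreover have "pochhammer (1/2 - real k) (k + 1) = pochhammer (1/2 - real k) k * (1/2)"
    by (simp add: pochhammer_Suc)
  ultimately show ?thesis by (simp only: mult.assoc[symmetric]) simp
qed

lemma pochhammer_neg_nat: "l \<le> k \<Longrightarrow> (-1) ^ l * pochhammer (- real k) l = fact k / fact (k - l)"
proof (induction l)
  case (Suc l)
  have "(-1) ^ Suc l * pochhammer (- real k) (Suc l) = ((-1) ^ l * pochhammer (- real k) l) * (real k - real l)"
    by (simp add: pochhammer_Suc algebra_simps)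
  also have "\<dots> = fact k / fact (k - l) * (real k - real l)" using Suc by simp
  also have "k - l = Suc (k - Suc l)" using Suc.prems by simp
  also have "fact k / fact (Suc (k - Suc l)) * (real k - real l) = fact k / (fact (k - Suc l) :: real)"
    using Suc.prems by (simp add: field_simps of_nat_diff)
  finally show ?case .
qed simp

section \<open>The series of exp(4 pi (sqrt(n-1) - sqrt n)) in 1/sqrt n and the coefficients
  \<open>A1\<close>, \<open>A2\<close>\<close>

definition exp_half_tan_fps :: "complex fps" where
  "exp_half_tan_fps = fps_compose (fps_exp (- (4 * of_real pi))) half_tan_fps"

lemma has_fps_expansion_exp_half_tan:
  "(\<lambda>z. exp (- (4 * of_real pi) * half_tan z)) has_fps_expansion exp_half_tan_fps"
  using has_fps_expansion_compose[OF has_fps_expansion_exp has_fps_expansion_half_tan half_tan_fps_0, of "- (4 * of_real pi)"]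
  by (simp add: o_def exp_half_tan_fps_def)

lemma nth_exp_half_tan_fps:
  "fps_nth exp_half_tan_fps n = (\<Sum>j=0..n. (- (4 * of_real pi)) ^ j / fact j * fps_nth (half_tan_fps ^ j) n)"
  by (simp add: exp_half_tan_fps_def fps_compose_nth)

lemma sum_even_indices:
  fixes f :: "nat \<Rightarrow> 'a :: comm_monoid_add"
  assumes "\<And>j. odd j \<Longrightarrow> f j = 0"
  shows "(\<Sum>j=0..2 * k. f j) = (\<Sum>l=0..k. f (2 * l))"
proof (induction k)
  case (Suc k)
  thus ?case using assms[of "Suc (2 * k)"] by simp
qed simp

lemma sum_odd_indices:
  fixes f :: "nat \<Rightarrow> 'a :: comm_monoid_add"
  assumes "\<And>j. even j \<Longrightarrow> f j = 0"
  shows "(\<Sum>j=0..2 * k + 1. f j) = (\<Sum>l=0..k. f (2 * l + 1))"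
proof (induction k)
  case 0
  thus ?case using assms[of 0] by simp
next
  case (Suc k)
  thus ?case using assms[of "Suc (Suc (2 * k))"] by simp
qed

text \<open>By parity only even powers of \<open>half_tan\<close> reach an even degree. Inserting
  their ballot numbers with i = k - l and rewriting factorials as Pochhammer symbols gives
  \<open>A1\<close>.\<close>

lemma exp_half_tan_even: "fps_nth exp_half_tan_fps (2 * k) = of_real (A1 k)"
proof (cases "k = 0")
  case True
  thus ?thesis by (simp add: nth_exp_half_tan_fps A1_def)
next
  case False
  let ?L = "\<lambda>l. (- (4 * of_real pi)) ^ (2 * l) / fact (2 * l) * fps_nth (half_tan_fps ^ (2 * l)) (2 * k)"
  let ?R = "\<lambda>l. (-1) ^ k * pochhammer (1/2 - real k) (k + 1) / real k *
      ((-1) ^ l * pochhammer (- real k) l / fact (k + l) * ((4 * pi) ^ (2 * l) / fact (2 * l - 1)))"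
  have "fps_nth exp_half_tan_fps (2 * k) = (\<Sum>l=0..k. ?L l)"
    unfolding nth_exp_half_tan_fps by (rule sum_even_indices) (simp add: half_tan_power_odd)
  \<comment> \<open>Power 0 of \<open>half_tan\<close> is the constant 1, which has no coefficient
    in degree 2k > 0; hence the sum in \<open>A1\<close> starts at 1.\<close>
  also have "\<dots> = (\<Sum>l=1..k. ?L l)"
    using False by (intro sum.mono_neutral_right) (auto simp: not_le)
  also have "\<dots> = (\<Sum>l=1..k. of_real (?R l))"
  proof (intro sum.cong refl)
    fix l assume l: "l \<in> {1..k}"
    then obtain l' where l': "l = Suc l'" by (cases l) auto
    obtain k' where k': "k = Suc k'" using False by (cases k) auto
    have b: "fps_nth (half_tan_fps ^ (2 * l)) (2 * k) =
        of_nat (2 * l) * fact (2 * k - 1) / (2 ^ (2 * k) * fact (k - l) * fact (k - l + 2 * l))"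
      by (rule half_tan_power_nth) (use l in auto)
    have kl: "k - l + 2 * l = k + l" using l by simp
    have fl: "(fact (2 * l) :: real) = real (2 * l) * fact (2 * l - 1)" by (simp add: l')
    have fk: "(fact (2 * k) :: real) = real (2 * k) * fact (2 * k - 1)" by (simp add: k')
    have "?L l =
      complex_of_real ((4 * pi) ^ (2 * l) / fact (2 * l) * (real (2 * l) * fact (2 * k - 1) / (2 ^ (2 * k) * fact (k - l) * fact (k + l))))"
      unfolding b kl by simp
    also have "(4 * pi) ^ (2 * l) / fact (2 * l) * (real (2 * l) * fact (2 * k - 1) / (2 ^ (2 * k) * fact (k - l) * fact (k + l))) =
       (4 * pi) ^ (2 * l) / fact (2 * l - 1) * (fact (2 * k - 1) / (4 ^ k * fact (k - l) * fact (k + l)))"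
    proof -
      have "(2 :: real) ^ (2 * k) = 4 ^ k" by (simp add: power_mult)
      moreover have "P / (c * f) * (c * g / D) = P / f * (g / D)" if "c \<noteq> 0" for P c f g D :: real
        using that by simp
      ultimately show ?thesis unfolding fl using l by simp
    qed
    also have "\<dots> = ?R l"
      unfolding pochhammer_half fk using pochhammer_neg_nat[of l k] l False by (simp add: mult_ac)
    finally show "?L l =
      complex_of_real (?R l)" .
  qed
  also have "\<dots> = of_real (A1 k)" using False unfolding A1_def by (simp only: of_real_sum[symmetric] sum_distrib_left if_False)
  finally show ?thesis .
qed

text \<open>As in the even case; the odd powers of -4 pi contribute the extra sign in
  \<open>A2\<close>.\<close>

lemma exp_half_tan_odd: "fps_nth exp_half_tan_fps (2 * k + 1) = of_real (A2 k)"
proof -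
  let ?L = "\<lambda>l. (- (4 * of_real pi)) ^ (2 * l + 1) / fact (2 * l + 1) * fps_nth (half_tan_fps ^ (2 * l + 1)) (2 * k + 1)"
  let ?R = "\<lambda>l. (-1) ^ (k + 1) * pochhammer (1/2 - real k) (k + 1) *
      ((-1) ^ l * pochhammer (- real k) l / fact (l + k + 1) * ((4 * pi) ^ (2 * l + 1) / fact (2 * l)))"
  have "fps_nth exp_half_tan_fps (2 * k + 1) =
      (\<Sum>l=0..k. ?L l)"
    unfolding nth_exp_half_tan_fps by (rule sum_odd_indices) (simp add: half_tan_power_odd)
  also have "\<dots> = (\<Sum>l=0..k. of_real (?R l))"
  proof (intro sum.cong refl)
    fix l assume l: "l \<in> {0..k}"
    have b: "fps_nth (half_tan_fps ^ (2 * l + 1)) (2 * k + 1) =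
        of_nat (2 * l + 1) * fact (2 * k + 1 - 1) / (2 ^ (2 * k + 1) * fact (k - l) * fact (k - l + (2 * l + 1)))"
      by (rule half_tan_power_nth) (use l in auto)
    have kl: "k - l + (2 * l + 1) = l + k + 1" "2 * k + 1 - 1 = 2 * k" using l by simp_all
    have fl: "(fact (2 * l + 1) :: real) = real (2 * l + 1) * fact (2 * l)" by simp
    have "?L l =
      complex_of_real (- ((4 * pi) ^ (2 * l + 1)) / fact (2 * l + 1) * (real (2 * l + 1) * fact (2 * k) / (2 ^ (2 * k + 1) * fact (k - l) * fact (l + k + 1))))"
      unfolding b kl by (simp add: fact_numeral del: fact_Suc of_nat_Suc)
    also have "- ((4 * pi) ^ (2 * l + 1)) / fact (2 * l + 1) * (real (2 * l + 1) * fact (2 * k) / (2 ^ (2 * k + 1) * fact (k - l) * fact (l + k + 1))) =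
       - ((4 * pi) ^ (2 * l + 1)) / fact (2 * l) * (fact (2 * k) / (2 * 4 ^ k * fact (k - l) * fact (l + k + 1)))"
    proof -
      have "(2 :: real) ^ (2 * k + 1) = 2 * 4 ^ k" by (simp add: power_mult)
      moreover have "- P / (c * f) * (c * g / D) = - P / f * (g / D)" if "c \<noteq> 0" for P c f g D :: real
        using that by simp
      ultimately show ?thesis unfolding fl by (simp del: fact_Suc of_nat_Suc power_Suc)
    qed
    also have "\<dots> = - ((-1) ^ k * pochhammer (1/2 - real k) (k + 1)) *
      ((-1) ^ l * pochhammer (- real k) l / fact (l + k + 1) * ((4 * pi) ^ (2 * l + 1) / fact (2 * l)))"
      unfolding pochhammer_half using pochhammer_neg_nat[of l k] l by (simp add: mult_ac del: fact_Suc of_nat_Suc power_Suc)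
    also have "- ((-1) ^ k * pochhammer (1/2 - real k) (k + 1)) = (-1) ^ (k + 1) * pochhammer (1/2 - real k) (k + 1)"
      by simp
    finally show "?L l =
      complex_of_real (?R l)" .
  qed
  also have "\<dots> = of_real (A2 k)" unfolding A2_def by (simp only: of_real_sum[symmetric] sum_distrib_left)
  finally show ?thesis .
qed

definition B_hat_fps :: "complex fps" where
  "B_hat_fps = exp_half_tan_fps * binomial_sq_fps (- 27 / 4)"

lemma nth_binomial_sq_fps_A_alpha: "fps_nth (binomial_sq_fps (- \<alpha>)) n = of_real (A_alpha \<alpha> n)"
  by (simp add: nth_binomial_sq_fps A_alpha_def)

text \<open>The factor (1 - z^2)^(-27/4) is even, so the parity of the degree selects
  \<open>A1\<close> or \<open>A2\<close> in the convolution.\<close>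

lemma nth_B_hat_fps: "fps_nth B_hat_fps n = of_real (B_hat n)"
proof -
  let ?f = "\<lambda>i. fps_nth exp_half_tan_fps i * fps_nth (binomial_sq_fps (- 27 / 4)) (n - i)"
  have A: "fps_nth (binomial_sq_fps (- 27 / 4)) i = of_real (A_alpha (27 / 4) i)" for i
    using nth_binomial_sq_fps_A_alpha[of "27 / 4" i] by simp
  have n: "fps_nth B_hat_fps n = (\<Sum>i=0..n. ?f i)" by (simp add: B_hat_fps_def fps_mult_nth)
  show ?thesis
  proof (cases "even n")
    case True
    then obtain m where m: "n = 2 * m" by auto
    have r: "{0..n} = {0..2 * m}" using m by simp
    have "fps_nth B_hat_fps n = (\<Sum>i=0..2 * m. if odd i then 0 else ?f i)"
      unfolding n r by (intro sum.cong refl) (auto simp: nth_binomial_sq_fps m)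
    also have "\<dots> = (\<Sum>l=0..m. if odd (2 * l) then 0 else ?f (2 * l))"
      by (rule sum_even_indices) auto
    also have "\<dots> = (\<Sum>l=0..m. of_real (A1 l * A_alpha (27 / 4) (2 * m - 2 * l)))"
      unfolding exp_half_tan_even A m by simp
    finally show ?thesis by (simp add: B_hat_def m)
  next
    case False
    then obtain m where m: "n = 2 * m + 1" by (elim oddE)
    have r: "{0..n} = {0..2 * m + 1}" using m by simp
    have "fps_nth B_hat_fps n = (\<Sum>i=0..2 * m + 1. if even i then 0 else ?f i)"
      unfolding n r
    proof (intro sum.cong refl)
      fix i assume "i \<in> {0..2 * m + 1}"
      moreover have "odd (n - i)" if "even i" "i \<le> n" using that False by simp
      ultimately show "?f i = (if even i then 0 else ?f i)" using m by (auto simp: nth_binomial_sq_fps)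
    qed
    also have "\<dots> = (\<Sum>l=0..m. if even (2 * l + 1) then 0 else ?f (2 * l + 1))"
      by (rule sum_odd_indices) auto
    also have "\<dots> = (\<Sum>l=0..m. of_real (A2 l * A_alpha (27 / 4) (2 * m - 2 * l)))"
      unfolding exp_half_tan_odd A m by simp
    finally show ?thesis using False by (simp add: B_hat_def Let_def m)
  qed
qed

section \<open>The Hankel terms in 1/sqrt n and the coefficients \<open>C_coeff\<close> and
  \<open>B_tilde\<close>\<close>

definition hankel_coeff :: "nat \<Rightarrow> real" where
  "hankel_coeff k = (-1) ^ k * a13 k / (4 * pi) ^ k"

text \<open>The series of (s / sqrt(1 - s^2))^k, that is of (n-1)^(-k/2) for s = 1/sqrt n. With x =
  4 pi sqrt(n-1), the Hankel term of order k is \<open>hankel_coeff k\<close> times this.\<close>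

definition hankel_power_fps :: "nat \<Rightarrow> complex fps" where
  "hankel_power_fps k = fps_X ^ k * binomial_sq_fps (- real k / 2)"

lemma nth_hankel_power_fps:
  "fps_nth (hankel_power_fps k) n = (if n < k then 0 else fps_nth (binomial_sq_fps (- real k / 2)) (n - k))"
  by (simp add: hankel_power_fps_def fps_X_power_mult_nth)

text \<open>Only \<open>k\<close> of the same parity as \<open>n\<close> contribute. For odd
  \<open>k\<close> the sign (-1)^k of \<open>hankel_coeff\<close> is the additional -1 in the odd
  case of \<open>C_coeff\<close>.\<close>

lemma C_coeff_eq: "of_real (C_coeff n) = (\<Sum>k=0..n. of_real (hankel_coeff k) * fps_nth (hankel_power_fps k) n)"
proof (cases "even n")
  case True
  then obtain m where m: "n = 2 * m" by auto
  have "(\<Sum>k=0..n. of_real (hankel_coeff k) * fps_nth (hankel_power_fps k) n) =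
      (\<Sum>k=0..2 * m. if odd k then 0 else of_real (hankel_coeff k) * fps_nth (hankel_power_fps k) n)"
    unfolding m by (intro sum.cong refl) (auto simp: nth_hankel_power_fps nth_binomial_sq_fps)
  also have "\<dots> = (\<Sum>k=0..m. if odd (2 * k) then 0 else of_real (hankel_coeff (2 * k)) * fps_nth (hankel_power_fps (2 * k)) n)"
    by (rule sum_even_indices) auto
  also have "\<dots> = (\<Sum>k=0..m. of_real ((-1) ^ m * (((- real k) gchoose (m - k)) * ((-1) ^ k * a13 (2 * k) / (4 * pi) ^ (2 * k)))))"
  proof (intro sum.cong refl)
    fix k assume k: "k \<in> {0..m}"
    have e: "(n - 2 * k) div 2 = m - k" "even (n - 2 * k)" "- real (2 * k) / 2 = - real k" using k m by auto
    have s: "(-1) ^ (m - k) = (-1) ^ m * (-1) ^ k * (1 :: real)"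
      using k by (auto simp: minus_one_power_iff)
    have "fps_nth (hankel_power_fps (2 * k)) n = of_real ((-1) ^ (m - k) * ((- real k) gchoose (m - k)))"
      using k m e by (simp add: nth_hankel_power_fps nth_binomial_sq_fps)
    thus "(if odd (2 * k) then 0 else of_real (hankel_coeff (2 * k)) * fps_nth (hankel_power_fps (2 * k)) n) =
        complex_of_real ((-1) ^ m * (((- real k) gchoose (m - k)) * ((-1) ^ k * a13 (2 * k) / (4 * pi) ^ (2 * k))))"
      by (simp add: hankel_coeff_def s)
  qed
  also have "\<dots> = of_real (C_coeff n)" using True m by (simp add: C_coeff_def sum_distrib_left)
  finally show ?thesis ..
next
  case False
  then obtain m where m: "n = 2 * m + 1" by (elim oddE)
  have "(\<Sum>k=0..n. of_real (hankel_coeff k) * fps_nth (hankel_power_fps k) n) =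
      (\<Sum>k=0..2 * m + 1. if even k then 0 else of_real (hankel_coeff k) * fps_nth (hankel_power_fps k) n)"
    unfolding m by (intro sum.cong refl) (auto simp: nth_hankel_power_fps nth_binomial_sq_fps)
  also have "\<dots> = (\<Sum>k=0..m. if even (2 * k + 1) then 0 else of_real (hankel_coeff (2 * k + 1)) * fps_nth (hankel_power_fps (2 * k + 1)) n)"
    by (rule sum_odd_indices) auto
  also have "\<dots> = (\<Sum>k=0..m. of_real ((-1) ^ (m + 1) * (((- (2 * real k + 1) / 2) gchoose (m - k)) * ((-1) ^ k * a13 (2 * k + 1) / (4 * pi) ^ (2 * k + 1)))))"
  proof (intro sum.cong refl)
    fix k assume k: "k \<in> {0..m}"
    have e: "(n - (2 * k + 1)) div 2 = m - k" "even (n - (2 * k + 1))" "- real (2 * k + 1) / 2 = - (2 * real k + 1) / 2" "\<not> n < 2 * k + 1"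
      using k m by auto
    have s: "(-1) ^ (m - k) = (-1) ^ m * (-1) ^ k * (1 :: real)"
      using k by (auto simp: minus_one_power_iff)
    have "fps_nth (hankel_power_fps (2 * k + 1)) n = of_real ((-1) ^ (m - k) * ((- (2 * real k + 1) / 2) gchoose (m - k)))"
      unfolding nth_hankel_power_fps nth_binomial_sq_fps e using e by (simp only: if_True if_False)
    moreover have "hankel_coeff (2 * k + 1) = - (a13 (2 * k + 1) / (4 * pi) ^ (2 * k + 1))"
      by (simp add: hankel_coeff_def)
    ultimately show "(if even (2 * k + 1) then 0 else of_real (hankel_coeff (2 * k + 1)) * fps_nth (hankel_power_fps (2 * k + 1)) n) =
        complex_of_real ((-1) ^ (m + 1) * (((- (2 * real k + 1) / 2) gchoose (m - k)) * ((-1) ^ k * a13 (2 * k + 1) / (4 * pi) ^ (2 * k + 1))))"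
      by (simp add: s mult_ac power_Suc[of "-1 :: complex" m] del: power_Suc)
  qed
  also have "\<dots> = of_real (C_coeff n)" using False m by (simp add: C_coeff_def Let_def sum_distrib_left)
  finally show ?thesis ..
qed

text \<open>The Hankel term of order k starts in degree k, so cutting the expansion at
  \<open>M\<close> does not affect the Taylor coefficients below \<open>M\<close>.\<close>

lemma B_tilde_eq:
  assumes "m < M"
  shows "of_real (B_tilde m) = (\<Sum>k<M. of_real (hankel_coeff k) * fps_nth (B_hat_fps * hankel_power_fps k) m)"
proof -
  have low: "fps_nth (hankel_power_fps k) n = 0" if "n < k" for n k
    using that by (simp add: nth_hankel_power_fps)
  have C: "of_real (C_coeff j) = (\<Sum>k<M. of_real (hankel_coeff k) * fps_nth (hankel_power_fps k) j)" if "j \<le> m" for j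
    unfolding C_coeff_eq using that assms low by (intro sum.mono_neutral_left) auto
  have "of_real (B_tilde m) = (\<Sum>i=0..m. fps_nth B_hat_fps i * of_real (C_coeff (m - i)))"
    by (simp add: B_tilde_def nth_B_hat_fps)
  also have "\<dots> = (\<Sum>i=0..m. \<Sum>k<M. of_real (hankel_coeff k) * (fps_nth B_hat_fps i * fps_nth (hankel_power_fps k) (m - i)))"
    by (intro sum.cong refl) (simp add: C sum_distrib_left mult_ac)
  also have "\<dots> = (\<Sum>k<M. \<Sum>i=0..m. of_real (hankel_coeff k) * (fps_nth B_hat_fps i * fps_nth (hankel_power_fps k) (m - i)))"
    by (rule sum.swap)
  also have "\<dots> = (\<Sum>k<M. of_real (hankel_coeff k) * fps_nth (B_hat_fps * hankel_power_fps k) m)"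
    by (simp add: fps_mult_nth sum_distrib_left)
  finally show ?thesis .
qed

section \<open>Taylor remainders by Cauchy's estimate on the circle of radius 1/2\<close>

lemma taylor_tail_bound:
  fixes f :: "complex \<Rightarrow> complex"
  assumes holo: "f holomorphic_on ball 0 1" and F: "f has_fps_expansion F"
    and B: "\<And>z. norm z = 1 / 2 \<Longrightarrow> norm (f z) \<le> B" and s: "0 \<le> s" "s < 1 / 2"
  shows "norm (f (of_real s) - (\<Sum>m<M. fps_nth F m * of_real s ^ m)) \<le> B * (2 * s) ^ M / (1 - 2 * s)"
proof -
  have "f has_fps_expansion fps_expansion f 0"
    by (rule has_fps_expansion_fps_expansion[OF _ _ holo]) auto
  hence "F = fps_expansion f 0" using F by (metis fps_expansion_unique_complex)
  hence F_nth: "fps_nth F m = (deriv ^^ m) f 0 / fact m" for m by (simp add: fps_expansion_def)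
  have bound: "norm (fps_nth F m) \<le> B * 2 ^ m" for m
  proof -
    have "norm ((deriv ^^ m) f 0) \<le> fact m * B / (1 / 2) ^ m"
    proof (rule Cauchy_inequality)
      show "f holomorphic_on ball 0 (1 / 2)" by (rule holomorphic_on_subset[OF holo]) auto
      show "continuous_on (cball 0 (1 / 2)) f"
        by (rule holomorphic_on_imp_continuous_on, rule holomorphic_on_subset[OF holo]) auto
    qed (use B in auto)
    thus ?thesis by (simp add: F_nth norm_divide power_divide field_simps)
  qed
  have "(\<lambda>m. fps_nth F m * of_real s ^ m) sums f (of_real s)"
    using holomorphic_power_series[OF holo, of "of_real s"] s by (simp add: F_nth)
  hence "(\<lambda>m. fps_nth F (m + M) * of_real s ^ (m + M)) sums (f (of_real s) - (\<Sum>m<M. fps_nth F m * of_real s ^ m))"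
    by (subst sums_iff_shift) simp
  hence eq: "f (of_real s) - (\<Sum>m<M. fps_nth F m * of_real s ^ m) = (\<Sum>m. fps_nth F (m + M) * of_real s ^ (m + M))"
    by (rule sums_unique)
  have le: "norm (fps_nth F (m + M) * of_real s ^ (m + M)) \<le> (B * (2 * s) ^ M) * (2 * s) ^ m" for m
  proof -
    have "norm (fps_nth F (m + M) * of_real s ^ (m + M)) = norm (fps_nth F (m + M)) * s ^ (m + M)"
      using s by (simp add: norm_mult norm_power)
    also have "\<dots> \<le> B * 2 ^ (m + M) * s ^ (m + M)" using s by (intro mult_right_mono bound) auto
    finally show ?thesis by (simp add: power_add power_mult_distrib mult_ac)
  qed
  have geo: "(\<lambda>m. (B * (2 * s) ^ M) * (2 * s) ^ m) sums (B * (2 * s) ^ M * (1 / (1 - 2 * s)))"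
    using s by (intro sums_mult geometric_sums) auto
  have sn: "summable (\<lambda>m. norm (fps_nth F (m + M) * of_real s ^ (m + M)))"
    by (rule summable_comparison_test'[OF sums_summable[OF geo], of 0]) (use le in simp)
  have "norm (\<Sum>m. fps_nth F (m + M) * of_real s ^ (m + M)) \<le> (\<Sum>m. norm (fps_nth F (m + M) * of_real s ^ (m + M)))"
    by (rule summable_norm[OF sn])
  also have "\<dots> \<le> (\<Sum>m. (B * (2 * s) ^ M) * (2 * s) ^ m)"
    by (rule suminf_le[OF le sn sums_summable[OF geo]])
  also have "\<dots> = B * (2 * s) ^ M * (1 / (1 - 2 * s))" by (rule sums_unique[OF geo, symmetric])
  finally show ?thesis unfolding eq by simp
qed

text \<open>At real z = 1/sqrt n: the quotient of the prefactors at n - 1 and at n, times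
  (n-1)^(-k/2).\<close>

definition expansion_fun :: "nat \<Rightarrow> complex \<Rightarrow> complex" where
  "expansion_fun k z = (exp (- (4 * of_real pi) * half_tan z) * (1 - z\<^sup>2) powr of_real (- 27 / 4)) *
     (z ^ k * (1 - z\<^sup>2) powr of_real (- real k / 2))"

lemma expansion_fun_fps: "expansion_fun k has_fps_expansion (B_hat_fps * hankel_power_fps k)"
  unfolding expansion_fun_def B_hat_fps_def hankel_power_fps_def
  by (intro has_fps_expansion_mult has_fps_expansion_exp_half_tan has_fps_expansion_binomial_sq has_fps_expansion_fps_X_power)

lemma holomorphic_expansion_fun: "expansion_fun k holomorphic_on ball 0 1"
  unfolding expansion_fun_def
  by (intro holomorphic_intros holomorphic_half_tan) (use one_minus_sq_not_nonpos in auto)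

lemma norm_powr_le:
  fixes z :: complex
  assumes "norm z \<ge> c" "c > 0" "a \<le> 0"
  shows "norm (z powr of_real a) \<le> c powr a"
proof -
  have "norm (z powr of_real a) = norm z powr a"
    using assms by (subst norm_powr_real_powr') auto
  also have "\<dots> \<le> c powr a" using assms by (intro powr_mono2') auto
  finally show ?thesis .
qed

lemma three_quarters_powr_le: "(3 / 4) powr (- 27 / 4) \<le> (8 :: real)"
proof -
  have "(3 / 4 :: real) powr (- 27 / 4) \<le> (3 / 4) powr (- 7)" by (intro powr_mono') auto
  also have "\<dots> = (4 / 3) ^ 7" by (simp add: powr_minus powr_numeral power_divide)
  also have "\<dots> \<le> 8" by (simp add: eval_nat_numeral)
  finally show ?thesis .
qed

text \<open>The bound must not depend on \<open>k\<close>. Weakening |1 - z^2| >= 3/4 to 1/4 in the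
  last factor gives 2^k, which cancels |z|^k = 2^(-k). The rest is at most 3^7 * 8 = 17496.\<close>

lemma norm_expansion_fun_le:
  assumes z: "norm z = 1 / 2"
  shows "norm (expansion_fun k z) \<le> 17500"
proof -
  have "norm (z\<^sup>2) = 1 / 4" by (simp only: norm_power z) (simp add: power_divide)
  hence n: "norm (1 - z\<^sup>2) \<ge> 3 / 4" using norm_triangle_ineq2[of 1 "z\<^sup>2"] by simp
  have "norm (half_tan z) \<le> (1 / 2) / 1"
    unfolding half_tan_def norm_divide z using norm_one_plus_csqrt by (intro frac_le) auto
  hence "norm (- (4 * of_real pi) * half_tan z) \<le> 4 * pi * (1 / 2)"
    by (simp add: norm_mult)
  also have "\<dots> \<le> of_nat 7 * 1" using pi_approx by simp
  finally have "norm (exp (- (4 * of_real pi) * half_tan z)) \<le> exp (of_nat 7 * 1)"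
    by (intro order_trans[OF norm_exp]) simp
  also have "\<dots> = exp 1 ^ 7" by (rule exp_of_nat_mult)
  also have "\<dots> \<le> 3 ^ 7" by (intro power_mono exp_le) auto
  finally have 1: "norm (exp (- (4 * of_real pi) * half_tan z)) \<le> 2187" by simp
  have 2: "norm ((1 - z\<^sup>2) powr of_real (- 27 / 4)) \<le> 8"
    using norm_powr_le[OF n, of "- 27 / 4"] three_quarters_powr_le by linarith
  have "norm ((1 - z\<^sup>2) powr of_real (- real k / 2)) \<le> (1 / 4) powr (- real k / 2)"
    by (rule norm_powr_le) (use n in auto)
  also have "(1 / 4 :: real) powr (- real k / 2) = 2 ^ k"
  proof -
    have q: "(2 :: real) powr (-2) = 1 / 4" by (simp add: powr_minus powr_numeral)
    have "((2 :: real) powr (-2)) powr (- real k / 2) = 2 powr real k" by (simp add: powr_powr)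
    hence "(1 / 4 :: real) powr (- real k / 2) = 2 powr real k" by (simp only: q)
    thus ?thesis by (simp add: powr_realpow)
  qed
  finally have "norm (z ^ k * (1 - z\<^sup>2) powr of_real (- real k / 2)) \<le> (1 / 2) ^ k * 2 ^ k"
    unfolding norm_mult norm_power z by (intro mult_left_mono) auto
  hence 3: "norm (z ^ k * (1 - z\<^sup>2) powr of_real (- real k / 2)) \<le> 1"
    by (simp add: power_divide)
  have "norm (expansion_fun k z) \<le> (2187 * 8) * 1"
    unfolding expansion_fun_def norm_mult[of "_ * _" "_ * _"] norm_mult[of "exp _"]
    using 1 2 3 by (intro mult_mono) auto
  thus ?thesis by simp
qed

lemma expansion_fun_of_real:
  assumes s: "0 \<le> s" "s < 1"
  defines "r \<equiv> sqrt (1 - s\<^sup>2)"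
  shows "expansion_fun k (of_real s) = of_real (exp (- (4 * pi * (s / (1 + r)))) * (1 - s\<^sup>2) powr (- 27 / 4) * (s / r) ^ k)"
proof -
  have pos: "1 - s\<^sup>2 > 0" using s by (simp add: power_less_one_iff abs_square_less_1)
  have e: "1 - (of_real s)\<^sup>2 = complex_of_real (1 - s\<^sup>2)" by simp
  have h: "half_tan (of_real s) = of_real (s / (1 + r))"
    unfolding half_tan_def e r_def using pos by (simp add: csqrt_of_real_nonneg flip: of_real_power of_real_diff)
  have p: "complex_of_real (1 - s\<^sup>2) powr of_real a = of_real ((1 - s\<^sup>2) powr a)" for a
    using pos by (intro powr_of_real) auto
  have "(1 - s\<^sup>2) powr (- real k / 2) = (1 / r) ^ k"
  proof -
    have "r > 0" using pos by (simp add: r_def)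
    have "(1 - s\<^sup>2) powr (- real k / 2) = (r powr 2) powr (- real k / 2)" using pos by (simp add: r_def)
    also have "\<dots> = r powr (- real k)" by (simp add: powr_powr)
    also have "\<dots> = (1 / r) ^ k" using \<open>r > 0\<close> by (simp add: powr_minus powr_realpow power_divide divide_inverse power_inverse)
    finally show ?thesis .
  qed
  hence "expansion_fun k (of_real s) = exp (- (4 * of_real pi) * of_real (s / (1 + r))) * of_real ((1 - s\<^sup>2) powr (- 27 / 4)) * (of_real s ^ k * of_real ((1 / r) ^ k))"
    unfolding expansion_fun_def e h p by simp
  also have "exp (- (4 * of_real pi) * of_real (s / (1 + r))) = complex_of_real (exp (- (4 * pi * (s / (1 + r)))))"
    by (simp flip: exp_of_real)
  also have "of_real s ^ k * of_real ((1 / r) ^ k) = complex_of_real ((s / r) ^ k)"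
    by (simp add: power_divide)
  finally show ?thesis by simp
qed

lemma pochhammer_27_le: "pochhammer (27 / 2 :: real) k \<le> 14 ^ k * fact k"
proof (induction k)
  case (Suc k)
  have "pochhammer (27 / 2 :: real) (Suc k) = pochhammer (27 / 2) k * (27 / 2 + real k)" by (rule pochhammer_Suc)
  also have "\<dots> \<le> (14 ^ k * fact k) * (14 * (real k + 1))" using Suc by (intro mult_mono) auto
  also have "\<dots> = 14 ^ Suc k * fact (Suc k)" by (simp add: algebra_simps)
  finally show ?case .
qed simp

text \<open>The Pochhammer symbol is at most 14^k k!, and the power of 2 * 4 pi > 14 absorbs
  14^k.\<close>

lemma abs_hankel_coeff_le: "\<bar>hankel_coeff k\<bar> \<le> 1300 * fact k"
proof -
  have "\<bar>hankel_coeff k\<bar> = \<bar>binom25 k\<bar> * (pochhammer (27 / 2) k / (2 * (4 * pi)) ^ k)"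
    unfolding hankel_coeff_def a13_eq power_mult_distrib[of 2 "4 * pi"]
    by (simp add: abs_mult abs_divide power_abs pochhammer_nonneg)
  also have "\<dots> \<le> 1300 * (14 ^ k * fact k / 14 ^ k)"
    using pi_gt3 by (intro mult_mono frac_le abs_binom25_le pochhammer_27_le power_mono) (auto simp: pochhammer_nonneg)
  finally show ?thesis by simp
qed

lemma sum_fact_le: "(\<Sum>k<M. fact k) \<le> (fact M :: real)"
proof (induction M)
  case (Suc M)
  show ?case
  proof (cases "M = 0")
    case False
    have "(\<Sum>k<Suc M. fact k) \<le> fact M + (fact M :: real)" using Suc by simp
    also have "\<dots> = 2 * fact M" by simp
    also have "\<dots> \<le> real (Suc M) * fact M" using False by (intro mult_right_mono) auto
    finally show ?thesis by simp
  qed simp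
qed simp

text \<open>By \<open>B_tilde_eq\<close> the difference is a combination of Taylor remainders of
  order \<open>M\<close>, one for each Hankel term. The factorial bounds of the coefficients sum to
  at most M!, 1 - 2 s >= 9/11, and 1300 * 17500 * 11/9 is below 3 * 10^7.\<close>

lemma expansion_main_error:
  assumes s: "0 \<le> s" "s \<le> 1 / 11"
  defines "r \<equiv> sqrt (1 - s\<^sup>2)"
  shows "\<bar>exp (- (4 * pi * (s / (1 + r)))) * (1 - s\<^sup>2) powr (- 27 / 4) * (\<Sum>k<M. hankel_coeff k * (s / r) ^ k)
     - (\<Sum>m<M. B_tilde m * s ^ m)\<bar> \<le> 3 * 10 ^ 7 * fact M * (2 * s) ^ M"
proof -
  let ?G = "exp (- (4 * pi * (s / (1 + r)))) * (1 - s\<^sup>2) powr (- 27 / 4)"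
  let ?F = "\<lambda>k. B_hat_fps * hankel_power_fps k"
  let ?E = "\<lambda>k. expansion_fun k (of_real s) - (\<Sum>m<M. fps_nth (?F k) m * of_real s ^ m)"
  have "complex_of_real (?G * (\<Sum>k<M. hankel_coeff k * (s / r) ^ k) - (\<Sum>m<M. B_tilde m * s ^ m)) =
      (\<Sum>k<M. of_real (hankel_coeff k) * expansion_fun k (of_real s)) - (\<Sum>m<M. of_real (B_tilde m) * of_real s ^ m)"
    unfolding r_def using s by (simp add: expansion_fun_of_real sum_distrib_left sum_distrib_right mult_ac)
  also have "(\<Sum>m<M. of_real (B_tilde m) * of_real s ^ m) =
      (\<Sum>m<M. \<Sum>k<M. of_real (hankel_coeff k) * (fps_nth (?F k) m * complex_of_real s ^ m))"
    by (intro sum.cong refl) (simp add: B_tilde_eq[of _ M] sum_distrib_right sum_distrib_left mult_ac)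
  also have "\<dots> = (\<Sum>k<M. \<Sum>m<M. of_real (hankel_coeff k) * (fps_nth (?F k) m * complex_of_real s ^ m))"
    by (rule sum.swap)
  also have "(\<Sum>k<M. of_real (hankel_coeff k) * expansion_fun k (of_real s)) - \<dots> =
      (\<Sum>k<M. of_real (hankel_coeff k) * ?E k)"
    by (simp add: right_diff_distrib sum_subtractf sum_distrib_left)
  finally have eq: "complex_of_real (?G * (\<Sum>k<M. hankel_coeff k * (s / r) ^ k) - (\<Sum>m<M. B_tilde m * s ^ m)) =
      (\<Sum>k<M. of_real (hankel_coeff k) * ?E k)" .
  have "\<bar>?G * (\<Sum>k<M. hankel_coeff k * (s / r) ^ k) - (\<Sum>m<M. B_tilde m * s ^ m)\<bar> =
      norm (\<Sum>k<M. of_real (hankel_coeff k) * ?E k)"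
    unfolding eq[symmetric] by (simp only: norm_of_real)
  also have "\<dots> \<le> (\<Sum>k<M. norm (complex_of_real (hankel_coeff k) * ?E k))"
    by (rule norm_sum)
  also have "\<dots> \<le> (\<Sum>k<M. (1300 * fact k) * (17500 * (2 * s) ^ M / (1 - 2 * s)))"
    unfolding norm_mult norm_of_real
    by (intro sum_mono mult_mono abs_hankel_coeff_le taylor_tail_bound holomorphic_expansion_fun expansion_fun_fps norm_expansion_fun_le)
      (use s in auto)
  also have "\<dots> = (\<Sum>k<M. fact k) * (1300 * (17500 * (2 * s) ^ M / (1 - 2 * s)))"
    unfolding sum_distrib_right by (intro sum.cong refl) simp
  also have "\<dots> \<le> fact M * (1300 * (17500 * (2 * s) ^ M / (9 / 11)))"
    using s by (intro mult_mono sum_fact_le mult_left_mono frac_le) auto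
  also have "\<dots> = (1300 * 17500 * 11 / 9) * (fact M * (2 * s) ^ M)" by simp
  also have "\<dots> \<le> 3 * 10 ^ 7 * (fact M * (2 * s) ^ M)" using s by (intro mult_right_mono) auto
  finally show ?thesis by (simp only: mult.assoc)
qed

lemma power_le_fact_exp: "0 \<le> t \<Longrightarrow> t ^ m \<le> fact m * exp (t :: real)"
proof -
  assume t: "0 \<le> t"
  have "(\<lambda>n. t ^ n / fact n) sums exp t" using exp_converges[of t] by (simp add: divide_inverse mult.commute)
  hence "summable (\<lambda>n. t ^ n / fact n)" "(\<Sum>n. t ^ n / fact n) = exp t" by (auto simp: sums_iff)
  moreover have "(\<Sum>n\<in>{m}. t ^ n / fact n) \<le> (\<Sum>n. t ^ n / fact n)"
    using \<open>summable (\<lambda>n. t ^ n / fact n)\<close> by (rule sum_le_suminf) (use t in auto)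
  ultimately have "t ^ m / fact m \<le> exp t" by simp
  thus ?thesis by (simp add: field_simps)
qed

section \<open>The error estimate\<close>

lemma E13_nonneg: "E13 N \<ge> 0"
proof -
  consider "N \<le> 11" | "N = 12" | "N \<ge> 13" by linarith
  thus ?thesis
  proof cases
    case 1
    hence "sqrt (1 / (13 - real N)) \<ge> sqrt (1 / 14)" by (intro real_sqrt_le_mono frac_le) auto
    with 1 show ?thesis unfolding E13_def
      by (auto intro!: add_nonneg_nonneg mult_nonneg_nonneg)
  next
    case 2
    thus ?thesis by (simp add: E13_def)
  next
    case 3
    thus ?thesis unfolding E13_def
      by (auto intro!: add_nonneg_nonneg mult_nonneg_nonneg divide_nonneg_nonneg)
  qed
qed

lemma E2_ge: "E2 \<ge> 10 ^ 5"
proof -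
  have "2 \<le> sqrt (2 * pi)" using pi_gt3 by (intro real_le_rsqrt) auto
  moreover have "cosh (4 * pi) \<ge> 29000"
  proof -
    have "(5 / 2) ^ 12 \<le> (exp 1 :: real) ^ 12"
      using exp_lower_Taylor_quadratic[of 1] by (intro power_mono) auto
    also have "\<dots> = exp (of_nat 12 * 1)" by (rule exp_of_nat_mult[symmetric])
    also have "\<dots> \<le> exp (4 * pi)" using pi_gt3 by simp
    finally have "58000 \<le> exp (4 * pi)" by (simp add: eval_nat_numeral)
    hence "58000 \<le> exp (4 * pi) + exp (- (4 * pi))" by (rule add_increasing2[rotated]) simp
    thus ?thesis by (simp add: cosh_field_def)
  qed
  ultimately have "(2 * 2) * 29000 \<le> 2 * sqrt (2 * pi) * cosh (4 * pi)"
    by (intro mult_mono) auto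
  thus ?thesis by (simp add: E2_def)
qed

text \<open>Only the product \<open>E4 N * E6 N\<close>, with \<open>E6 N\<close> at least
  \<open>2 * E5 N\<close>, is kept. Its constant is 204 * E2 with E2 >= 10^5, its base is sqrt(69 *
  27/4) > 21 since 441 <= 465.75, and (N+1)! <= 2 N N! uses N >= 1.\<close>

lemma E_total_ge:
  assumes N: "N \<ge> 1"
  shows "10 ^ 7 * 21 ^ (N + 1) * fact (N + 1) \<le> E_total N"
proof -
  let ?e = "(real N + 1) / 2"
  have pos: "E2 \<ge> 0" "E3 (27 / 4) N \<ge> 0" "E4 N \<ge> 0" "E5 N \<ge> 0" "EN1 N \<ge> 0"
    using E2_ge E13_nonneg[of N] by (auto simp: E3_def E4_def E5_def EN1_def)
  hence E6: "E6 N \<ge> 2 * E5 N" by (simp add: E6_def)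
  have "21 ^ (N + 1) = (441 :: real) powr ?e"
  proof -
    have q: "(21 :: real) powr 2 = 441" by (simp add: powr_numeral)
    have "((21 :: real) powr 2) powr ?e = 21 powr real (N + 1)" by (simp add: powr_powr add.commute)
    thus ?thesis unfolding q by (simp only: powr_realpow zero_less_numeral)
  qed
  also have "\<dots> \<le> (27 / 4 * 69) powr ?e" by (intro powr_mono2) auto
  also have "\<dots> = (27 / 4) powr ?e * 69 powr ?e" by (rule powr_mult)
  finally have p: "21 ^ (N + 1) \<le> (27 / 4) powr ?e * (69 :: real) powr ?e" .
  have f: "fact (N + 1) \<le> 2 * (real N * fact N)"
  proof -
    have "fact (N + 1) = (real N + 1) * fact N" by simp
    also have "\<dots> \<le> (2 * real N) * fact N" using N by (intro mult_right_mono) auto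
    finally show ?thesis by simp
  qed
  have "10 ^ 7 * 21 ^ (N + 1) * fact (N + 1) \<le> 10 ^ 7 * ((27 / 4) powr ?e * 69 powr ?e) * (2 * (real N * fact N))"
    using p f by (intro mult_mono) auto
  also have "\<dots> = 2 * 10 ^ 7 * (((27 / 4) powr ?e * 69 powr ?e) * (real N * fact N))" by simp
  also have "\<dots> \<le> 204 * E2 * (((27 / 4) powr ?e * 69 powr ?e) * (real N * fact N))"
    using E2_ge by (intro mult_right_mono) auto
  also have "\<dots> = E4 N * (2 * E5 N)" by (simp add: E4_def E3_def E5_def)
  also have "\<dots> \<le> E4 N * (28 * fact N + E6 N)"
    using pos E6 by (intro mult_left_mono) (simp_all add: add_increasing)
  also have "\<dots> \<le> E_total N"
    unfolding E_total_def using pos E6 by simp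
  finally show ?thesis .
qed

text \<open>The saving exp(-3/2 pi t) is at most exp(-9/2 t) and is split: exp(-7/2 t) absorbs t^14
  at the cost 14! / (7/2)^14 <= 3000, and exp(-t) absorbs t^M at the cost M!.\<close>

lemma exponential_error_bound:
  assumes t: "t \<ge> 1"
  shows "sqrt 2 * t powr (27 / 2) / exp (4 * pi * t) * (200 * exp (5 / 2 * pi * t)) \<le> 10 ^ 6 * fact M / t ^ M"
proof -
  have "sqrt 2 \<le> 3 / 2" by (rule real_le_lsqrt) (auto simp: power2_eq_square)
  have "t powr (27 / 2) \<le> t powr real 14" using t by (intro powr_mono) auto
  also have "\<dots> = t ^ 14" using t by (intro powr_realpow) auto
  finally have 1: "t powr (27 / 2) \<le> t ^ 14" .
  have "exp (5 / 2 * pi * t) / exp (4 * pi * t) = exp (- (3 / 2 * pi * t))"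
    by (simp flip: exp_diff)
  also have "\<dots> \<le> exp (- (7 / 2 * t + t))"
  proof -
    have "9 / 2 * t \<le> 3 / 2 * pi * t" using pi_gt3 t by (intro mult_right_mono) auto
    thus ?thesis by simp
  qed
  also have "\<dots> = 1 / (exp (7 / 2 * t) * exp t)" by (simp only: exp_minus exp_add inverse_eq_divide)
  finally have 2: "exp (5 / 2 * pi * t) / exp (4 * pi * t) \<le> 1 / (exp (7 / 2 * t) * exp t)" .
  have "(7 / 2 * t) ^ 14 \<le> fact 14 * exp (7 / 2 * t)" using t by (intro power_le_fact_exp) auto
  hence "(7 / 2) ^ 14 * t ^ 14 \<le> fact 14 * exp (7 / 2 * t)" by (simp only: power_mult_distrib)
  moreover have "(fact 14 :: real) \<le> 3000 * (7 / 2) ^ 14" by (simp add: fact_numeral power_divide)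
  hence "fact 14 * exp (7 / 2 * t) \<le> 3000 * (7 / 2) ^ 14 * exp (7 / 2 * t)" by (intro mult_right_mono) auto
  ultimately have "(7 / 2) ^ 14 * t ^ 14 \<le> (7 / 2) ^ 14 * (3000 * exp (7 / 2 * t))" by (simp only: mult_ac)
  hence 3: "t ^ 14 \<le> 3000 * exp (7 / 2 * t)" by (rule mult_left_le_imp_le) simp
  have 4: "t ^ M \<le> fact M * exp t" using t by (intro power_le_fact_exp) auto
  have "sqrt 2 * t powr (27 / 2) / exp (4 * pi * t) * (200 * exp (5 / 2 * pi * t)) =
      (200 * sqrt 2) * (t powr (27 / 2) * (exp (5 / 2 * pi * t) / exp (4 * pi * t)))" by simp
  also have "\<dots> \<le> 300 * ((3000 * exp (7 / 2 * t)) * (1 / (exp (7 / 2 * t) * exp t)))"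
    using 1 2 3 \<open>sqrt 2 \<le> 3 / 2\<close> by (intro mult_mono) auto
  also have "\<dots> = 900000 / exp t" by simp
  also have "\<dots> \<le> 900000 * (fact M / t ^ M)"
  proof -
    have "1 / exp t \<le> fact M / t ^ M" using 4 t by (simp add: field_simps)
    thus ?thesis by simp
  qed
  also have "\<dots> \<le> 10 ^ 6 * (fact M / t ^ M)" using t by (intro mult_right_mono) auto
  finally show ?thesis by simp
qed

text \<open>Three errors are added: the circle method (\<open>c * D\<close>), the passage from n - 1
  to n by Taylor remainders, and the Hankel remainder (\<open>G * \<rho>\<close>). Each is a
  constant times M! s^M, the second with an additional 2^M.\<close>

lemma p24_expansion_error:
  assumes n: "n \<ge> 138" and N: "N \<ge> 1"
  shows "\<bar>real (p24 n) * (sqrt 2 * real n powr (27 / 4)) / exp (4 * pi * sqrt (real n))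
      - (\<Sum>m=0..N. B_tilde m / real n powr (real m / 2))\<bar> \<le> E_total N * real n powr (- (real N + 1) / 2)"
proof -
  define M where "M = N + 1"
  define t where "t = sqrt (real n)"
  define s where "s = 1 / t"
  define \<nu> where "\<nu> = real n - 1"
  define r where "r = sqrt (1 - s\<^sup>2)"
  define x where "x = 4 * pi * sqrt \<nu>"
  have "11 \<le> t" unfolding t_def using n by (intro real_le_rsqrt) auto
  hence t: "t \<ge> 11" "t > 0" by auto
  have s: "0 < s" "s \<le> 1 / 11" using t by (auto simp: s_def divide_simps)
  have n_t: "real n = t\<^sup>2" by (simp add: t_def)
  have \<nu>: "\<nu> > 0" using n by (simp add: \<nu>_def)
  have \<nu>_t: "\<nu> = t\<^sup>2 * (1 - s\<^sup>2)" using t by (simp add: \<nu>_def n_t s_def power_divide right_diff_distrib)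
  have s2: "s\<^sup>2 \<le> 1 / 121" using power_mono[of s "1 / 11" 2] s by (simp add: power_divide)
  have r: "r > 0" "r\<^sup>2 = 1 - s\<^sup>2" using s2 by (auto simp: r_def)
  \<comment> \<open>Then 2 x >= 14 / s, so that (2 x)^M absorbs the 14^M from the Pochhammer bound
    in the Hankel remainder.\<close>
  have r_ge: "7 / (4 * pi) \<le> r"
  proof -
    have "7 / (4 * pi) \<le> 7 / (4 * 3)" using pi_gt3 by (intro frac_le) auto
    also have "\<dots> \<le> r" unfolding r_def using s2 by (intro real_le_rsqrt) (auto simp: power2_eq_square)
    finally show ?thesis .
  qed
  have sqrt_\<nu>: "sqrt \<nu> = t * r" unfolding \<nu>_t r_def using t by (simp add: real_sqrt_mult)
  have inv_x: "1 / x = (s / r) / (4 * pi)" using t r by (simp add: x_def sqrt_\<nu> s_def)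
  have x: "x > 0" using \<nu> by (simp add: x_def)
  obtain \<rho> where \<rho>: "\<bar>\<rho>\<bar> \<le> 6000 * pochhammer (27 / 2) M / (2 * x) ^ M"
    and main: "bessel_main \<nu> =
      exp x / (sqrt 2 * \<nu> powr (27 / 4)) * ((\<Sum>k<M. (-1) ^ k * a13 k / x ^ k) + \<rho>)"
    using main_term_expansion[OF \<nu>, of M] unfolding x_def by blast
  have hankel: "(\<Sum>k<M. (-1) ^ k * a13 k / x ^ k) = (\<Sum>k<M. hankel_coeff k * (s / r) ^ k)"
  proof (intro sum.cong refl)
    fix k
    have "1 / x ^ k = (s / r) ^ k / (4 * pi) ^ k"
      by (simp only: power_one_over[symmetric] inv_x power_divide[of "s / r"])
    thus "(-1) ^ k * a13 k / x ^ k = hankel_coeff k * (s / r) ^ k"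
      by (simp add: hankel_coeff_def divide_inverse mult_ac)
  qed
  define G where "G = exp (- (4 * pi * (s / (1 + r)))) * (1 - s\<^sup>2) powr (- 27 / 4)"
  define c where "c = sqrt 2 * real n powr (27 / 4) / exp (4 * pi * t)"
  have c: "c * (exp x / (sqrt 2 * \<nu> powr (27 / 4))) = G"
  proof -
    \<comment> \<open>Both sides are sqrt n - sqrt(n-1), since t r = sqrt(n-1).\<close>
    have e0: "s / (1 + r) = t * (1 - r)"
    proof -
      have "(1 - r) * (1 + r) = s\<^sup>2" using r by (simp add: algebra_simps power2_eq_square)
      hence "1 - r = s\<^sup>2 / (1 + r)" using r by (simp add: field_simps)
      thus ?thesis using t by (simp add: s_def power2_eq_square)
    qed
    have "- (4 * pi * (s / (1 + r))) = x - 4 * pi * t"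
      unfolding e0 x_def sqrt_\<nu> by (simp add: algebra_simps)
    hence e: "exp (- (4 * pi * (s / (1 + r)))) = exp x / exp (4 * pi * t)" by (simp only: exp_diff)
    have p: "\<nu> powr (27 / 4) = real n powr (27 / 4) * (1 - s\<^sup>2) powr (27 / 4)"
      unfolding \<nu>_t n_t using s2 by (intro powr_mult)
    have "(- 27 / 4 :: real) = - (27 / 4)" by simp
    hence q: "(1 - s\<^sup>2) powr (- 27 / 4) = 1 / (1 - s\<^sup>2) powr (27 / 4)" by (simp only: powr_minus inverse_eq_divide)
    have aux: "k * p / E * (X / (k * (p * q))) = X / E * (1 / q)" if "k > 0" "p > 0" for k p q X E :: real
      using that by simp
    show ?thesis unfolding c_def G_def e p q by (rule aux) (use n in simp_all)
  qed
  have G: "0 \<le> G" "G \<le> 8"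
  proof -
    show "0 \<le> G" by (simp add: G_def)
    have "(1 - s\<^sup>2) powr (- 27 / 4) \<le> (3 / 4) powr (- 27 / 4)" using s2 by (intro powr_mono2') auto
    also have "\<dots> \<le> 8" by (rule three_quarters_powr_le)
    finally have "exp (- (4 * pi * (s / (1 + r)))) * (1 - s\<^sup>2) powr (- 27 / 4) \<le> 1 * 8"
      using s r by (intro mult_mono) auto
    thus "G \<le> 8" by (simp add: G_def)
  qed
  have B: "(\<Sum>m=0..N. B_tilde m / real n powr (real m / 2)) = (\<Sum>m<M. B_tilde m * s ^ m)"
  proof (intro sum.cong)
    show "{0..N} = {..<M}" by (auto simp: M_def)
    fix m
    have "real n powr (real m / 2) = t ^ m"
      using t unfolding n_t by (simp add: powr_powr flip: powr_realpow powr_numeral)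
    thus "B_tilde m / real n powr (real m / 2) = B_tilde m * s ^ m"
      by (simp add: s_def power_divide)
  qed
  have nM: "real n powr (- (real N + 1) / 2) = s ^ M"
  proof -
    have n2: "real n = t powr 2" using t by (simp add: n_t powr_numeral)
    have "real n powr (- (real N + 1) / 2) = t powr (2 * (- (real N + 1) / 2))"
      by (simp only: n2 powr_powr)
    also have "2 * (- (real N + 1) / 2) = - real M" by (simp add: M_def)
    finally have "real n powr (- (real N + 1) / 2) = t powr (- real M)" .
    thus ?thesis using t by (simp add: powr_minus powr_realpow s_def power_one_over inverse_eq_divide)
  qed
  define D where "D = real (p24 n) - bessel_main \<nu>"
  have cpos: "c > 0" using n by (simp add: c_def)
  have "real (p24 n) * (sqrt 2 * real n powr (27 / 4)) / exp (4 * pi * t) = c * real (p24 n)"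
    by (simp add: c_def)
  also have "\<dots> = c * D + (c * (exp x / (sqrt 2 * \<nu> powr (27 / 4)))) * ((\<Sum>k<M. (-1) ^ k * a13 k / x ^ k) + \<rho>)"
  proof -
    have "c * real (p24 n) = c * D + c * (bessel_main \<nu>)"
      unfolding D_def by (simp only: right_diff_distrib diff_add_cancel)
    thus ?thesis unfolding main by (simp only: mult.assoc)
  qed
  also have "\<dots> = c * D + (G * (\<Sum>k<M. hankel_coeff k * (s / r) ^ k) + G * \<rho>)"
    unfolding c hankel by (simp only: distrib_left)
  finally have eq: "real (p24 n) * (sqrt 2 * real n powr (27 / 4)) / exp (4 * pi * t) - (\<Sum>m<M. B_tilde m * s ^ m) =
      c * D + (G * (\<Sum>k<M. hankel_coeff k * (s / r) ^ k) - (\<Sum>m<M. B_tilde m * s ^ m)) + G * \<rho>" by simp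
  let ?F = "fact M * s ^ M :: real"
  have F0: "?F \<ge> 0" using s by simp
  have e1: "\<bar>c * D\<bar> \<le> 10 ^ 6 * ?F"
  proof -
    have "\<bar>D\<bar> \<le> 200 * exp (5 / 2 * pi * sqrt \<nu>)"
      unfolding D_def \<nu>_def by (rule p24_bessel_estimate) (use n in simp)
    also have "\<dots> \<le> 200 * exp (5 / 2 * pi * t)" by (simp add: t_def \<nu>_def)
    finally have "\<bar>c * D\<bar> \<le> c * (200 * exp (5 / 2 * pi * t))"
      unfolding abs_mult using cpos by simp
    also have "\<dots> = sqrt 2 * t powr (27 / 2) / exp (4 * pi * t) * (200 * exp (5 / 2 * pi * t))"
      unfolding c_def n_t using t by (simp add: powr_powr flip: powr_numeral)
    also have "\<dots> \<le> 10 ^ 6 * fact M / t ^ M"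
      by (rule exponential_error_bound) (use t in simp)
    also have "\<dots> = 10 ^ 6 * ?F" by (simp add: s_def power_divide)
    finally show ?thesis .
  qed
  have e2: "\<bar>G * (\<Sum>k<M. hankel_coeff k * (s / r) ^ k) - (\<Sum>m<M. B_tilde m * s ^ m)\<bar> \<le> 3 * 10 ^ 7 * (2 ^ M * ?F)"
    using expansion_main_error[of s M] s unfolding G_def r_def by (simp add: power_mult_distrib mult_ac)
  have e3: "\<bar>G * \<rho>\<bar> \<le> 48000 * ?F"
  proof -
    have "1 / x ^ M \<le> (s / 7) ^ M"
    proof -
      have "1 / x = s / (4 * pi * r)" by (simp add: inv_x)
      also have "\<dots> \<le> s / 7" using s r_ge by (intro divide_left_mono) (auto simp: field_simps r)
      finally have "(1 / x) ^ M \<le> (s / 7) ^ M" using x by (intro power_mono) auto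
      thus ?thesis by (simp add: power_one_over)
    qed
    hence "pochhammer (27 / 2) M * (1 / x ^ M) \<le> (14 ^ M * fact M) * (s / 7) ^ M"
      using x by (intro mult_mono pochhammer_27_le) auto
    also have "\<dots> = 2 ^ M * ?F"
    proof -
      have "(14 :: real) ^ M = 2 ^ M * 7 ^ M" by (simp flip: power_mult_distrib)
      thus ?thesis by (simp add: power_divide)
    qed
    finally have "pochhammer (27 / 2) M * (1 / x ^ M) / 2 ^ M \<le> 2 ^ M * ?F / 2 ^ M" by (intro divide_right_mono) auto
    hence "6000 * (pochhammer (27 / 2) M * (1 / x ^ M) / 2 ^ M) \<le> 6000 * ?F" by simp
    moreover have "6000 * pochhammer (27 / 2) M / (2 * x) ^ M = 6000 * (pochhammer (27 / 2) M * (1 / x ^ M) / 2 ^ M)"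
      by (simp add: power_mult_distrib)
    ultimately have "\<bar>\<rho>\<bar> \<le> 6000 * ?F" using \<rho> by linarith
    hence "\<bar>G\<bar> * \<bar>\<rho>\<bar> \<le> 8 * (6000 * ?F)" using G by (intro mult_mono) auto
    thus ?thesis by (simp add: abs_mult)
  qed
  have two: "1 \<le> (2 :: real) ^ M" by simp
  \<comment> \<open>N >= 1 gives M >= 2, and (21/2)^2 > 110: this gap between the bases 2 and 21
    absorbs the constant 4 * 10^7.\<close>
  have pw: "110 * 2 ^ M \<le> (21 :: real) ^ M"
  proof -
    have "(110 :: real) \<le> (21 / 2) ^ 2" by (simp add: power2_eq_square)
    also have "\<dots> \<le> (21 / 2) ^ M" using N by (intro power_increasing) (auto simp: M_def)
    finally show ?thesis by (simp add: power_divide field_simps)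
  qed
  have "\<bar>c * D + (G * (\<Sum>k<M. hankel_coeff k * (s / r) ^ k) - (\<Sum>m<M. B_tilde m * s ^ m)) + G * \<rho>\<bar>
      \<le> 10 ^ 6 * ?F + 3 * 10 ^ 7 * (2 ^ M * ?F) + 48000 * ?F"
    using e1 e2 e3 by linarith
  also have "\<dots> \<le> 4 * 10 ^ 7 * (2 ^ M * ?F)"
  proof -
    have "?F \<le> 2 ^ M * ?F" using mult_right_mono[OF two F0] by (simp only: mult_1)
    moreover have "10 ^ 6 * F + 3 * 10 ^ 7 * Q + 48000 * F \<le> 4 * 10 ^ 7 * Q" if "0 \<le> F" "F \<le> Q" for F Q :: real
      using that by simp
    ultimately show ?thesis using F0 by blast
  qed
  also have "\<dots> = (4 * 10 ^ 7 / 110) * ((110 * 2 ^ M) * ?F)" by simp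
  also have "\<dots> \<le> 10 ^ 7 * (21 ^ M * ?F)"
    using pw F0 by (intro mult_mono mult_right_mono) auto
  also have "\<dots> = (10 ^ 7 * 21 ^ (N + 1) * fact (N + 1)) * s ^ M" by (simp only: M_def mult.assoc)
  also have "\<dots> \<le> E_total N * s ^ M" using s by (intro mult_right_mono E_total_ge N) auto
  finally show ?thesis unfolding B nM t_def[symmetric] eq .
qed

theorem theorem1p1:
  shows "\<exists>R :: nat \<Rightarrow> nat \<Rightarrow> real. \<forall>N \<ge> 1. \<forall>n. int n \<ge> n_threshold N \<longrightarrow>
    real (p24 n) =
      exp (4 * pi * sqrt (real n)) / (sqrt 2 * real n powr (27/4)) *
        ((\<Sum>m = 0..N. B_tilde m / real n powr (real m / 2)) + R N n)
    \<and> \<bar>R N n\<bar> \<le> E_total N * real n powr (- (real N + 1) / 2)"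
proof (intro exI allI impI conjI)
  \<comment> \<open>The remainder is the normalised deviation itself, so the identity holds by
    construction and only the bound has content.\<close>
  let ?R = "\<lambda>N n. real (p24 n) * (sqrt 2 * real n powr (27 / 4)) / exp (4 * pi * sqrt (real n))
      - (\<Sum>m=0..N. B_tilde m / real n powr (real m / 2))"
  fix N n :: nat
  assume N: "N \<ge> 1" and "int n \<ge> n_threshold N"
  hence n: "n \<ge> 138" by (simp add: n_threshold_def)
  hence "sqrt 2 * real n powr (27 / 4) > 0" by simp
  with n show "real (p24 n) = exp (4 * pi * sqrt (real n)) / (sqrt 2 * real n powr (27/4)) *
        ((\<Sum>m = 0..N. B_tilde m / real n powr (real m / 2)) + ?R N n)" by simp
  show "\<bar>?R N n\<bar> \<le> E_total N * real n powr (- (real N + 1) / 2)"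
    by (rule p24_expansion_error[OF n N])
qed

end
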